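(* For every integer $n\ge 1$ and every proper density $f\in PD_n$ (resp. $g\in PD_{n-1}$) there exists a constant $c_B(n,f)>0$ (resp. $c_S(n,g)>0$) such that for every $n$-dimensional Hilbert geometry $(\mathcal{C},d_{\mathcal{C}})$, every point $x\in\mathcal{C}$ and every real $r\ge 0$, $$c_B(n,f)\,r^n\le \mu_{f,\mathcal{C}}\bigl(B_{\mathcal{C}}(x,r)\bigr)\qquad\Bigl(\text{resp. } c_S(n,g)\,r^{n-1}\le \mathrm{Area}_{g,\mathcal{C}}\bigl(S_{\mathcal{C}}(x,r)\bigr)\Bigr).$$
   Context: An $n$-dimensional Hilbert geometry $(\mathcal{C},d_{\mathcal{C}})$ is a nonempty open convex set $\mathcal{C}\subset\mathbb{R}^n$ that contains no whole line (a properly open convex set), endowed with the Hilbert distance: $d_{\mathcal{C}}(p,p)=0$, and for distinct $p,q\in\mathcal{C}$, if the line $pq$ meets $\partial\mathcal{C}$ at $a,b$ with $a,p,q,b$ in this order on the line, $$d_{\mathcal{C}}(p,q)=\frac12\ln\left(\frac{\|q-a\|}{\|p-a\|}\cdot\frac{\|p-b\|}{\|q-b\|}\right),$$ where $\|\cdot\|$ is the Euclidean norm; if $a$ or $b$ is at infinity the corresponding ratio is taken equal to $1$. $B_{\mathcal{C}}(x,r)$ and $S_{\mathcal{C}}(x,r)$ are the metric ball and metric sphere of radius $r$ centred at $x$ for $d_{\mathcal{C}}$. Proper densities: let $\mathcal{E}_n$ be the set of pairs $(\omega,x)$ with $\omega\subset\mathbb{R}^n$ a properly open convex set and $x\in\omega$.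 A function $f:\mathcal{E}_n\to(0,+\infty)$ is a proper density if it is (i) continuous for the pointed Hausdorff topology on $\mathcal{E}_n$ ($(\omega_k,x_k)\to(\omega,x)$ when $x_k\to x$ and the closures of $\omega_k$ converge to that of $\omega$ in the Hausdorff sense on bounded regions); (ii) monotone decreasing: if $x\in\omega\subset\Omega$ then $f(\Omega,x)\le f(\omega,x)$; (iii) chain rule compatible: for every projective transformation $T$ (defined on $\omega$, with $T(\omega)$ properly open convex in $\mathbb{R}^n$), $f(T(\omega),T(x))\,\mathrm{Jac}(T)=f(\omega,x)$, where $\mathrm{Jac}(T)$ is the absolute value of the Jacobian determinant of $T$ at $x$. $PD_n$ denotes the set of proper densities on $\mathcal{E}_n$. For $f\in PD_n$, $\mu_{f,\mathcal{C}}$ is the Borel measure $\mu_{f,\mathcal{C}}(A)=\int_A f(\mathcal{C},p)\,d\mathrm{Leb}(p)$ on $\mathcal{C}$. For $g\in PD_{n-1}$ and a hypersurface $S\subset\mathcal{C}$ with tangent hyperplane $H(p)$ at $p\in S$, the $(n-1)$-dimensional measure $\mathrm{Area}_{g,\mathcal{C}}$ on $S$ is defined by $d\mathrm{Area}_{g,\mathcal{C}}(p)=d\mu_{g,\mathcal{C}\cap H(p)}(p)$; that is, its density at $p$ with respect to the Euclidean $(n-1)$-dimensional area of $S$ is $g(\mathcal{C}\cap H(p),p)$, where $H(p)$ is identified isometrically with $\mathbb{R}^{n-1}$. Metric balls are convex, so metric spheres have a tangent hyperplane at almost every point, which suffices for this definition. For $n=1$, $g\in PD_0$ is a positive constant,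 $\mathrm{Area}_{g,\mathcal{C}}$ is $g$ times the counting measure, and $r^{0}=1$. *)

theory Defs
  imports "HOL-Analysis.Analysis"
begin

section \<open>Properly open convex sets and the Hilbert distance\<close>

definition properly_open_convex :: "'a::euclidean_space set \<Rightarrow> bool" where
  "properly_open_convex C \<longleftrightarrow> open C \<and> convex C \<and> C \<noteq> {} \<and>
     \<not> (\<exists>p v. v \<noteq> 0 \<and> range (\<lambda>t::real. p + t *\<^sub>R v) \<subseteq> C)"

text \<open>The line through p and q, followed from p to q, leaves C at b after q.\<close>

definition exit_point :: "'a::euclidean_space set \<Rightarrow> 'a \<Rightarrow> 'a \<Rightarrow> 'a \<Rightarrow> bool" where
  "exit_point C p q b \<longleftrightarrow> b \<in> frontier C \<and> q \<in> open_segment p b"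

text \<open>
  The ratio of the distances from p and from q to the exit point; it is 1 if
  that point is at infinity.  For distinct points p, q of an open convex set there is
  at most one exit point.
\<close>

definition exit_ratio :: "'a::euclidean_space set \<Rightarrow> 'a \<Rightarrow> 'a \<Rightarrow> real" where
  "exit_ratio C p q =
     (if \<exists>b. exit_point C p q b
      then (let b = (THE b. exit_point C p q b) in norm (p - b) / norm (q - b))
      else 1)"

definition hilbert_dist :: "'a::euclidean_space set \<Rightarrow> 'a \<Rightarrow> 'a \<Rightarrow> real" where
  "hilbert_dist C p q =
     (if p = q then 0 else 1 / 2 * ln (exit_ratio C q p * exit_ratio C p q))"

definition hilbert_ball :: "'a::euclidean_space set \<Rightarrow> 'a \<Rightarrow> real \<Rightarrow> 'a set" where
  "hilbert_ball C x r = {y \<in> C. hilbert_dist C x y < r}"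

definition hilbert_sphere :: "'a::euclidean_space set \<Rightarrow> 'a \<Rightarrow> real \<Rightarrow> 'a set" where
  "hilbert_sphere C x r = {y \<in> C. hilbert_dist C x y = r}"


section \<open>Proper densities\<close>

definition pointed_convex_sets :: "('a::euclidean_space set \<times> 'a) set" where
  "pointed_convex_sets = {(\<omega>, x). properly_open_convex \<omega> \<and> x \<in> \<omega>}"

text \<open>Hausdorff convergence of the closures on bounded regions (Attouch-Wets convergence).\<close>

definition closures_converge :: "(nat \<Rightarrow> 'a::euclidean_space set) \<Rightarrow> 'a set \<Rightarrow> bool" where
  "closures_converge W \<omega> \<longleftrightarrow>
     (\<forall>R>0. \<forall>\<epsilon>>0. \<forall>\<^sub>F k in sequentially.
        closure (W k) \<inter> cball 0 R \<subseteq> (\<Union>y\<in>closure \<omega>. cball y \<epsilon>) \<and>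
        closure \<omega> \<inter> cball 0 R \<subseteq> (\<Union>y\<in>closure (W k). cball y \<epsilon>))"

text \<open>
  A projective transformation is given, in the homogeneous coordinates (x, 1), by a
  linear automorphism L of the product with the real line; it is defined on \<omega>
  if no point of \<omega> is sent to infinity.
\<close>

definition projective_on :: "'a::euclidean_space set \<Rightarrow> ('a \<Rightarrow> 'a) \<Rightarrow> bool" where
  "projective_on \<omega> T \<longleftrightarrow>
     (\<exists>L :: 'a \<times> real \<Rightarrow> 'a \<times> real. linear L \<and> bij L \<and>
        (\<forall>x\<in>\<omega>. snd (L (x, 1)) \<noteq> 0 \<and> T x = fst (L (x, 1)) /\<^sub>R snd (L (x, 1))))"

definition Jac :: "(real^'n \<Rightarrow> real^'n) \<Rightarrow> real^'n \<Rightarrow> real" where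
  "Jac T x = \<bar>det (matrix (frechet_derivative T (at x)))\<bar>"

text \<open>
  Densities are total functions in HOL, but only their values on
  \<^const>\<open>pointed_convex_sets\<close> are constrained or used.  The pointed Hausdorff
  topology is metrizable, so continuity is sequential continuity.
\<close>

definition proper_density :: "((real^'n) set \<Rightarrow> real^'n \<Rightarrow> real) \<Rightarrow> bool" where
  "proper_density f \<longleftrightarrow>
     (\<forall>(\<omega>, x) \<in> pointed_convex_sets. 0 < f \<omega> x) \<and>
     (\<forall>W X \<omega> x. (\<forall>k. (W k, X k) \<in> pointed_convex_sets) \<longrightarrow> (\<omega>, x) \<in> pointed_convex_sets \<longrightarrow>
        X \<longlonglongrightarrow> x \<longrightarrow> closures_converge W \<omega> \<longrightarrow> (\<lambda>k. f (W k) (X k)) \<longlonglongrightarrow> f \<omega> x) \<and>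
     (\<forall>\<omega> \<Omega> x. properly_open_convex \<omega> \<longrightarrow> properly_open_convex \<Omega> \<longrightarrow> x \<in> \<omega> \<longrightarrow> \<omega> \<subseteq> \<Omega> \<longrightarrow>
        f \<Omega> x \<le> f \<omega> x) \<and>
     (\<forall>\<omega> x T. (\<omega>, x) \<in> pointed_convex_sets \<longrightarrow> projective_on \<omega> T \<longrightarrow>
        properly_open_convex (T ` \<omega>) \<longrightarrow> f (T ` \<omega>) (T x) * Jac T x = f \<omega> x)"

definition hilbert_measure ::
  "((real^'n) set \<Rightarrow> real^'n \<Rightarrow> real) \<Rightarrow> (real^'n) set \<Rightarrow> (real^'n) measure" where
  "hilbert_measure f C = density (restrict_space lborel C) (\<lambda>p. ennreal (f C p))"


section \<open>Area of hypersurfaces\<close>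

text \<open>
  The k-dimensional Hausdorff measure, normalized to agree with Lebesgue measure on
  k-dimensional Euclidean space; for k one less than the dimension it is the
  Euclidean area on Lipschitz hypersurfaces.  The outer measure is a metric outer measure,
  hence countably additive on Borel sets, so measure-of does not collapse to the zero measure.
\<close>

definition hausdorff_gauge :: "nat \<Rightarrow> 'a::euclidean_space set \<Rightarrow> ennreal" where
  "hausdorff_gauge k U =
     (if U = {} then 0 else ennreal (unit_ball_vol (real k) * (diameter U / 2) ^ k))"

definition hausdorff_outer :: "nat \<Rightarrow> 'a::euclidean_space set \<Rightarrow> ennreal" where
  "hausdorff_outer k A =
     (SUP \<delta>\<in>{0::real<..}. INF U\<in>{U :: nat \<Rightarrow> 'a set.
        A \<subseteq> (\<Union>i. U i) \<and> (\<forall>i. bounded (U i) \<and> diameter (U i) \<le> \<delta>)}.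
          (\<Sum>i. hausdorff_gauge k (U i)))"

definition hausdorff_measure :: "nat \<Rightarrow> 'a::euclidean_space measure" where
  "hausdorff_measure k = measure_of UNIV (sets borel) (hausdorff_outer k)"

definition tangent_hyperplane ::
  "'a::euclidean_space set \<Rightarrow> 'a \<Rightarrow> 'a set \<Rightarrow> bool" where
  "tangent_hyperplane S p H \<longleftrightarrow>
     (\<exists>\<nu>. \<nu> \<noteq> 0 \<and> H = {q. \<nu> \<bullet> (q - p) = 0} \<and>
        ((\<lambda>q. (\<nu> \<bullet> (q - p)) / norm (q - p)) \<longlongrightarrow> 0) (at p within S))"

text \<open>
  The value of the density g at (C \<inter> H, p), with the hyperplane H identified with
  the lower-dimensional Euclidean space by an isometric parametrization \<phi>.  For a
  proper density the value does not depend on \<phi>: two choices differ by an isometry,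
  which is a projective transformation with Jacobian 1.
\<close>

definition slice_density ::
  "((real^'m) set \<Rightarrow> real^'m \<Rightarrow> real) \<Rightarrow> (real^'n) set \<Rightarrow> (real^'n) set \<Rightarrow> real^'n \<Rightarrow> real" where
  "slice_density g C H p =
     (let \<phi> = (SOME \<phi> :: real^'m \<Rightarrow> real^'n.
                 (\<forall>u v. dist (\<phi> u) (\<phi> v) = dist u v) \<and> range \<phi> = H)
      in g (\<phi> -` C) (inv \<phi> p))"

text \<open>
  Points of S without a well-defined tangent hyperplane get density 0; on a Hilbert
  sphere they form a null set.  Meant for types with \<open>CARD('n) = CARD('m) + 1\<close>.
\<close>

definition hilbert_area ::
  "((real^'m) set \<Rightarrow> real^'m \<Rightarrow> real) \<Rightarrow> (real^'n) set \<Rightarrow> (real^'n) set \<Rightarrow> ennreal" where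
  "hilbert_area g C S =
     (\<integral>\<^sup>+ p\<in>S. (if \<exists>!H. tangent_hyperplane S p H
                  then ennreal (slice_density g C (THE H. tangent_hyperplane S p H) p)
                  else 0) \<partial>hausdorff_measure CARD('m))"

text \<open>
  A type \<open>real^'m\<close> has positive dimension, so hypersurfaces of the line are treated
  separately: a proper density in dimension 0 is a positive constant g.
\<close>

definition hilbert_area_line :: "real \<Rightarrow> 'a set \<Rightarrow> ennreal" where
  "hilbert_area_line g S = ennreal g * emeasure (count_space UNIV) S"

end

theory Submission
  imports Defs
begin

text \<open>
  A function \<open>\<zeta>\<close> that is affine and positive on \<open>C\<close> satisfies \<open>\<zeta> p \<le> exit_ratio C p q * \<zeta> q\<close>, with
  equality for some \<open>\<zeta>\<close>; so the Hilbert distance is governed by affine functions, which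
  are treated as functionals on \<open>(y, 1)\<close>. Level sets of such a function vanishing at a boundary point
  are far apart, and induction on the dimension gives at least \<open>N\<^sup>n\<close> separated points in a ball and
  \<open>N\<^sup>n\<^sup>-\<^sup>1\<close> on a sphere, with \<open>N\<close> proportional to \<open>r / \<rho>\<close> and \<open>\<rho> = min 1 r\<close>.

  It remains to bound from below the measure of a ball of radius \<open>\<rho>\<close>, and the area of the part of the sphere in
  such a ball around one of its points \<open>p\<close>, by a multiple of \<open>\<rho>\<close> to the dimension. Monotonicity and the
  chain rule allow one to replace \<open>C\<close> by a simplex, given by functionals of maximal determinant among the
  admissible ones; there the density is explicit, and \<open>C\<close> is comparable to the simplex near \<open>p\<close>.
  For the sphere, one projects from a point on the line through the centre and \<open>p\<close>; the image contains a cube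
  of size \<open>\<rho>\<close> by the intermediate value theorem, and the Jacobian of the projection restricted to the tangent
  hyperplane bounds the density from below.
\<close>

section \<open>Positive affine functions and the Hilbert distance\<close>

text \<open>Functionals on \<open>(y, 1)\<close> can also be evaluated at homogeneous vectors that
  are not points of the space, so the projection centre \<open>q\<close> may lie at infinity, and
  rescaling a vector changes no cross-ratio. The shape of \<open>C\<close> enters through the
  functionals positive on it: maximality of the determinant makes finitely many of them control all
  others with coefficients at most 1, at the price of a factor depending on the dimension. The
  determinant itself cancels. For volumes, the density is bounded below by a multiple of it, and the
  corresponding parallelepiped has a multiple of its inverse as volume. For areas the cancellation
  is pointwise: the density on a tangent plane is at least a multiple of the Jacobian of the
  projection along that plane, so what remains is the Lebesgue measure of the projected set,
  whatever the direction of the plane. The size \<open>\<rho>\<close> cancels as well, since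
  \<open>N\<close> is of order \<open>r / \<rho>\<close> in each dimension. In the end the constants
  depend on the dimension and, through its value at the point \<open>1\<close> of
  \<open>orthant\<close>, on the density.\<close>

definition pos_affine :: "'a::euclidean_space set \<Rightarrow> ('a \<times> real) set" where
  "pos_affine C = {\<zeta>. \<forall>y\<in>C. 0 < \<zeta> \<bullet> (y, 1)}"

lemma pos_affineD: "\<zeta> \<in> pos_affine C \<Longrightarrow> y \<in> C \<Longrightarrow> 0 < \<zeta> \<bullet> (y, 1)"
  by (simp add: pos_affine_def)

lemma one_pos_affine: "(0, 1) \<in> pos_affine C"
  by (simp add: pos_affine_def)

lemma pos_affine_scaleR: "\<zeta> \<in> pos_affine C \<Longrightarrow> 0 < c \<Longrightarrow> c *\<^sub>R \<zeta> \<in> pos_affine C"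
  by (simp add: pos_affine_def)

lemma pos_affine_closure:
  assumes "\<zeta> \<in> pos_affine C" "b \<in> closure C"
  shows "0 \<le> \<zeta> \<bullet> (b, 1)"
proof (rule continuous_ge_on_closure[OF _ assms(2)])
  show "continuous_on (closure C) (\<lambda>y. \<zeta> \<bullet> (y, 1))"
    by (intro continuous_intros)
  show "\<And>y. y \<in> C \<Longrightarrow> 0 \<le> \<zeta> \<bullet> (y, 1)"
    using assms(1) by (force simp: pos_affine_def)
qed

lemma affine_eval_between:
  fixes p b :: "'a::euclidean_space"
  shows "\<zeta> \<bullet> (p + t *\<^sub>R (b - p), 1) = \<zeta> \<bullet> (p, 1) + t * (\<zeta> \<bullet> (b, 1) - \<zeta> \<bullet> (p, 1))"
  by (cases \<zeta>) (simp add: inner_right_distrib inner_diff_right algebra_simps)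

text \<open>A nonnegative affine function vanishing at a point of the open set \<open>C\<close>
  would become negative just beyond that point, seen from \<open>q\<close>.\<close>

lemma nonneg_affine_imp_pos_affine:
  fixes C :: "'a::euclidean_space set"
  assumes C: "open C" and nn: "\<And>y. y \<in> C \<Longrightarrow> 0 \<le> \<zeta> \<bullet> (y, 1)" and q: "q \<in> C" "0 < \<zeta> \<bullet> (q, 1)"
  shows "\<zeta> \<in> pos_affine C"
  unfolding pos_affine_def
proof safe
  fix y assume y: "y \<in> C"
  show "0 < \<zeta> \<bullet> (y, 1)"
  proof (rule ccontr)
    assume "\<not> ?thesis"
    with nn[OF y] have 0: "\<zeta> \<bullet> (y, 1) = 0" by simp
    obtain e where e: "e > 0" "ball y e \<subseteq> C" using C y open_contains_ball by blast
    \<comment> \<open>Negative, so that the point lies on the far side of \<open>y\<close> from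
      \<open>q\<close>; the summand 1 avoids a division by zero and still leaves the displacement
      below \<open>e\<close>.\<close>
    define t where "t = - e / (2 * (norm (q - y) + 1))"
    have np: "norm (q - y) + 1 > 0" using norm_ge_zero[of "q - y"] by linarith
    then have t0: "t < 0" using e by (simp add: t_def divide_neg_pos)
    have "norm (t *\<^sub>R (q - y)) < e"
    proof -
      have "t = - (e / (2 * (norm (q - y) + 1)))" by (simp add: t_def)
      then have "\<bar>t\<bar> = e / (2 * (norm (q - y) + 1))" using t0 by linarith
      then have "norm (t *\<^sub>R (q - y)) = e / 2 * (norm (q - y) / (norm (q - y) + 1))"
        by (simp only: norm_scaleR times_divide_times_eq times_divide_eq_left times_divide_eq_right divide_divide_eq_left mult.commute mult.left_commute)
      also have "\<dots> \<le> e / 2 * 1"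
        using e np by (intro mult_left_mono) (auto simp: divide_le_eq_1)
      also have "\<dots> < e" using e by simp
      finally show ?thesis .
    qed
    then have "y + t *\<^sub>R (q - y) \<in> C" using e(2) by (auto simp: dist_norm)
    from nn[OF this] have "0 \<le> t * (\<zeta> \<bullet> (q, 1))"
      using 0 by (simp add: affine_eval_between)
    with t0 q(2) show False by (simp add: zero_le_mult_iff)
  qed
qed

text \<open>Separation only yields a function that is nonnegative on \<open>C\<close>; moving from a
  point of \<open>C\<close> along its normal gives a point where it is positive, and openness does
  the rest.\<close>

lemma pos_affine_separation:
  fixes C :: "'a::euclidean_space set"
  assumes C: "open C" "convex C" "C \<noteq> {}" and y: "y \<notin> C"
  obtains \<zeta> where "\<zeta> \<in> pos_affine C" "\<zeta> \<bullet> (y, 1) \<le> 0"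
proof -
  have "\<exists>a b. a \<noteq> 0 \<and> (\<forall>x\<in>{y}. a \<bullet> x \<le> b) \<and> (\<forall>x\<in>C. b \<le> a \<bullet> x)"
    by (rule separating_hyperplane_sets) (use C y in auto)
  then obtain a b where ab: "a \<noteq> 0" "a \<bullet> y \<le> b" "\<And>x. x \<in> C \<Longrightarrow> b \<le> a \<bullet> x" by auto
  let ?z = "(a, - b)"
  have nn: "\<And>x. x \<in> C \<Longrightarrow> 0 \<le> ?z \<bullet> (x, 1)" using ab(3) by simp
  obtain x where x: "x \<in> C" using C by auto
  obtain e where e: "e > 0" "cball x e \<subseteq> C" using C x open_contains_cball by blast
  define q where "q = x + (e / norm a) *\<^sub>R a"
  have q: "q \<in> C" using e ab(1) by (auto simp: q_def dist_norm intro!: subsetD[OF e(2)])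
  have "a \<bullet> q = a \<bullet> x + e * norm a"
    using ab(1) by (simp add: q_def inner_right_distrib power2_norm_eq_inner[symmetric] power2_eq_square)
  then have "0 < ?z \<bullet> (q, 1)" using ab e x by (smt (verit) inner_Pair inner_real_def mult_cancel_left2 mult_pos_pos zero_less_norm_iff)
  from nonneg_affine_imp_pos_affine[OF C(1) nn q this] have "?z \<in> pos_affine C" .
  moreover have "?z \<bullet> (y, 1) \<le> 0" using ab(2) by simp
  ultimately show thesis by (rule that)
qed

lemma open_segmentE:
  assumes "x \<in> open_segment a b"
  obtains u where "0 < u" "u < 1" "x = (1 - u) *\<^sub>R a + u *\<^sub>R b" "a \<noteq> b"
proof -
  have "\<exists>u. 0 < u \<and> u < 1 \<and> x = (1 - u) *\<^sub>R a + u *\<^sub>R b" "a \<noteq> b"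
    using assms by (simp_all add: in_segment(2))
  then show thesis using that by (elim exE conjE)
qed

text \<open>Of two exit points the nearer one would lie strictly between the interior point
  \<open>q\<close> and a point of the closure, hence in the interior. So the definite description in
  \<open>exit_ratio\<close> denotes a genuine point.\<close>

lemma exit_point_unique:
  fixes C :: "'a::euclidean_space set"
  assumes C: "open C" "convex C" and q: "q \<in> C" and b: "exit_point C p q b" "exit_point C p q c"
  shows "b = c"
proof -
  have *: False if sb: "q \<in> open_segment p b" and sc: "q \<in> open_segment p c"
    and lt: "norm (b - p) < norm (c - p)" and bc: "b \<in> frontier C" "c \<in> frontier C" for b c
  proof -
    obtain s where s: "0 < s" "s < 1" "q = (1 - s) *\<^sub>R p + s *\<^sub>R b" "p \<noteq> b"
      using sb by (rule open_segmentE)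
    obtain t where t: "0 < t" "t < 1" "q = (1 - t) *\<^sub>R p + t *\<^sub>R c" "p \<noteq> c"
      using sc by (rule open_segmentE)
    have eq: "s *\<^sub>R (b - p) = t *\<^sub>R (c - p)"
      using trans[OF s(3)[symmetric] t(3)] by (simp add: algebra_simps)
    have "b - p = (1 / s) *\<^sub>R (s *\<^sub>R (b - p))" using s(1) by simp
    also have "\<dots> = (t / s) *\<^sub>R (c - p)" unfolding eq by simp
    finally have b: "b - p = (t / s) *\<^sub>R (c - p)" .
    have ts: "t / s < 1"
    proof -
      have "norm (b - p) = (t / s) * norm (c - p)" using b s(1) t(1) by simp
      with lt have "(t / s) * norm (c - p) < 1 * norm (c - p)" by simp
      then show ?thesis by (rule mult_right_less_imp_less) simp
    qed
    \<comment> \<open>The parameter of \<open>b\<close> on the segment from \<open>q\<close> to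
      \<open>c\<close>: it solves \<open>t / s = (1 - k) * t + k\<close>.\<close>
    define k where "k = (t / s - t) / (1 - t)"
    have k: "0 < k" "k < 1"
    proof -
      have "t < t / s" using s(1,2) t(1) by (simp add: field_simps)
      then show "0 < k" unfolding k_def using t(2) by (intro divide_pos_pos) linarith+
      have "t / s - t < 1 - t" using ts by linarith
      then show "k < 1" unfolding k_def using t(2) by simp
    qed
    have qp: "q - p = t *\<^sub>R (c - p)" using t(3) by (simp add: algebra_simps)
    have "b - p = (1 - k) *\<^sub>R (q - p) + k *\<^sub>R (c - p)"
    proof -
      have "k * (1 - t) = t / s - t" using t(2) by (simp add: k_def)
      then have "t / s = (1 - k) * t + k" by (simp add: algebra_simps)
      then show ?thesis unfolding b qp by (simp only: scaleR_scaleR scaleR_left_distrib[symmetric])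
    qed
    then have "b = (1 - k) *\<^sub>R q + k *\<^sub>R c" by (simp add: algebra_simps)
    moreover have "q \<noteq> c"
    proof
      assume "q = c"
      with qp have "(1 - t) *\<^sub>R (c - p) = 0" by (simp add: algebra_simps)
      with t show False by simp
    qed
    ultimately have "b \<in> open_segment q c" using k by (metis in_segment(2))
    moreover have "q \<in> interior C" "c \<in> closure C"
      using q C(1) bc(2) by (simp_all add: frontier_def interior_open)
    ultimately have "b \<in> interior C"
      using in_interior_closure_convex_segment[OF C(2)] by blast
    then show False using bc(1) C(1) by (simp add: frontier_def)
  qed
  have qb: "q \<in> open_segment p b" "q \<in> open_segment p c" "b \<in> frontier C" "c \<in> frontier C"
    using b by (auto simp: exit_point_def)
  have n: "norm (b - p) = norm (c - p)" using *[OF qb(1,2) _ qb(3,4)] *[OF qb(2,1) _ qb(4,3)] by (meson linorder_less_linear)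
  obtain s where s: "0 < s" "s < 1" "q = (1 - s) *\<^sub>R p + s *\<^sub>R b" "p \<noteq> b"
    using qb(1) by (rule open_segmentE)
  obtain t where t: "0 < t" "t < 1" "q = (1 - t) *\<^sub>R p + t *\<^sub>R c" "p \<noteq> c"
    using qb(2) by (rule open_segmentE)
  have eq: "s *\<^sub>R (b - p) = t *\<^sub>R (c - p)"
    using trans[OF s(3)[symmetric] t(3)] by (simp add: algebra_simps)
  from arg_cong[OF this, of norm] have "s * norm (b - p) = t * norm (c - p)"
    using s(1) t(1) by simp
  with n s(4) t(4) have st: "s = t" by auto
  show ?thesis using eq s(1) unfolding st by simp
qed

text \<open>The exit ratio is the best constant in the Harnack inequality for positive affine functions.\<close>

lemma exit_ratio_attained:
  fixes C :: "'a::euclidean_space set"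
  assumes C: "open C" "convex C" and pq: "p \<in> C" "q \<in> C"
  shows "(\<forall>\<zeta>\<in>pos_affine C. \<zeta> \<bullet> (p, 1) \<le> exit_ratio C p q * (\<zeta> \<bullet> (q, 1))) \<and>
         (\<exists>\<zeta>\<in>pos_affine C. \<zeta> \<bullet> (p, 1) = exit_ratio C p q * (\<zeta> \<bullet> (q, 1)))"
proof (cases "\<exists>b. exit_point C p q b")
  case True
  then obtain b where b: "exit_point C p q b" by blast
  then have "(THE b. exit_point C p q b) = b"
    using exit_point_unique[OF C pq(2)] by blast
  then have er: "exit_ratio C p q = norm (p - b) / norm (q - b)"
    using True by (simp add: exit_ratio_def)
  obtain t where t: "0 < t" "t < 1" "q = (1 - t) *\<^sub>R p + t *\<^sub>R b" "p \<noteq> b"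
    using b open_segmentE[of q p b] by (auto simp: exit_point_def)
  have q: "q = p + t *\<^sub>R (b - p)" using t(3) by (simp add: algebra_simps)
  have "q - b = (1 - t) *\<^sub>R (p - b)" using q by (simp add: algebra_simps)
  then have er': "exit_ratio C p q = 1 / (1 - t)" using t er by simp
  have bf: "b \<in> closure C" "b \<notin> C" using b C(1) by (auto simp: exit_point_def frontier_def interior_open)
  have 1: "\<zeta> \<bullet> (p, 1) \<le> exit_ratio C p q * (\<zeta> \<bullet> (q, 1))" if "\<zeta> \<in> pos_affine C" for \<zeta>
  proof -
    have "\<zeta> \<bullet> (q, 1) \<ge> (1 - t) * (\<zeta> \<bullet> (p, 1))"
      using pos_affine_closure[OF that bf(1)] t(1) unfolding q affine_eval_between
      by (simp add: algebra_simps)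
    then show ?thesis using t(2) unfolding er' by (simp add: field_simps)
  qed
  \<comment> \<open>Equality comes from a functional supporting \<open>C\<close> at the exit point:
    it vanishes at \<open>b\<close>, so its values along the line are proportional to the distances
    from \<open>b\<close>.\<close>
  obtain \<zeta> where z: "\<zeta> \<in> pos_affine C" "\<zeta> \<bullet> (b, 1) \<le> 0"
    using pos_affine_separation[OF C _ bf(2)] pq by blast
  then have z0: "\<zeta> \<bullet> (b, 1) = 0" using pos_affine_closure[OF z(1) bf(1)] by simp
  have "\<zeta> \<bullet> (p, 1) = exit_ratio C p q * (\<zeta> \<bullet> (q, 1))"
  proof -
    have "\<zeta> \<bullet> (q, 1) = (1 - t) * (\<zeta> \<bullet> (p, 1))"
      unfolding q affine_eval_between z0 by (simp add: algebra_simps)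
    then show ?thesis unfolding er' using t(2) by simp
  qed
  with 1 z(1) show ?thesis by (intro conjI ballI bexI[of _ \<zeta>])
next
  case False
  then have er: "exit_ratio C p q = 1" by (simp add: exit_ratio_def)
  have 1: "\<zeta> \<bullet> (p, 1) \<le> \<zeta> \<bullet> (q, 1)" if z: "\<zeta> \<in> pos_affine C" for \<zeta>
  proof (cases "p = q")
    case pq_ne: False
    \<comment> \<open>Without an exit point the ray beyond \<open>q\<close> stays in
      \<open>C\<close>, and a positive affine function cannot decrease along it; the constant
      function gives equality with ratio 1.\<close>
    have ray: "p + s *\<^sub>R (q - p) \<in> C" if "s > 1" for s
    proof (rule ccontr)
      assume n: "p + s *\<^sub>R (q - p) \<notin> C"
      let ?S = "closed_segment q (p + s *\<^sub>R (q - p))"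
      have "?S \<inter> frontier C \<noteq> {}"
        by (rule connected_Int_frontier) (use pq n in auto)
      then obtain b where b: "b \<in> ?S" "b \<in> frontier C" by blast
      have "b \<noteq> q" using b(2) pq(2) C(1) by (auto simp: frontier_def interior_open)
      obtain u where u: "0 \<le> u" "u \<le> 1" "b = (1 - u) *\<^sub>R q + u *\<^sub>R (p + s *\<^sub>R (q - p))"
        using b(1) by (metis in_segment(1))
      define k where "k = 1 + u * (s - 1)"
      have bk: "b = p + k *\<^sub>R (q - p)" unfolding u(3) k_def by (simp add: algebra_simps)
      have "u \<noteq> 0" using u(3) \<open>b \<noteq> q\<close> by auto
      then have k: "k > 1" using u(1) that by (simp add: k_def)
      have "q = (1 - 1 / k) *\<^sub>R p + (1 / k) *\<^sub>R b"
        unfolding bk using k by (simp add: algebra_simps)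
      moreover have "p \<noteq> b" using bk k pq_ne by auto
      moreover have "0 < 1 / k" "1 / k < 1" using k by auto
      ultimately have "q \<in> open_segment p b" by (metis in_segment(2))
      then have "exit_point C p q b" using b(2) by (simp add: exit_point_def)
      with False show False by blast
    qed
    show ?thesis
    proof (rule ccontr)
      assume "\<not> ?thesis"
      then have d: "\<zeta> \<bullet> (p, 1) - \<zeta> \<bullet> (q, 1) > 0" by simp
      \<comment> \<open>One unit of the parameter past the zero of \<open>\<zeta>\<close> on the ray
        from \<open>p\<close> through \<open>q\<close>.\<close>
      define s where "s = 1 + \<zeta> \<bullet> (p, 1) / (\<zeta> \<bullet> (p, 1) - \<zeta> \<bullet> (q, 1))"
      have "s > 1" using d pos_affineD[OF z pq(1)] by (simp add: s_def)
      from pos_affineD[OF z ray[OF this]]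
      have "0 < \<zeta> \<bullet> (p, 1) + s * (\<zeta> \<bullet> (q, 1) - \<zeta> \<bullet> (p, 1))"
        by (simp add: affine_eval_between)
      moreover have "s * (\<zeta> \<bullet> (p, 1) - \<zeta> \<bullet> (q, 1)) = (\<zeta> \<bullet> (p, 1) - \<zeta> \<bullet> (q, 1)) + \<zeta> \<bullet> (p, 1)"
        using d by (simp add: s_def field_simps)
      ultimately show False using d by (simp add: algebra_simps)
    qed
  qed auto
  have "(0, 1) \<bullet> (p, 1::real) = (0, 1) \<bullet> (q, 1::real)" by simp
  then show ?thesis
    using 1 one_pos_affine[of C] unfolding er mult_1 by (intro conjI ballI bexI[of _ "(0, 1)"])
qed

lemma exit_ratio_refl [simp]: "exit_ratio C p p = 1"
  by (simp add: exit_ratio_def exit_point_def open_segment_def)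

section \<open>The Hilbert metric in terms of positive affine functions\<close>

locale properly_convex =
  fixes C :: "'a::euclidean_space set"
  assumes proper: "properly_open_convex C"
begin

lemma open_C: "open C" and convex_C: "convex C" and C_nonempty: "C \<noteq> {}"
  using proper by (auto simp: properly_open_convex_def)

lemma no_line: "v \<noteq> 0 \<Longrightarrow> \<exists>t. p + t *\<^sub>R v \<notin> C"
  using proper unfolding properly_open_convex_def by blast

lemma exit_ratio_ge:
  "p \<in> C \<Longrightarrow> q \<in> C \<Longrightarrow> \<zeta> \<in> pos_affine C \<Longrightarrow> \<zeta> \<bullet> (p, 1) \<le> exit_ratio C p q * (\<zeta> \<bullet> (q, 1))"
  using exit_ratio_attained[OF open_C convex_C] by blast

lemma exit_ratio_attain:
  assumes "p \<in> C" "q \<in> C"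
  obtains \<zeta> where "\<zeta> \<in> pos_affine C" "\<zeta> \<bullet> (p, 1) = exit_ratio C p q * (\<zeta> \<bullet> (q, 1))"
  using exit_ratio_attained[OF open_C convex_C assms] by blast

lemma exit_ratio_ge_1: "p \<in> C \<Longrightarrow> q \<in> C \<Longrightarrow> 1 \<le> exit_ratio C p q"
  using exit_ratio_ge[OF _ _ one_pos_affine] by simp

lemma exit_ratio_le:
  assumes "p \<in> C" "q \<in> C" "\<And>\<zeta>. \<zeta> \<in> pos_affine C \<Longrightarrow> \<zeta> \<bullet> (p, 1) \<le> A * (\<zeta> \<bullet> (q, 1))"
  shows "exit_ratio C p q \<le> A"
proof -
  obtain \<zeta> where z: "\<zeta> \<in> pos_affine C" "\<zeta> \<bullet> (p, 1) = exit_ratio C p q * (\<zeta> \<bullet> (q, 1))"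
    using exit_ratio_attain assms by blast
  with assms(3)[OF z(1)] pos_affineD[OF z(1) assms(2)] show ?thesis
    by (metis mult_right_le_imp_le)
qed

lemma hilbert_dist_alt:
  "hilbert_dist C p q = 1 / 2 * ln (exit_ratio C q p * exit_ratio C p q)"
  by (simp add: hilbert_dist_def)

lemma hilbert_dist_sym: "hilbert_dist C p q = hilbert_dist C q p"
  by (simp add: hilbert_dist_alt mult.commute)

lemma hilbert_dist_refl [simp]: "hilbert_dist C p p = 0"
  by (simp add: hilbert_dist_def)

lemma hilbert_dist_le_iff:
  assumes "p \<in> C" "q \<in> C"
  shows "hilbert_dist C p q \<le> r \<longleftrightarrow> exit_ratio C q p * exit_ratio C p q \<le> exp (2 * r)"
proof -
  have "0 < exit_ratio C q p * exit_ratio C p q"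
    using exit_ratio_ge_1[OF assms] exit_ratio_ge_1[OF assms(2,1)] by (intro mult_pos_pos) auto
  then have "ln (exit_ratio C q p * exit_ratio C p q) \<le> 2 * r \<longleftrightarrow>
      exit_ratio C q p * exit_ratio C p q \<le> exp (2 * r)"
    by (metis exp_le_cancel_iff exp_ln)
  then show ?thesis unfolding hilbert_dist_alt by linarith
qed

lemma exp_hilbert_dist:
  assumes "p \<in> C" "q \<in> C"
  shows "exp (2 * hilbert_dist C p q) = exit_ratio C q p * exit_ratio C p q"
proof -
  have "0 < exit_ratio C q p * exit_ratio C p q"
    using exit_ratio_ge_1[OF assms] exit_ratio_ge_1[OF assms(2,1)] by (intro mult_pos_pos) auto
  moreover have "2 * hilbert_dist C p q = ln (exit_ratio C q p * exit_ratio C p q)"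
    unfolding hilbert_dist_alt by linarith
  ultimately show ?thesis using exp_ln by simp
qed

text \<open>Exit ratios are best constants in \<open>\<zeta> \<bullet> (p, 1) \<le> A * (\<zeta>
  \<bullet> (q, 1))\<close>, hence submultiplicative along \<open>p\<close>, \<open>q\<close>,
  \<open>s\<close>; the logarithm turns this into the triangle inequality.\<close>

lemma hilbert_dist_triangle:
  assumes "p \<in> C" "q \<in> C" "s \<in> C"
  shows "hilbert_dist C p s \<le> hilbert_dist C p q + hilbert_dist C q s"
proof -
  have *: "exit_ratio C p s \<le> exit_ratio C p q * exit_ratio C q s"
    if "p \<in> C" "q \<in> C" "s \<in> C" for p q s
  proof (rule exit_ratio_le)
    fix \<zeta> assume z: "\<zeta> \<in> pos_affine C"
    have "\<zeta> \<bullet> (p, 1) \<le> exit_ratio C p q * (\<zeta> \<bullet> (q, 1))" using exit_ratio_ge z that by blast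
    also have "\<dots> \<le> exit_ratio C p q * (exit_ratio C q s * (\<zeta> \<bullet> (s, 1)))"
      using exit_ratio_ge[OF that(2,3) z] exit_ratio_ge_1[OF that(1,2)] by (intro mult_left_mono) auto
    finally show "\<zeta> \<bullet> (p, 1) \<le> exit_ratio C p q * exit_ratio C q s * (\<zeta> \<bullet> (s, 1))"
      by (simp add: mult.assoc)
  qed (use that in auto)
  have "exit_ratio C s p * exit_ratio C p s \<le>
      (exit_ratio C s q * exit_ratio C q p) * (exit_ratio C p q * exit_ratio C q s)"
    using *[of p q s] *[of s q p] assms exit_ratio_ge_1
    by (intro mult_mono) (auto intro: order_trans[OF zero_le_one] mult_nonneg_nonneg)
  also have "\<dots> = exp (2 * (hilbert_dist C p q + hilbert_dist C q s))"
    by (simp add: distrib_left exp_add exp_hilbert_dist assms mult_ac)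
  finally show ?thesis using hilbert_dist_le_iff assms by blast
qed

text \<open>Both sides are homogeneous in \<open>\<zeta>\<close> and in \<open>\<xi>\<close>. With
  \<open>\<xi> = (0, 1)\<close> it bounds the decay of a positive affine function over the distance
  \<open>d\<close> by the factor \<open>exp (2 * d)\<close>.\<close>

lemma hilbert_dist_ge:
  assumes "p \<in> C" "q \<in> C" "\<zeta> \<in> pos_affine C" "\<xi> \<in> pos_affine C"
  shows "(\<zeta> \<bullet> (p, 1)) * (\<xi> \<bullet> (q, 1)) \<le> exp (2 * hilbert_dist C p q) * ((\<zeta> \<bullet> (q, 1)) * (\<xi> \<bullet> (p, 1)))"
proof -
  have "(\<zeta> \<bullet> (p, 1)) * (\<xi> \<bullet> (q, 1)) \<le>
      (exit_ratio C p q * (\<zeta> \<bullet> (q, 1))) * (exit_ratio C q p * (\<xi> \<bullet> (p, 1)))"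
    using assms exit_ratio_ge exit_ratio_ge_1[of p q]
    by (intro mult_mono) (auto intro!: mult_nonneg_nonneg less_imp_le[OF pos_affineD])
  then show ?thesis by (simp add: exp_hilbert_dist assms mult_ac)
qed

text \<open>Only the product of \<open>A\<close> and \<open>B\<close> is constrained, so the Harnack
  constants may be computed from arbitrary homogeneous representatives of the points.\<close>

lemma hilbert_dist_le:
  assumes "p \<in> C" "q \<in> C"
    and "\<And>\<zeta>. \<zeta> \<in> pos_affine C \<Longrightarrow> \<zeta> \<bullet> (p, 1) \<le> A * (\<zeta> \<bullet> (q, 1))"
    and "\<And>\<zeta>. \<zeta> \<in> pos_affine C \<Longrightarrow> \<zeta> \<bullet> (q, 1) \<le> B * (\<zeta> \<bullet> (p, 1))"
    and "A * B \<le> exp (2 * r)"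
  shows "hilbert_dist C p q \<le> r"
proof -
  have "exit_ratio C p q \<le> A" "exit_ratio C q p \<le> B"
    using exit_ratio_le assms by blast+
  then have "exit_ratio C q p * exit_ratio C p q \<le> B * A"
    using exit_ratio_ge_1[OF assms(1,2)] exit_ratio_ge_1[OF assms(2,1)] by (intro mult_mono) auto
  then show ?thesis using hilbert_dist_le_iff assms by (smt (verit) mult.commute)
qed

text \<open>A relative variation of at most \<open>\<sigma>\<close> gives the Harnack constants
  \<open>1 / (1 - \<sigma>)\<close> and \<open>1 + \<sigma>\<close>.\<close>

lemma hilbert_dist_near:
  assumes pq: "p \<in> C" "q \<in> C" and \<sigma>: "0 \<le> \<sigma>" "\<sigma> < 1" and r: "1 + \<sigma> \<le> exp (2 * r) * (1 - \<sigma>)"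
    and near: "\<And>\<zeta>. \<zeta> \<in> pos_affine C \<Longrightarrow> \<bar>\<zeta> \<bullet> (q, 1) - \<zeta> \<bullet> (p, 1)\<bar> \<le> \<sigma> * (\<zeta> \<bullet> (p, 1))"
  shows "hilbert_dist C p q \<le> r"
proof (rule hilbert_dist_le[OF pq, of "1 / (1 - \<sigma>)" "1 + \<sigma>"])
  fix \<zeta> assume z: "\<zeta> \<in> pos_affine C"
  have "(1 - \<sigma>) * (\<zeta> \<bullet> (p, 1)) \<le> \<zeta> \<bullet> (q, 1)" using near[OF z] by (simp add: algebra_simps)
  then show "\<zeta> \<bullet> (p, 1) \<le> 1 / (1 - \<sigma>) * (\<zeta> \<bullet> (q, 1))" using \<sigma> by (simp add: field_simps)
  show "\<zeta> \<bullet> (q, 1) \<le> (1 + \<sigma>) * (\<zeta> \<bullet> (p, 1))" using near[OF z] by (simp add: algebra_simps)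
next
  show "1 / (1 - \<sigma>) * (1 + \<sigma>) \<le> exp (2 * r)" using r \<sigma> by (simp add: field_simps)
qed

lemma mem_C_if_pos:
  assumes "\<And>\<zeta>. \<zeta> \<in> pos_affine C \<Longrightarrow> 0 < \<zeta> \<bullet> (y, 1)"
  shows "y \<in> C"
proof (rule ccontr)
  assume "y \<notin> C"
  then obtain \<zeta> where "\<zeta> \<in> pos_affine C" "\<zeta> \<bullet> (y, 1) \<le> 0"
    by (rule pos_affine_separation[OF open_C convex_C C_nonempty])
  with assms show False by fastforce
qed

text \<open>On the line through \<open>p\<close> and \<open>q\<close> the function is nonnegative at
  the two opposite points of the sphere of radius \<open>e\<close>, so its increment over the length
  \<open>e\<close> is at most its value at the centre.\<close>

lemma pos_affine_ball:
  assumes e: "ball p e \<subseteq> C" "e > 0" and q: "q \<in> ball p e" and z: "\<zeta> \<in> pos_affine C"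
  shows "\<bar>\<zeta> \<bullet> (q, 1) - \<zeta> \<bullet> (p, 1)\<bar> \<le> dist p q / e * (\<zeta> \<bullet> (p, 1))"
proof (cases "p = q")
  case False
  have cl: "cball p e \<subseteq> closure C" using e by (metis closure_ball closure_mono less_imp_neq)
  define k where "k = e / dist p q"
  have k: "k > 0" using e(2) False by (simp add: k_def)
  have "0 \<le> \<zeta> \<bullet> (p + k *\<^sub>R (q - p), 1)" "0 \<le> \<zeta> \<bullet> (p + (- k) *\<^sub>R (q - p), 1)"
    using False e by (auto intro!: pos_affine_closure[OF z subsetD[OF cl]]
      simp: k_def dist_norm norm_minus_commute)
  then have "k * \<bar>\<zeta> \<bullet> (q, 1) - \<zeta> \<bullet> (p, 1)\<bar> \<le> \<zeta> \<bullet> (p, 1)"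
    unfolding affine_eval_between by (auto simp: abs_if algebra_simps)
  then show ?thesis using e(2) False by (simp add: k_def field_simps)
qed simp

lemma hilbert_dist_small:
  assumes p: "p \<in> C" and r: "r > 0"
  shows "\<exists>\<delta>>0. ball p \<delta> \<subseteq> C \<and> (\<forall>q\<in>ball p \<delta>. hilbert_dist C p q \<le> r)"
proof -
  obtain e where e: "e > 0" "ball p e \<subseteq> C" using open_C p open_contains_ball by blast
  \<comment> \<open>The hyperbolic tangent of \<open>r\<close>, that is, the solution of
    \<open>1 + k = exp (2 * r) * (1 - k)\<close>.\<close>
  define k where "k = (exp (2 * r) - 1) / (exp (2 * r) + 1)"
  have E: "exp (2 * r) > 1" using r by simp
  have k: "0 < k" "k < 1" "1 + k = exp (2 * r) * (1 - k)"
  proof -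
    have D: "exp (2 * r) + 1 > 0" using E by linarith
    then have "k * (exp (2 * r) + 1) = exp (2 * r) - 1" by (simp add: k_def)
    then show "1 + k = exp (2 * r) * (1 - k)" by (simp add: algebra_simps)
    show "0 < k" "k < 1" using E D by (simp_all add: k_def)
  qed
  have "hilbert_dist C p q \<le> r" if q: "q \<in> ball p (k * e)" for q
  proof (rule hilbert_dist_near[of _ _ k])
    have qe: "q \<in> ball p e" using q k e by (auto intro: less_le_trans simp: mult_left_le_one_le)
    then show "q \<in> C" using e by auto
    fix \<zeta> assume z: "\<zeta> \<in> pos_affine C"
    have "\<bar>\<zeta> \<bullet> (q, 1) - \<zeta> \<bullet> (p, 1)\<bar> \<le> dist p q / e * (\<zeta> \<bullet> (p, 1))"
      by (rule pos_affine_ball[OF e(2,1) qe z])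
    also have "\<dots> \<le> k * (\<zeta> \<bullet> (p, 1))"
      using q e pos_affineD[OF z p] by (intro mult_right_mono) (auto simp: divide_le_eq)
    finally show "\<bar>\<zeta> \<bullet> (q, 1) - \<zeta> \<bullet> (p, 1)\<bar> \<le> k * (\<zeta> \<bullet> (p, 1))" .
  qed (use p k in auto)
  moreover have "ball p (k * e) \<subseteq> C" using k e by (auto intro!: subsetD[OF e(2)] less_le_trans[of _ "k*e" e] simp: mult_left_le_one_le)
  ultimately show ?thesis using k e by (intro exI[of _ "k * e"]) auto
qed

lemma continuous_on_hilbert_dist:
  assumes x: "x \<in> C" shows "continuous_on C (hilbert_dist C x)"
  unfolding continuous_on_iff
proof (intro ballI allI impI)
  fix p and e :: real assume p: "p \<in> C" and e: "e > 0"
  then obtain \<delta> where d: "\<delta> > 0" "ball p \<delta> \<subseteq> C" "\<forall>q\<in>ball p \<delta>. hilbert_dist C p q \<le> e / 2"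
    using hilbert_dist_small[OF p, of "e/2"] by auto
  have "dist (hilbert_dist C x q) (hilbert_dist C x p) < e" if "q \<in> C" "dist q p < \<delta>" for q
  proof -
    have "hilbert_dist C p q \<le> e / 2" using d that by (auto simp: dist_commute)
    then show ?thesis
      using hilbert_dist_triangle[OF x p that(1)] hilbert_dist_triangle[OF x that(1) p] e
        hilbert_dist_sym[of p q] by (auto simp: dist_real_def abs_if)
  qed
  with d(1) show "\<exists>d>0. \<forall>q\<in>C. dist q p < d \<longrightarrow> dist (hilbert_dist C x q) (hilbert_dist C x p) < e" by blast
qed

lemma open_hilbert_ball: "x \<in> C \<Longrightarrow> open (hilbert_ball C x r)"
  using continuous_open_preimage[OF continuous_on_hilbert_dist open_C open_lessThan, of x r]
  by (simp add: hilbert_ball_def Int_def vimage_def conj_commute)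

section \<open>Closed balls as intersections of half-spaces\<close>

definition closed_ball :: "'a \<Rightarrow> real \<Rightarrow> 'a set" where
  "closed_ball x r = {y \<in> C. hilbert_dist C x y \<le> r}"

text \<open>Taking the constant function for \<open>\<xi>\<close> forces
  \<open>\<zeta> \<bullet> (y, 1)\<close> to be positive, so membership in \<open>C\<close> follows
  from the inequalities. All of them are affine in \<open>y\<close>; this makes closed balls convex,
  and closed in the whole space.\<close>

lemma closed_ball_eq:
  assumes x: "x \<in> C"
  shows "closed_ball x r = {y. \<forall>\<zeta>\<in>pos_affine C. \<forall>\<xi>\<in>pos_affine C.
    (\<zeta> \<bullet> (x, 1)) * (\<xi> \<bullet> (y, 1)) \<le> exp (2 * r) * ((\<xi> \<bullet> (x, 1)) * (\<zeta> \<bullet> (y, 1)))}" (is "_ = ?R")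
proof safe
  fix y \<zeta> \<xi> assume y: "y \<in> closed_ball x r" and z: "\<zeta> \<in> pos_affine C" "\<xi> \<in> pos_affine C"
  then have y: "y \<in> C" "hilbert_dist C x y \<le> r" by (auto simp: closed_ball_def)
  have "(\<zeta> \<bullet> (x, 1)) * (\<xi> \<bullet> (y, 1)) \<le> exp (2 * hilbert_dist C x y) * ((\<zeta> \<bullet> (y, 1)) * (\<xi> \<bullet> (x, 1)))"
    by (rule hilbert_dist_ge[OF x y(1) z])
  also have "\<dots> \<le> exp (2 * r) * ((\<zeta> \<bullet> (y, 1)) * (\<xi> \<bullet> (x, 1)))"
    using y(2) x y(1) z by (intro mult_right_mono) (auto intro!: mult_nonneg_nonneg less_imp_le[OF pos_affineD])
  finally show "(\<zeta> \<bullet> (x, 1)) * (\<xi> \<bullet> (y, 1)) \<le> exp (2 * r) * ((\<xi> \<bullet> (x, 1)) * (\<zeta> \<bullet> (y, 1)))"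
    by (simp add: mult_ac)
next
  fix y assume *: "\<forall>\<zeta>\<in>pos_affine C. \<forall>\<xi>\<in>pos_affine C.
    (\<zeta> \<bullet> (x, 1)) * (\<xi> \<bullet> (y, 1)) \<le> exp (2 * r) * ((\<xi> \<bullet> (x, 1)) * (\<zeta> \<bullet> (y, 1)))"
  have yC: "y \<in> C"
  proof (rule mem_C_if_pos)
    fix \<zeta> assume z: "\<zeta> \<in> pos_affine C"
    have "0 < \<zeta> \<bullet> (x, 1)" by (rule pos_affineD[OF z x])
    also have "\<dots> \<le> exp (2 * r) * (\<zeta> \<bullet> (y, 1))"
      using *[rule_format, OF z one_pos_affine] by simp
    finally show "0 < \<zeta> \<bullet> (y, 1)" by (simp add: zero_less_mult_iff)
  qed
  obtain \<zeta> where z: "\<zeta> \<in> pos_affine C" "\<zeta> \<bullet> (x, 1) = exit_ratio C x y * (\<zeta> \<bullet> (y, 1))"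
    using exit_ratio_attain x yC by blast
  obtain \<xi> where xi: "\<xi> \<in> pos_affine C" "\<xi> \<bullet> (y, 1) = exit_ratio C y x * (\<xi> \<bullet> (x, 1))"
    using exit_ratio_attain x yC by blast
  have "(exit_ratio C y x * exit_ratio C x y) * ((\<xi> \<bullet> (x, 1)) * (\<zeta> \<bullet> (y, 1))) \<le>
    exp (2 * r) * ((\<xi> \<bullet> (x, 1)) * (\<zeta> \<bullet> (y, 1)))"
    using *[rule_format, OF z(1) xi(1)] by (simp only: z xi mult_ac)
  moreover have "0 < (\<xi> \<bullet> (x, 1)) * (\<zeta> \<bullet> (y, 1))"
    using z xi x yC by (intro mult_pos_pos pos_affineD)
  ultimately have "exit_ratio C y x * exit_ratio C x y \<le> exp (2 * r)"
    by (metis mult_right_le_imp_le)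
  then show "y \<in> closed_ball x r"
    using hilbert_dist_le_iff[OF x yC] yC by (simp add: closed_ball_def)
qed

lemma closed_ball_halfspaces:
  assumes "x \<in> C"
  shows "closed_ball x r = (\<Inter>\<zeta>\<in>pos_affine C. \<Inter>\<xi>\<in>pos_affine C.
    {y. ((\<zeta> \<bullet> (x, 1)) *\<^sub>R fst \<xi> - (exp (2 * r) * (\<xi> \<bullet> (x, 1))) *\<^sub>R fst \<zeta>) \<bullet> y
       \<le> exp (2 * r) * (\<xi> \<bullet> (x, 1)) * snd \<zeta> - (\<zeta> \<bullet> (x, 1)) * snd \<xi>})"
proof -
  have 1: "w \<bullet> (y, 1) = fst w \<bullet> y + snd w" for w :: "'a \<times> real" and y
    by (cases w) simp
  have 2: "(a * (\<xi> \<bullet> (y, 1)) \<le> e * (b * (\<zeta> \<bullet> (y, 1)))) \<longleftrightarrow>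
    (a *\<^sub>R fst \<xi> - (e * b) *\<^sub>R fst \<zeta>) \<bullet> y \<le> e * b * snd \<zeta> - a * snd \<xi>"
    for \<zeta> \<xi> :: "'a \<times> real" and y and a b e :: real
    unfolding 1 by (simp add: inner_diff_left algebra_simps)
  show ?thesis unfolding closed_ball_eq[OF assms] 2 by blast
qed

lemma convex_closed_ball: "x \<in> C \<Longrightarrow> convex (closed_ball x r)"
  unfolding closed_ball_halfspaces by (intro convex_INT ballI convex_halfspace_le)

lemma closed_closed_ball: "x \<in> C \<Longrightarrow> closed (closed_ball x r)"
  unfolding closed_ball_halfspaces by (intro closed_INT ballI closed_halfspace_le)

end

section \<open>Sections and packings\<close>

context properly_convex begin

text \<open>Found on the boundary of the intersection of \<open>C\<close> with its reflection in
  \<open>y\<close>, such a point is an end of the chord that is not farther from \<open>y\<close>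
  than the other end. Since its mirror image lies in the closure, a positive affine function is at
  this end at most twice its value at \<open>y\<close>.\<close>

lemma chord_end:
  assumes y: "y \<in> C" and v: "v \<noteq> 0"
  obtains t where "y + t *\<^sub>R v \<in> closure C" "y - t *\<^sub>R v \<in> closure C" "y + t *\<^sub>R v \<notin> C"
proof -
  define C' where "C' = C \<inter> (\<lambda>z. 2 *\<^sub>R y - z) -` C"
  have "open C'" unfolding C'_def
    by (intro open_Int open_C open_vimage continuous_intros)
  obtain T where T: "y + T *\<^sub>R v \<notin> C" using no_line[OF v] by blast
  let ?S = "closed_segment y (y + T *\<^sub>R v)"
  have "?S \<inter> frontier C' \<noteq> {}"
  proof (rule connected_Int_frontier)
    have "y \<in> C'" using y by (simp add: C'_def scaleR_2)
    then show "?S \<inter> C' \<noteq> {}" by auto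
    have "y + T *\<^sub>R v \<in> ?S - C'" using T by (simp add: C'_def)
    then show "?S - C' \<noteq> {}" by blast
  qed simp
  then obtain b where b: "b \<in> ?S" "b \<in> frontier C'" by blast
  obtain s where s: "b = y + s *\<^sub>R v"
  proof -
    obtain u where "b = (1 - u) *\<^sub>R y + u *\<^sub>R (y + T *\<^sub>R v)" using b(1) by (auto simp: in_segment(1))
    then have "b = y + (u * T) *\<^sub>R v" by (simp add: algebra_simps)
    then show thesis by (rule that)
  qed
  have bC': "b \<notin> C'" "b \<in> closure C'"
    using b(2) \<open>open C'\<close> by (auto simp: frontier_def interior_open)
  have "closure C' \<subseteq> closure C \<inter> (\<lambda>z. 2 *\<^sub>R y - z) -` closure C"
  proof (rule closure_minimal)
    show "C' \<subseteq> closure C \<inter> (\<lambda>z. 2 *\<^sub>R y - z) -` closure C"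
      using closure_subset[of C] by (auto simp: C'_def)
    show "closed (closure C \<inter> (\<lambda>z. 2 *\<^sub>R y - z) -` closure C)"
      by (intro closed_Int closed_vimage continuous_intros closed_closure)
  qed
  then have cl: "y + s *\<^sub>R v \<in> closure C" "y - s *\<^sub>R v \<in> closure C"
    using bC'(2) by (auto simp: s scaleR_2)
  have "y + s *\<^sub>R v \<notin> C \<or> y - s *\<^sub>R v \<notin> C" using bC'(1) by (auto simp: C'_def s scaleR_2)
  then show thesis
  proof
    assume "y + s *\<^sub>R v \<notin> C" with cl show thesis by (rule that)
  next
    assume "y - s *\<^sub>R v \<notin> C" with cl show thesis using that[of "- s"] by simp
  qed
qed

text \<open>Run from \<open>y\<close> towards the nearer end \<open>b\<close> of a chord, where
  \<open>\<zeta>\<close> vanishes. The point at which \<open>\<zeta>\<close> has dropped by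
  \<open>exp (- \<sigma>)\<close> is within distance \<open>\<sigma>\<close>, uniformly in
  \<open>C\<close> and \<open>y\<close>: every positive functional drops by at most that factor, and
  grows by at most \<open>2 - exp (- \<sigma>)\<close>.\<close>

lemma slice_points:
  assumes M: "affine M" and y: "y \<in> M" "y \<in> C" and y': "y' \<in> M" "y' \<noteq> y"
  obtains \<zeta> b where "\<zeta> \<in> pos_affine C" "b \<in> M" "\<zeta> \<bullet> (b, 1) = 0"
    "\<And>\<sigma>. 0 \<le> \<sigma> \<Longrightarrow> \<exists>z. z \<in> M \<and> z \<in> C \<and> \<zeta> \<bullet> (z, 1) = exp (- \<sigma>) * (\<zeta> \<bullet> (y, 1)) \<and>
        hilbert_dist C y z \<le> \<sigma>"
proof -
  obtain t where t: "y + t *\<^sub>R (y' - y) \<in> closure C" "y - t *\<^sub>R (y' - y) \<in> closure C"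
    "y + t *\<^sub>R (y' - y) \<notin> C"
    using chord_end[OF y(2), of "y' - y"] y'(2) by auto
  define b where "b = y + t *\<^sub>R (y' - y)"
  have line: "p + u *\<^sub>R (q - p) \<in> M" if "p \<in> M" "q \<in> M" for u p q
  proof -
    have "p + u *\<^sub>R (q - p) = (1 - u) *\<^sub>R p + u *\<^sub>R q" by (simp add: algebra_simps)
    then show ?thesis using M that by (simp add: affine_def)
  qed
  have bM: "b \<in> M" unfolding b_def by (rule line[OF y(1) y'(1)])
  obtain \<zeta> where z: "\<zeta> \<in> pos_affine C" "\<zeta> \<bullet> (b, 1) \<le> 0"
    using pos_affine_separation[OF open_C convex_C C_nonempty t(3)] unfolding b_def by blast
  have z0: "\<zeta> \<bullet> (b, 1) = 0" using pos_affine_closure[OF z(1)] t(1) z(2) by (fastforce simp: b_def)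
  have refl: "0 \<le> \<xi> \<bullet> (b, 1)" "\<xi> \<bullet> (b, 1) \<le> 2 * (\<xi> \<bullet> (y, 1))" if "\<xi> \<in> pos_affine C" for \<xi>
  proof -
    show "0 \<le> \<xi> \<bullet> (b, 1)" using pos_affine_closure[OF that t(1)] by (simp add: b_def)
    have "0 \<le> \<xi> \<bullet> (y + (-1) *\<^sub>R (b - y), 1)"
      using pos_affine_closure[OF that t(2)] by (simp add: b_def)
    then show "\<xi> \<bullet> (b, 1) \<le> 2 * (\<xi> \<bullet> (y, 1))" unfolding affine_eval_between by simp
  qed
  have "\<exists>z. z \<in> M \<and> z \<in> C \<and> \<zeta> \<bullet> (z, 1) = exp (- \<sigma>) * (\<zeta> \<bullet> (y, 1)) \<and> hilbert_dist C y z \<le> \<sigma>"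
    if \<sigma>: "0 \<le> \<sigma>" for \<sigma>
  proof -
    define e where "e = exp (- \<sigma>)"
    have e: "0 < e" "e \<le> 1" "1 / e = exp \<sigma>" using \<sigma> by (auto simp: e_def exp_minus field_simps)
    \<comment> \<open>The two tangent inequalities add up to
      \<open>2 \<le> exp \<sigma> + exp (- \<sigma>)\<close>.\<close>
    have e2: "2 - e \<le> exp \<sigma>"
      using exp_ge_add_one_self[of \<sigma>] exp_ge_add_one_self[of "- \<sigma>"] unfolding e_def by linarith
    define z where "z = y + (1 - e) *\<^sub>R (b - y)"
    have ev: "\<xi> \<bullet> (z, 1) = e * (\<xi> \<bullet> (y, 1)) + (1 - e) * (\<xi> \<bullet> (b, 1))" for \<xi>
      unfolding z_def affine_eval_between by (simp add: algebra_simps)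
    have ge: "e * (\<xi> \<bullet> (y, 1)) \<le> \<xi> \<bullet> (z, 1)" if "\<xi> \<in> pos_affine C" for \<xi>
      unfolding ev using refl(1)[OF that] e by simp
    have zC: "z \<in> C"
      by (rule mem_C_if_pos) (use ge e pos_affineD[OF _ y(2)] in \<open>fastforce intro: less_le_trans[rotated]\<close>)
    have "hilbert_dist C y z \<le> \<sigma>"
    proof (rule hilbert_dist_le[OF y(2) zC, of "exp \<sigma>" "exp \<sigma>"])
      fix \<xi> assume xi: "\<xi> \<in> pos_affine C"
      show "\<xi> \<bullet> (y, 1) \<le> exp \<sigma> * (\<xi> \<bullet> (z, 1))"
        using ge[OF xi] e(1) unfolding e(3)[symmetric] by (simp add: field_simps)
      have "\<xi> \<bullet> (z, 1) \<le> e * (\<xi> \<bullet> (y, 1)) + (1 - e) * (2 * (\<xi> \<bullet> (y, 1)))"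
        unfolding ev using refl(2)[OF xi] e by (intro add_left_mono mult_left_mono) auto
      also have "\<dots> = (2 - e) * (\<xi> \<bullet> (y, 1))" by (simp add: algebra_simps)
      also have "\<dots> \<le> exp \<sigma> * (\<xi> \<bullet> (y, 1))"
        using e2 pos_affineD[OF xi y(2)] by (intro mult_right_mono) auto
      finally show "\<xi> \<bullet> (z, 1) \<le> exp \<sigma> * (\<xi> \<bullet> (y, 1))" .
    qed (simp add: exp_add[symmetric])
    moreover have "z \<in> M" unfolding z_def by (rule line[OF y(1) bM])
    moreover have "\<zeta> \<bullet> (z, 1) = exp (- \<sigma>) * (\<zeta> \<bullet> (y, 1))" unfolding ev z0 by (simp add: e_def)
    ultimately show ?thesis using zC by blast
  qed
  then show thesis using that[OF z(1) bM z0] by blast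
qed

lemma affine_other_point:
  assumes "aff_dim M > 0"
  shows "\<exists>y'\<in>M. y' \<noteq> y"
proof (rule ccontr)
  assume "\<not> ?thesis"
  then have "M \<subseteq> {y}" by auto
  then have "aff_dim M \<le> 0" using aff_dim_subset[of M "{y}"] by simp
  with assms show False by simp
qed

text \<open>
  Let \<open>\<zeta>\<close> vanish at an end \<open>b\<close> of a chord of \<open>C \<inter> M\<close> through \<open>y\<close>. The sections of \<open>M\<close> by the
  level sets of \<open>\<zeta>\<close> at the heights \<open>exp (- 2 \<kappa> i)\<close> are at mutual distance at least \<open>\<kappa>\<close>, so each
  dimension contributes a factor \<open>N\<close>.
\<close>

lemma packing:
  assumes Q: "Q \<subseteq> C" and x: "x \<in> C" and \<kappa>: "\<kappa> > 0"
    and base: "\<And>M y. affine M \<Longrightarrow> aff_dim M = int k \<Longrightarrow> y \<in> M \<Longrightarrow> y \<in> C \<Longrightarrow>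
                 hilbert_dist C x y \<le> R \<Longrightarrow> Q \<inter> M \<noteq> {}"
  shows "affine M \<Longrightarrow> aff_dim M = int (k + j) \<Longrightarrow> y \<in> M \<Longrightarrow> y \<in> C \<Longrightarrow>
    hilbert_dist C x y + 2 * \<kappa> * j * (real N - 1) \<le> R \<Longrightarrow>
    \<exists>P. P \<subseteq> Q \<inter> M \<and> finite P \<and> card P = N ^ j \<and>
      (\<forall>p\<in>P. \<forall>q\<in>P. p \<noteq> q \<longrightarrow> \<kappa> \<le> hilbert_dist C p q)"
proof (induction j arbitrary: M y)
  \<comment> \<open>\<open>k\<close> is the dimension of the slices left over: 0 for balls, where
    the slice is itself a point of \<open>Q\<close>, and 1 for spheres, where a line through a point
    of the ball meets the sphere.\<close>
  case 0
  then obtain p where "p \<in> Q \<inter> M" using base[of M y] by auto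
  then show ?case by (intro exI[of _ "{p}"]) auto
next
  case (Suc j)
  obtain y' where y': "y' \<in> M" "y' \<noteq> y" using affine_other_point[of M y] Suc.prems(2) by auto
  obtain \<zeta> b where z: "\<zeta> \<in> pos_affine C" and b: "b \<in> M" "\<zeta> \<bullet> (b, 1) = 0"
    and pts: "\<And>\<sigma>. 0 \<le> \<sigma> \<Longrightarrow> \<exists>z. z \<in> M \<and> z \<in> C \<and> \<zeta> \<bullet> (z, 1) = exp (- \<sigma>) * (\<zeta> \<bullet> (y, 1)) \<and>
        hilbert_dist C y z \<le> \<sigma>"
    using slice_points[OF Suc.prems(1,3,4) y'] by blast
  have zy: "0 < \<zeta> \<bullet> (y, 1)" by (rule pos_affineD[OF z Suc.prems(4)])
  \<comment> \<open>The factor 2 in the exponent matches that of \<open>hilbert_dist_ge\<close>: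
    heights with ratio \<open>exp (2 * \<kappa>)\<close> force distance at least
    \<open>\<kappa>\<close>.\<close>
  define h where "h i = exp (- (2 * \<kappa> * real i)) * (\<zeta> \<bullet> (y, 1))" for i :: nat
  define Mi where "Mi i = M \<inter> {z. \<zeta> \<bullet> (z, 1) = h i}" for i
  have ev: "\<zeta> \<bullet> (z, 1) = h i \<longleftrightarrow> fst \<zeta> \<bullet> z = h i - snd \<zeta>" for z i
    by (cases \<zeta>) auto
  have "\<exists>P. P \<subseteq> Q \<inter> Mi i \<and> finite P \<and> card P = N ^ j \<and>
      (\<forall>p\<in>P. \<forall>q\<in>P. p \<noteq> q \<longrightarrow> \<kappa> \<le> hilbert_dist C p q)" if i: "i < N" for i
  proof -
    obtain z where z: "z \<in> M" "z \<in> C" "\<zeta> \<bullet> (z, 1) = h i" "hilbert_dist C y z \<le> 2 * \<kappa> * i"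
      using pts[of "2 * \<kappa> * i"] \<kappa> by (auto simp: h_def)
    \<comment> \<open>\<open>b\<close> lies in \<open>M\<close> at height 0 while the level is
      positive, so the level hyperplane does not contain \<open>M\<close> and lowers its dimension
      by exactly one.\<close>
    have bn: "\<not> M \<subseteq> {z. \<zeta> \<bullet> (z, 1) = h i}" using b zy by (auto simp: h_def)
    have "aff_dim (Mi i) = int (k + j)"
      using aff_dim_affine_Int_hyperplane[OF Suc.prems(1), of "fst \<zeta>" "h i - snd \<zeta>"] z(1,3) bn Suc.prems(2)
      unfolding Mi_def ev by auto
    moreover have "affine (Mi i)"
      unfolding Mi_def ev by (intro affine_Int Suc.prems(1) affine_hyperplane)
    moreover have "z \<in> Mi i" using z by (simp add: Mi_def)
    \<comment> \<open>Each dimension spends at most \<open>2 * \<kappa> * (real N - 1)\<close> of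
      the distance budget \<open>R\<close>.\<close>
    moreover have "hilbert_dist C x z + 2 * \<kappa> * j * (real N - 1) \<le> R"
    proof -
      have "2 * \<kappa> * i \<le> 2 * \<kappa> * (real N - 1)" using i \<kappa> by (intro mult_left_mono) auto
      then have "hilbert_dist C x z \<le> hilbert_dist C x y + 2 * \<kappa> * (real N - 1)"
        using hilbert_dist_triangle[OF x Suc.prems(4) z(2)] z(4) by linarith
      then show ?thesis using Suc.prems(5) by (simp add: algebra_simps)
    qed
    ultimately show ?thesis using Suc.IH z(2) by blast
  qed
  then obtain P where P: "\<And>i. i < N \<Longrightarrow> P i \<subseteq> Q \<inter> Mi i" "\<And>i. i < N \<Longrightarrow> finite (P i)"
    "\<And>i. i < N \<Longrightarrow> card (P i) = N ^ j"
    "\<And>i p q. i < N \<Longrightarrow> p \<in> P i \<Longrightarrow> q \<in> P i \<Longrightarrow> p \<noteq> q \<Longrightarrow> \<kappa> \<le> hilbert_dist C p q"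
    by metis
  have sep: "\<kappa> \<le> hilbert_dist C p q" if "i < i'" "i' < N" "p \<in> P i" "q \<in> P i'" for i i' p q
  proof -
    have pq: "p \<in> C" "q \<in> C" "\<zeta> \<bullet> (p, 1) = h i" "\<zeta> \<bullet> (q, 1) = h i'"
      using P(1)[of i] P(1)[of i'] that Q by (auto simp: Mi_def)
    have "h i \<le> exp (2 * hilbert_dist C p q) * h i'"
      using hilbert_dist_ge[OF pq(1,2) z one_pos_affine] pq by simp
    also have "\<dots> = exp (2 * hilbert_dist C p q - 2 * \<kappa> * real i') * (\<zeta> \<bullet> (y, 1))"
      by (simp add: h_def exp_diff exp_minus field_simps)
    finally have "exp (- (2 * \<kappa> * real i)) \<le> exp (2 * hilbert_dist C p q - 2 * \<kappa> * real i')"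
      using zy by (simp add: h_def)
    then have "\<kappa> * (real i' - real i) \<le> hilbert_dist C p q" by (simp add: algebra_simps)
    moreover have "\<kappa> * 1 \<le> \<kappa> * (real i' - real i)" using that(1) \<kappa> by (intro mult_left_mono) auto
    ultimately show ?thesis by simp
  qed
  have disj: "P i \<inter> P i' = {}" if "i < i'" "i' < N" for i i'
    using sep[OF that] \<kappa> by fastforce
  have disj': "P i \<inter> P i' = {}" if "i \<noteq> i'" "i < N" "i' < N" for i i'
    using disj[of i i'] disj[of i' i] that by (metis Int_commute nat_neq_iff)
  have sep': "\<kappa> \<le> hilbert_dist C p q" if "p \<in> (\<Union>i<N. P i)" "q \<in> (\<Union>i<N. P i)" "p \<noteq> q" for p q
  proof -
    obtain i i' where i: "i < N" "p \<in> P i" and i': "i' < N" "q \<in> P i'" using \<open>p \<in> _\<close> \<open>q \<in> _\<close> by auto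
    consider "i < i'" | "i = i'" | "i' < i" by linarith
    then show ?thesis
      using sep[of i i' p q] sep[of i' i q p] P(4)[of i p q] i i' \<open>p \<noteq> q\<close> hilbert_dist_sym[of p q]
      by cases auto
  qed
  have "card (\<Union>i<N. P i) = (\<Sum>i<N. card (P i))"
    using P(2) disj' by (intro card_UN_disjoint) auto
  also have "\<dots> = N ^ Suc j" using P(3) by simp
  finally have card: "card (\<Union>i<N. P i) = N ^ Suc j" .
  have sub: "(\<Union>i<N. P i) \<subseteq> Q \<inter> M" using P(1) by (auto simp: Mi_def)
  have fin: "finite (\<Union>i<N. P i)" using P(2) by auto
  show ?case using sub fin card sep' by (intro exI[of _ "\<Union>i<N. P i"] conjI ballI impI)
qed

section \<open>Metric spheres\<close>

lemma hilbert_dist_unbounded: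
  assumes x: "x \<in> C" and M: "affine M" "aff_dim M > 0" and y: "y \<in> M" "y \<in> C"
  shows "\<exists>z. z \<in> M \<and> z \<in> C \<and> R \<le> hilbert_dist C x z"
proof -
  obtain y' where y': "y' \<in> M" "y' \<noteq> y" using affine_other_point[of M y] M(2) by auto
  obtain \<zeta> b where z: "\<zeta> \<in> pos_affine C"
    and pts: "\<And>\<sigma>. 0 \<le> \<sigma> \<Longrightarrow> \<exists>z. z \<in> M \<and> z \<in> C \<and> \<zeta> \<bullet> (z, 1) = exp (- \<sigma>) * (\<zeta> \<bullet> (y, 1)) \<and>
        hilbert_dist C y z \<le> \<sigma>"
    using slice_points[OF M(1) y y'] by blast
  have zx: "0 < \<zeta> \<bullet> (x, 1)" "0 < \<zeta> \<bullet> (y, 1)" using pos_affineD[OF z] x y by auto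
  \<comment> \<open>Large enough for \<open>\<zeta>\<close> to fall below its value at
    \<open>x\<close> by the factor \<open>exp (2 * R)\<close>; the maximum with 0 is needed because
    \<open>slice_points\<close> only moves towards the end of the chord.\<close>
  define \<sigma> where "\<sigma> = max 0 (2 * R - ln ((\<zeta> \<bullet> (x, 1)) / (\<zeta> \<bullet> (y, 1))))"
  obtain w where w: "w \<in> M" "w \<in> C" "\<zeta> \<bullet> (w, 1) = exp (- \<sigma>) * (\<zeta> \<bullet> (y, 1))"
    using pts[of \<sigma>] by (auto simp: \<sigma>_def)
  have "\<zeta> \<bullet> (x, 1) \<le> exp (2 * hilbert_dist C x w) * (exp (- \<sigma>) * (\<zeta> \<bullet> (y, 1)))"
    using hilbert_dist_ge[OF x w(2) z one_pos_affine] w(3) by simp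
  also have "\<dots> = exp (2 * hilbert_dist C x w - \<sigma>) * (\<zeta> \<bullet> (y, 1))"
    by (simp add: exp_diff exp_minus field_simps)
  finally have "(\<zeta> \<bullet> (x, 1)) / (\<zeta> \<bullet> (y, 1)) \<le> exp (2 * hilbert_dist C x w - \<sigma>)"
    using zx by (simp add: divide_le_eq)
  then have "ln ((\<zeta> \<bullet> (x, 1)) / (\<zeta> \<bullet> (y, 1))) \<le> 2 * hilbert_dist C x w - \<sigma>"
    using zx by (metis divide_pos_pos exp_gt_zero ln_exp ln_le_cancel_iff)
  moreover have "2 * R - ln ((\<zeta> \<bullet> (x, 1)) / (\<zeta> \<bullet> (y, 1))) \<le> \<sigma>" by (simp add: \<sigma>_def)
  ultimately have "R \<le> hilbert_dist C x w" by linarith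
  with w show ?thesis by blast
qed

text \<open>This is the base case of \<open>packing\<close> for spheres: distances from
  \<open>x\<close> are unbounded on a positive-dimensional section, and the intermediate value
  theorem applies on a segment of it.\<close>

lemma hilbert_sphere_meets:
  assumes x: "x \<in> C" and M: "affine M" "aff_dim M > 0" and y: "y \<in> M" "y \<in> C" "hilbert_dist C x y \<le> R"
  shows "hilbert_sphere C x R \<inter> M \<noteq> {}"
proof -
  obtain z where z: "z \<in> M" "z \<in> C" "R \<le> hilbert_dist C x z"
    using hilbert_dist_unbounded[OF x M y(1,2)] by blast
  let ?S = "closed_segment y z"
  have sub: "?S \<subseteq> C" "?S \<subseteq> M"
    using closed_segment_subset convex_C affine_imp_convex[OF M(1)] y z by auto
  have "connected (hilbert_dist C x ` ?S)"
    by (rule connected_continuous_image) (use continuous_on_subset[OF continuous_on_hilbert_dist[OF x] sub(1)] in auto)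
  then have "{hilbert_dist C x y..hilbert_dist C x z} \<subseteq> hilbert_dist C x ` ?S"
    by (rule connected_contains_Icc) auto
  then have "R \<in> hilbert_dist C x ` ?S" using y z by auto
  then obtain w where "w \<in> ?S" "hilbert_dist C x w = R" by auto
  then show ?thesis using sub by (auto simp: hilbert_sphere_def)
qed

text \<open>The point needing an argument is that no sphere point is interior to the closed ball:
  stepping beyond it on the ray from \<open>x\<close> strictly increases the distance. Spheres can
  then be treated as frontiers of convex bodies.\<close>

lemma frontier_closed_ball:
  assumes x: "x \<in> C" and r: "r > 0"
  shows "frontier (closed_ball x r) = hilbert_sphere C x r"
proof (rule set_eqI)
  fix s
  have cl: "closure (closed_ball x r) = closed_ball x r" by (simp add: closed_closed_ball x)
  have "s \<notin> interior (closed_ball x r)" if s: "s \<in> C" "hilbert_dist C x s = r"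
  proof
    assume si: "s \<in> interior (closed_ball x r)"
    obtain e where e: "e > 0" "ball s e \<subseteq> closed_ball x r" using si mem_interior by blast
    have sx: "s \<noteq> x" using s r by auto
    define y where "y = s + (e / (2 * norm (s - x))) *\<^sub>R (s - x)"
    define k where "k = e / (2 * norm (s - x))"
    have k: "k > 0" using e sx by (simp add: k_def)
    have "y \<in> ball s e" using e sx by (simp add: y_def dist_norm)
    then have yK: "y \<in> closed_ball x r" using e by blast
    \<comment> \<open>These functionals attain the two exit ratios. Beyond \<open>s\<close> the
      first does not decrease and the second does not increase, one of the two strictly since
      \<open>r\<close> is positive.\<close>
    obtain \<alpha> where a: "\<alpha> \<in> pos_affine C" "\<alpha> \<bullet> (s, 1) = exit_ratio C s x * (\<alpha> \<bullet> (x, 1))"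
      using exit_ratio_attain[OF s(1) x] by blast
    obtain \<beta> where b: "\<beta> \<in> pos_affine C" "\<beta> \<bullet> (x, 1) = exit_ratio C x s * (\<beta> \<bullet> (s, 1))"
      using exit_ratio_attain[OF x s(1)] by blast
    have E: "exp (2 * r) = exit_ratio C s x * exit_ratio C x s"
      using exp_hilbert_dist[OF x s(1)] s(2) by simp
    have ge: "1 \<le> exit_ratio C s x" "1 \<le> exit_ratio C x s" using exit_ratio_ge_1 x s(1) by auto
    have "exp (2 * r) \<noteq> 1" using r by simp
    then have ne: "exit_ratio C s x > 1 \<or> exit_ratio C x s > 1" using E ge by fastforce
    have pos: "0 < \<alpha> \<bullet> (x, 1)" "0 < \<beta> \<bullet> (s, 1)" using pos_affineD[OF a(1) x] pos_affineD[OF b(1) s(1)] by auto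
    have y: "y = s + (- k) *\<^sub>R (x - s)" by (simp add: y_def k_def algebra_simps)
    have ay: "\<alpha> \<bullet> (y, 1) = (exit_ratio C s x + k * (exit_ratio C s x - 1)) * (\<alpha> \<bullet> (x, 1))"
      unfolding y affine_eval_between a(2) by (simp add: algebra_simps)
    have by': "\<beta> \<bullet> (y, 1) = (1 - k * (exit_ratio C x s - 1)) * (\<beta> \<bullet> (s, 1))"
      unfolding y affine_eval_between b(2) by (simp add: algebra_simps)
    have "(\<beta> \<bullet> (x, 1)) * (\<alpha> \<bullet> (y, 1)) \<le> exp (2 * r) * ((\<alpha> \<bullet> (x, 1)) * (\<beta> \<bullet> (y, 1)))"
      using yK a(1) b(1) unfolding closed_ball_eq[OF x] by blast
    then have "exit_ratio C x s * (exit_ratio C s x + k * (exit_ratio C s x - 1)) * ((\<beta> \<bullet> (s, 1)) * (\<alpha> \<bullet> (x, 1)))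
      \<le> exit_ratio C x s * (exit_ratio C s x * (1 - k * (exit_ratio C x s - 1))) * ((\<beta> \<bullet> (s, 1)) * (\<alpha> \<bullet> (x, 1)))"
      unfolding ay by' b(2) E by (simp only: mult_ac)
    then have "exit_ratio C x s * (exit_ratio C s x + k * (exit_ratio C s x - 1))
      \<le> exit_ratio C x s * (exit_ratio C s x * (1 - k * (exit_ratio C x s - 1)))"
      using pos by (metis mult_pos_pos mult_right_le_imp_le)
    then have "exit_ratio C s x + k * (exit_ratio C s x - 1)
      \<le> exit_ratio C s x * (1 - k * (exit_ratio C x s - 1))"
      using ge(2) by (simp del: distrib_left)
    then have "k * (exit_ratio C s x - 1) + k * (exit_ratio C s x * (exit_ratio C x s - 1)) \<le> 0"
      by (simp add: algebra_simps)
    moreover have "0 \<le> k * (exit_ratio C s x - 1)" "0 \<le> k * (exit_ratio C s x * (exit_ratio C x s - 1))"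
      using k ge by auto
    moreover have "0 < k * (exit_ratio C s x - 1) \<or> 0 < k * (exit_ratio C s x * (exit_ratio C x s - 1))"
      using ne k ge by auto
    ultimately show False by linarith
  qed
  moreover have "s \<in> interior (closed_ball x r)" if "s \<in> C" "hilbert_dist C x s < r"
  proof -
    have "hilbert_ball C x r \<subseteq> interior (closed_ball x r)"
      by (rule interior_maximal) (auto simp: hilbert_ball_def closed_ball_def open_hilbert_ball[OF x, unfolded hilbert_ball_def])
    then show ?thesis using that by (auto simp: hilbert_ball_def)
  qed
  ultimately show "s \<in> frontier (closed_ball x r) \<longleftrightarrow> s \<in> hilbert_sphere C x r"
    unfolding frontier_def cl by (auto simp: closed_ball_def hilbert_sphere_def order_less_le)
qed

lemma hilbert_ball_subset_interior:
  assumes "x \<in> C" shows "hilbert_ball C x r \<subseteq> interior (closed_ball x r)"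
  by (rule interior_maximal[OF _ open_hilbert_ball[OF assms]]) (auto simp: hilbert_ball_def closed_ball_def)

end

section \<open>Determinants\<close>

lemma det_shear:
  assumes "m \<noteq> n"
  shows "det (matrix (\<lambda>x::real^'n. \<chi> i. if i = m then x $ m + x $ n else x $ i)) = 1"
proof -
  have "matrix (\<lambda>x::real^'n. \<chi> i. if i = m then x $ m + x $ n else x $ i) =
      (\<chi> k. if k = m then row m (mat 1) + 1 *s row n (mat 1) else row k (mat 1))"
    by (auto simp: matrix_def row_def mat_def axis_def vec_eq_iff)
  then show ?thesis using det_row_operation[OF assms, of "mat 1 :: real^'n^'n" 1] by simp
qed

text \<open>Linear change of variables by decomposition into elementary maps: both sides are
  multiplicative under composition, and a singular map has a negligible image.\<close>

lemma measure_linear_image_vec: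
  fixes f :: "real^'n \<Rightarrow> real^'n"
  assumes "linear f"
  shows "\<forall>S\<in>lmeasurable. f ` S \<in> lmeasurable \<and> measure lebesgue (f ` S) = \<bar>det (matrix f)\<bar> * measure lebesgue S"
proof (rule induct_linear_elementary[OF assms]; intro ballI)
  fix f g :: "real^'n \<Rightarrow> real^'n" and S :: "(real^'n) set"
  assume lin: "linear f" "linear g" and S: "S \<in> lmeasurable"
    and f: "\<forall>S\<in>lmeasurable. f ` S \<in> lmeasurable \<and> measure lebesgue (f ` S) = \<bar>det (matrix f)\<bar> * measure lebesgue S"
    and g: "\<forall>S\<in>lmeasurable. g ` S \<in> lmeasurable \<and> measure lebesgue (g ` S) = \<bar>det (matrix g)\<bar> * measure lebesgue S"
  have "matrix (f \<circ> g) = matrix f ** matrix g" by (rule matrix_compose[OF lin(2,1)])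
  moreover have "(f \<circ> g) ` S = f ` g ` S" by (simp add: image_comp)
  ultimately show "(f \<circ> g) ` S \<in> lmeasurable \<and>
      measure lebesgue ((f \<circ> g) ` S) = \<bar>det (matrix (f \<circ> g))\<bar> * measure lebesgue S"
    using f g S by (simp only: det_mul abs_mult mult.assoc)
next
  fix f :: "real^'n \<Rightarrow> real^'n" and i and S :: "(real^'n) set"
  assume lin: "linear f" and 0: "\<And>x. f x $ i = 0" and "S \<in> lmeasurable"
  have ni: "\<not> inj f"
  proof
    assume "inj f"
    then have "surj f" using lin linear_injective_imp_surjective by blast
    then obtain x where "f x = axis i 1" by (metis surjD)
    with 0[of x] show False by (simp add: axis_def)
  qed
  have neg: "negligible (f ` S)" by (rule negligible_linear_singular_image[OF lin ni])
  moreover have "det (matrix f) = 0" using ni det_nz_iff_inj[OF lin] by blast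
  ultimately show "f ` S \<in> lmeasurable \<and> measure lebesgue (f ` S) = \<bar>det (matrix f)\<bar> * measure lebesgue S"
    using negligible_imp_measure0 negligible_imp_measurable by auto
next
  fix c and S :: "(real^'n) set"
  assume S: "S \<in> lmeasurable"
  have "\<bar>det (matrix (\<lambda>x::real^'n. \<chi> i. c i * x $ i))\<bar> = \<bar>prod c UNIV\<bar>"
    by (subst det_diagonal) (auto simp: matrix_def axis_def)
  then show "(\<lambda>x::real^'n. \<chi> i. c i * x $ i) ` S \<in> lmeasurable \<and> measure lebesgue ((\<lambda>x::real^'n. \<chi> i. c i * x $ i) ` S) =
      \<bar>det (matrix (\<lambda>x::real^'n. \<chi> i. c i * x $ i))\<bar> * measure lebesgue S"
    using measurable_stretch[OF S] measure_stretch[OF S] by simp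
next
  fix m n :: 'n and S :: "(real^'n) set"
  assume mn: "m \<noteq> n" and S: "S \<in> lmeasurable"
  let ?\<tau> = "Transposition.transpose m n"
  let ?h = "\<lambda>x::real^'n. \<chi> i. x $ ?\<tau> i"
  have lin: "linear ?h" by (rule linearI) (simp_all add: vec_eq_iff)
  \<comment> \<open>An involution has determinant 1 or -1, which gives the absolute value for a
    transposition of coordinates.\<close>
  have hh: "?h (?h x) = x" for x by (simp add: vec_eq_iff)
  have "matrix ?h ** matrix ?h = mat 1"
    using matrix_compose[OF lin lin] hh by (simp add: o_def matrix_id_mat_1[unfolded id_def])
  then have "det (matrix ?h) * det (matrix ?h) = 1" by (metis det_I det_mul)
  then have d: "\<bar>det (matrix ?h)\<bar> = 1" by (auto simp: square_eq_1_iff)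
  have "measure lebesgue (?h ` cbox a b) = 1 * measure lebesgue (cbox a b)" for a b :: "real^'n"
  proof -
    have sub: "?h ` cbox a b \<subseteq> cbox (?h a) (?h b)" for a b by (auto simp: mem_box_cart)
    have "cbox (?h a) (?h b) \<subseteq> ?h ` cbox a b"
    proof
      fix x assume "x \<in> cbox (?h a) (?h b)"
      then have "?h x \<in> cbox a b" using sub[of "?h a" "?h b"] hh by auto
      then show "x \<in> ?h ` cbox a b" by (rule image_eqI[rotated]) (simp add: hh)
    qed
    with sub have eq: "?h ` cbox a b = cbox (?h a) (?h b)" by blast
    have "(\<Prod>i\<in>UNIV. b $ ?\<tau> i - a $ ?\<tau> i) = (\<Prod>i\<in>UNIV. b $ i - a $ i)"
      by (rule prod.reindex_bij_betw[where h = ?\<tau>]) simp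
    moreover have "cbox (?h a) (?h b) = {} \<longleftrightarrow> cbox a b = {}" using eq by (metis image_is_empty)
    ultimately show ?thesis unfolding eq by (simp add: content_cbox_if_cart)
  qed
  from measure_linear_sufficient[OF lin S this]
  show "?h ` S \<in> lmeasurable \<and> measure lebesgue (?h ` S) = \<bar>det (matrix ?h)\<bar> * measure lebesgue S"
    unfolding d by simp
next
  fix m n :: 'n and S :: "(real^'n) set"
  assume mn: "m \<noteq> n" and S: "S \<in> lmeasurable"
  let ?h = "\<lambda>x::real^'n. \<chi> i. if i = m then x $ m + x $ n else x $ i"
  have lin: "linear ?h" by (rule linearI) (auto simp: vec_eq_iff algebra_simps)
  have "measure lebesgue (?h ` cbox a b) = 1 * measure lebesgue (cbox a b)" for a b
  proof (cases "cbox a b = {}")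
    case False
    \<comment> \<open>Moves the lower face in direction \<open>n\<close> to height 0, since
      \<open>measure_shear_interval\<close> wants a nonnegative lower bound there.\<close>
    define v where "v = axis n (a $ n)"
    have cb: "cbox a b = (+) v ` cbox (a - v) (b - v)" by (simp flip: cbox_translation)
    then have ne: "cbox (a - v) (b - v) \<noteq> {}" using False by auto
    have "?h ` cbox a b = (+) (?h v) ` (?h ` cbox (a - v) (b - v))"
      unfolding cb image_image using linear_add[OF lin] by simp
    then have "measure lebesgue (?h ` cbox a b) = measure lebesgue (?h ` cbox (a - v) (b - v))"
      by (simp only: measure_translation)
    also have "\<dots> = measure lebesgue (cbox (a - v) (b - v))"
      by (rule measure_shear_interval[OF mn ne]) (simp add: v_def)
    also have "\<dots> = measure lebesgue (cbox a b)" unfolding cb by (simp only: measure_translation)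
    finally show ?thesis by simp
  qed simp
  from measure_linear_sufficient[OF lin S this]
  show "?h ` S \<in> lmeasurable \<and> measure lebesgue (?h ` S) = \<bar>det (matrix ?h)\<bar> * measure lebesgue S"
    unfolding det_shear[OF mn] by simp
qed

lemma emeasure_linear_image:
  fixes f :: "real^'n \<Rightarrow> real^'n"
  assumes "linear f" "bounded S" "S \<in> sets borel" "f ` S \<in> sets borel"
  shows "emeasure lborel (f ` S) = ennreal \<bar>det (matrix f)\<bar> * emeasure lborel S"
proof -
  have S: "S \<in> lmeasurable" using assms by (intro bounded_set_imp_lmeasurable) auto
  have fS: "f ` S \<in> lmeasurable" and
    m: "measure lebesgue (f ` S) = \<bar>det (matrix f)\<bar> * measure lebesgue S"
    using measure_linear_image_vec[OF assms(1)] S by auto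
  have "emeasure lebesgue (f ` S) = ennreal \<bar>det (matrix f)\<bar> * emeasure lebesgue S"
    using m emeasure_eq_measure2[OF S] emeasure_eq_measure2[OF fS] by (simp add: ennreal_mult)
  then show ?thesis using assms by simp
qed

text \<open>
  Taking the columns of a matrix of maximal determinant among the elements of \<open>D\<close>, all
  coordinates are bounded by 1 by Cramer's rule.
\<close>

lemma max_det_basis_vec:
  fixes D :: "(real^'m) set"
  assumes D: "compact D" "span D = UNIV"
  obtains u :: "'m \<Rightarrow> real^'m" where "\<And>i. u i \<in> D"
    "\<And>x. x \<in> D \<Longrightarrow> \<exists>c. x = (\<Sum>i\<in>UNIV. c i *\<^sub>R u i) \<and> (\<forall>i. \<bar>c i\<bar> \<le> 1)"
proof -
  define K where "K = {A :: real^'m^'m. \<forall>i. A $ i \<in> D}"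
  have cD: "closed D" using D compact_imp_closed by blast
  obtain b where b: "\<And>x. x \<in> D \<Longrightarrow> norm x \<le> b" using compact_imp_bounded[OF D(1)] bounded_iff by metis
  have "closed K"
  proof -
    have "K = (\<Inter>i. (\<lambda>A. A $ i) -` D)" by (auto simp: K_def)
    then show ?thesis by (auto intro!: closed_INT closed_vimage cD continuous_intros)
  qed
  moreover have "bounded K"
    unfolding bounded_iff
  proof (intro exI ballI)
    fix A assume "A \<in> K"
    then have "(\<Sum>i\<in>UNIV. norm (A $ i)) \<le> (\<Sum>i\<in>(UNIV::'m set). b)"
      by (intro sum_mono b) (auto simp: K_def)
    then show "norm A \<le> (\<Sum>i\<in>(UNIV::'m set). b)"
      using L2_set_le_sum[of UNIV "\<lambda>i. norm (A $ i)"] by (simp add: norm_vec_def)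
  qed
  ultimately have cK: "compact K" by (simp add: compact_eq_bounded_closed)
  obtain B where B: "B \<subseteq> D" "independent B" "D \<subseteq> span B" "card B = dim D" by (rule basis_exists)
  have cB: "card B = CARD('m)" using B(4) D(2) by (metis dim_span dim_UNIV DIM_cart DIM_real mult.right_neutral)
  have fB: "finite B" using B(2) finiteI_independent by blast
  then obtain h where h: "bij_betw h (UNIV::'m set) B" using cB by (metis finite_class.finite_UNIV finite_same_card_bij)
  define A0 where "A0 = (\<chi> i. h i)"
  have A0K: "A0 \<in> K" using h B(1) by (auto simp: K_def A0_def bij_betw_def)
  \<comment> \<open>A basis contained in \<open>D\<close> shows that the maximal determinant is not
    zero, so that Cramer's rule applies to the maximizer.\<close>
  have "det A0 \<noteq> 0"
  proof -
    have "\<forall>c. (\<Sum>i\<in>UNIV. c i *s row i A0) = 0 \<longrightarrow> (\<forall>i. c i = 0)"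
    proof (intro allI impI)
      fix c i assume "(\<Sum>i\<in>UNIV. c i *s row i A0) = 0"
      then have "(\<Sum>i\<in>UNIV. c i *\<^sub>R h i) = 0" by (simp add: row_def A0_def scalar_mult_eq_scaleR)
      then have "(\<Sum>v\<in>B. c (the_inv_into UNIV h v) *\<^sub>R v) = 0"
        using sum.reindex_bij_betw[OF h, of "\<lambda>v. c (the_inv_into UNIV h v) *\<^sub>R v"] h
        by (simp add: the_inv_into_f_f bij_betw_def)
      then have "c (the_inv_into UNIV h (h i)) = 0"
        using B(2) fB h unfolding independent_explicit_finite_subsets
        by (meson bij_betwE iso_tuple_UNIV_I order_refl)
      then show "c i = 0" using h by (simp add: the_inv_into_f_f bij_betw_def)
    qed
    then have "\<exists>B. A0 ** B = mat 1" using matrix_right_invertible_independent_rows by blast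
    then show ?thesis by (metis invertible_det_nz invertible_right_inverse)
  qed
  have "continuous_on K (\<lambda>A. \<bar>det A\<bar>)"
    unfolding det_def by (intro continuous_intros)
  then obtain A where A: "A \<in> K" and max: "\<And>A'. A' \<in> K \<Longrightarrow> \<bar>det A'\<bar> \<le> \<bar>det A\<bar>"
    using continuous_attains_sup[OF cK] A0K by blast
  have dA: "det A \<noteq> 0" using max[OF A0K] \<open>det A0 \<noteq> 0\<close> by auto
  show thesis
  proof (rule that[of "\<lambda>i. A $ i"])
    show "A $ i \<in> D" for i using A by (simp add: K_def)
    fix x assume x: "x \<in> D"
    define c where "c k = det (\<chi> i j. if j = k then x $ i else transpose A $ i $ j) / det (transpose A)" for k
    have dT: "det (transpose A) \<noteq> 0" using dA by simp
    have "transpose A *v (\<chi> k. c k) = x"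
      using cramer[OF dT, of "\<chi> k. c k" x] by (simp add: c_def)
    then have "x = (\<Sum>i\<in>UNIV. c i *\<^sub>R A $ i)"
      by (simp add: matrix_vector_mult_def transpose_def vec_eq_iff mult.commute)
    moreover have "\<bar>c k\<bar> \<le> 1" for k
    proof -
      have "(\<chi> i j. if j = k then x $ i else transpose A $ i $ j) = transpose (\<chi> j. if j = k then x else A $ j)"
        by (auto simp: transpose_def vec_eq_iff)
      then have "c k = det (\<chi> j. if j = k then x else A $ j) / det A"
        by (simp add: c_def)
      moreover have "(\<chi> j. if j = k then x else A $ j) \<in> K" using x A by (auto simp: K_def)
      ultimately show ?thesis using max[of "\<chi> j. if j = k then x else A $ j"] dA by (simp add: divide_le_eq)
    qed
    ultimately show "\<exists>c. x = (\<Sum>i\<in>UNIV. c i *\<^sub>R A $ i) \<and> (\<forall>i. \<bar>c i\<bar> \<le> 1)" by blast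
  qed
qed

text \<open>Carried over from coordinate space by a linear isomorphism of \<open>span D\<close>.
  This allows \<open>D\<close> to span a proper subspace, such as the functionals vanishing along a
  line.\<close>

lemma max_det_basis:
  fixes D :: "'v::euclidean_space set"
  assumes D: "compact D" and dim: "dim D = CARD('m::finite)"
  obtains u :: "'m::finite \<Rightarrow> 'v" where "\<And>i. u i \<in> D"
    "\<And>x. x \<in> D \<Longrightarrow> \<exists>c. x = (\<Sum>i\<in>UNIV. c i *\<^sub>R u i) \<and> (\<forall>i. \<bar>c i\<bar> \<le> 1)"
proof -
  have "dim (span D) = dim (UNIV :: (real^'m) set)" using dim by (simp add: dim_span)
  then obtain f :: "'v \<Rightarrow> real^'m" and g where fg: "linear f" "linear g" "f ` span D = UNIV" "g ` UNIV = span D"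
    "\<And>x. x \<in> span D \<Longrightarrow> g (f x) = x"
    using isometries_subspaces[OF subspace_span subspace_UNIV] by metis
  have "compact (f ` D)" using D fg(1) by (intro compact_continuous_image linear_continuous_on linear_conv_bounded_linear[THEN iffD1])
  moreover have "span (f ` D) = UNIV" using fg(1,3) by (simp add: linear_span_image)
  ultimately obtain u :: "'m \<Rightarrow> real^'m" where u: "\<And>i. u i \<in> f ` D"
    "\<And>x. x \<in> f ` D \<Longrightarrow> \<exists>c. x = (\<Sum>i\<in>UNIV. c i *\<^sub>R u i) \<and> (\<forall>i. \<bar>c i\<bar> \<le> 1)"
    by (rule max_det_basis_vec) blast
  show thesis
  proof (rule that[of "\<lambda>i. g (u i)"])
    show "g (u i) \<in> D" for i using u(1)[of i] fg(5) span_superset by fastforce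
    fix x assume x: "x \<in> D"
    then obtain c where c: "f x = (\<Sum>i\<in>UNIV. c i *\<^sub>R u i)" "\<forall>i. \<bar>c i\<bar> \<le> 1" using u(2) by blast
    have "x = g (f x)" using fg(5) x span_superset by (metis subsetD)
    also have "\<dots> = (\<Sum>i\<in>UNIV. c i *\<^sub>R g (u i))"
      unfolding c(1) using fg(2) by (simp add: linear_sum linear_scale)
    finally show "\<exists>c. x = (\<Sum>i\<in>UNIV. c i *\<^sub>R g (u i)) \<and> (\<forall>i. \<bar>c i\<bar> \<le> 1)" using c(2) by blast
  qed
qed

section \<open>Proper densities\<close>

text \<open>An affine chart of the open simplex, whose cone in homogeneous coordinates consists of
  the vectors with positive coordinates. Diagonal maps act transitively on it.\<close>

definition orthant :: "(real^'n) set" where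
  "orthant = {x. \<forall>i. 0 < x $ i}"

lemma no_line_in_orthant:
  assumes "v \<noteq> 0" shows "\<exists>t. p + t *\<^sub>R v \<notin> (orthant :: (real^'n) set)"
proof -
  obtain i where "v $ i \<noteq> 0" using assms by (auto simp: vec_eq_iff)
  then have "(p + (- (p $ i) / v $ i) *\<^sub>R v) $ i = 0" by simp
  then show ?thesis unfolding orthant_def by (metis less_irrefl mem_Collect_eq)
qed

lemma properly_open_convexI:
  fixes \<omega> :: "(real^'n) set"
  assumes "open \<omega>" "convex \<omega>" "\<omega> \<noteq> {}" "\<omega> \<subseteq> orthant"
  shows "properly_open_convex \<omega>"
proof -
  have "\<not> range (\<lambda>t::real. p + t *\<^sub>R v) \<subseteq> \<omega>" if "v \<noteq> 0" for p v
    using no_line_in_orthant[OF that, of p] assms(4) by blast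
  then show ?thesis using assms unfolding properly_open_convex_def by blast
qed

lemma properly_open_convex_orthant: "properly_open_convex (orthant :: (real^'n) set)"
proof (rule properly_open_convexI)
  have eq: "(orthant :: (real^'n) set) = (\<Inter>i. {x. axis i 1 \<bullet> x > 0})"
    by (auto simp: orthant_def inner_axis')
  show "open (orthant :: (real^'n) set)"
    unfolding eq by (intro open_INT finite_class.finite_UNIV ballI open_halfspace_gt)
  show "convex (orthant :: (real^'n) set)"
    unfolding eq by (intro convex_INT convex_halfspace_gt)
  have "(1 :: real^'n) \<in> orthant" by (simp add: orthant_def)
  then show "orthant \<noteq> ({} :: (real^'n) set)" by blast
qed simp

lemma proper_density_pos:
  assumes "proper_density f" "properly_open_convex \<omega>" "x \<in> \<omega>"
  shows "0 < f \<omega> x"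
  using conjunct1[OF assms(1)[unfolded proper_density_def]] assms(2,3)
  by (auto simp: pointed_convex_sets_def)

lemma proper_density_mono:
  assumes "proper_density f" "properly_open_convex \<omega>" "properly_open_convex \<Omega>" "x \<in> \<omega>" "\<omega> \<subseteq> \<Omega>"
  shows "f \<Omega> x \<le> f \<omega> x"
  using conjunct1[OF conjunct2[OF conjunct2[OF assms(1)[unfolded proper_density_def]]]] assms(2-)
  by simp

lemma proper_density_chain:
  assumes "proper_density f" "properly_open_convex \<omega>" "x \<in> \<omega>" "projective_on \<omega> T"
    "properly_open_convex (T ` \<omega>)"
  shows "f (T ` \<omega>) (T x) * Jac T x = f \<omega> x"
  using conjunct2[OF conjunct2[OF conjunct2[OF assms(1)[unfolded proper_density_def]]]] assms(2-)
  by (simp add: pointed_convex_sets_def)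

lemma proper_density_continuous:
  fixes f :: "(real^'n) set \<Rightarrow> real^'n \<Rightarrow> real"
  assumes f: "proper_density f" and C: "properly_open_convex C"
  shows "continuous_on C (f C)"
  unfolding continuous_on_sequentially
proof (intro allI ballI impI)
  fix X :: "nat \<Rightarrow> real^'n" and x assume x: "x \<in> C" and X: "(\<forall>n. X n \<in> C) \<and> X \<longlonglongrightarrow> x"
  have cc: "closures_converge (\<lambda>_. C) C"
    unfolding closures_converge_def by (auto intro!: eventuallyI bexI)
  from conjunct1[OF conjunct2[OF f[unfolded proper_density_def]], rule_format, of "\<lambda>_. C" X C x]
  show "(f C \<circ> X) \<longlonglongrightarrow> f C x"
    using C X x cc by (simp add: o_def pointed_convex_sets_def)
qed

lemma Jac_derivative:
  assumes "(T has_derivative T') (at x)"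
  shows "Jac T x = \<bar>det (matrix T')\<bar>"
  using frechet_derivative_at[OF assms] by (simp add: Jac_def)

text \<open>The diagonal map taking \<open>1\<close> to \<open>x\<close> preserves the orthant, and
  its Jacobian is the product of the coordinates of \<open>x\<close>; so the chain rule determines
  the density on a simplex up to a constant.\<close>

lemma density_orthant:
  fixes g :: "(real^'m) set \<Rightarrow> real^'m \<Rightarrow> real"
  assumes g: "proper_density g" and x: "x \<in> orthant"
  shows "g orthant x * (\<Prod>i\<in>UNIV. x $ i) = g orthant 1"
proof -
  define T where "T = (\<lambda>y::real^'m. \<chi> i. x $ i * y $ i)"
  have xp: "\<And>i. 0 < x $ i" using x by (simp add: orthant_def)
  have lin: "linear T" unfolding T_def by (rule linearI) (auto simp: vec_eq_iff algebra_simps)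
  have inv: "T (\<chi> i. y $ i / x $ i) = y" "(\<chi> i. T y $ i / x $ i) = y" for y
    using xp by (auto simp: T_def vec_eq_iff less_imp_neq[THEN not_sym])
  have im: "T ` orthant = orthant"
  proof
    show "T ` orthant \<subseteq> orthant" using xp by (auto simp: T_def orthant_def)
    show "orthant \<subseteq> T ` orthant"
    proof
      fix y :: "real^'m" assume "y \<in> orthant"
      then have "(\<chi> i. y $ i / x $ i) \<in> orthant" using xp by (simp add: orthant_def)
      then show "y \<in> T ` orthant" by (rule image_eqI[rotated]) (simp only: inv)
    qed
  qed
  have pr: "projective_on orthant T"
    unfolding projective_on_def
  proof (intro exI conjI ballI)
    let ?L = "\<lambda>(y, w::real). (T y, w)"
    show "linear ?L" by (rule linearI) (auto simp: linear_add[OF lin] linear_scale[OF lin])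
    show "bij ?L"
      by (rule bij_betw_byWitness[where f' = "\<lambda>(y, w). (\<chi> i. y $ i / x $ i, w)"]) (auto simp: inv)
  qed auto
  have "Jac T 1 = \<bar>det (matrix T)\<bar>"
    by (rule Jac_derivative) (intro linear_imp_has_derivative lin)
  also have "\<dots> = (\<Prod>i\<in>UNIV. x $ i)"
    unfolding T_def using xp by (subst det_diagonal) (auto simp: matrix_def axis_def abs_prod less_imp_le intro!: prod.cong)
  finally have J: "Jac T 1 = (\<Prod>i\<in>UNIV. x $ i)" .
  have "g (T ` orthant) (T 1) * Jac T 1 = g orthant 1"
    by (rule proper_density_chain[OF g properly_open_convex_orthant _ pr])
      (auto simp: im properly_open_convex_orthant, simp add: orthant_def)
  moreover have "T 1 = x" by (simp add: T_def vec_eq_iff)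
  ultimately show ?thesis unfolding im J by simp
qed

lemma properly_open_convex_projective_image:
  fixes L :: "(real^'m) \<times> real \<Rightarrow> (real^'m) \<times> real"
  assumes \<omega>: "properly_open_convex \<omega>" and L: "linear L" "bij L"
    and pos: "\<And>y. y \<in> \<omega> \<Longrightarrow> 0 < snd (L (y, 1))" "\<And>y i. y \<in> \<omega> \<Longrightarrow> 0 < fst (L (y, 1)) $ i"
    and T: "T = (\<lambda>y. fst (L (y, 1)) /\<^sub>R snd (L (y, 1)))"
  shows "properly_open_convex (T ` \<omega>)" "T ` \<omega> \<subseteq> orthant"
proof -
  have w: "open \<omega>" "convex \<omega>" "\<omega> \<noteq> {}" using \<omega> by (auto simp: properly_open_convex_def)
  have cL: "continuous_on UNIV L" using L(1) by (simp add: linear_continuous_on linear_conv_bounded_linear)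
  have hom: "L (y, 1) = snd (L (y, 1)) *\<^sub>R (T y, 1)" if "y \<in> \<omega>" for y
    using pos(1)[OF that] by (simp add: T prod_eq_iff)
  have cont: "continuous_on \<omega> T"
    unfolding T using pos(1)
    by (intro continuous_intros continuous_on_compose2[OF cL]) (auto simp: less_imp_neq[THEN not_sym])
  have inj: "inj_on T \<omega>"
  proof (rule inj_onI)
    fix y z assume yz: "y \<in> \<omega>" "z \<in> \<omega>" "T y = T z"
    let ?a = "snd (L (y, 1))" and ?b = "snd (L (z, 1))"
    have "L (?b *\<^sub>R (y, 1)) = L (?a *\<^sub>R (z, 1))"
      unfolding linear_scale[OF L(1)] using hom[OF yz(1)] hom[OF yz(2)] yz(3)
      by (metis mult.commute scaleR_scaleR)
    then have "?b *\<^sub>R (y, 1::real) = ?a *\<^sub>R (z, 1)" using L(2) by (meson bij_is_inj injD)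
    then show "y = z" using pos(1)[OF yz(2)] by auto
  qed
  have op: "open (T ` \<omega>)" by (rule invariance_of_domain[OF cont w(1) inj])
  have cv: "convex (T ` \<omega>)"
    unfolding convex_alt
  proof (intro ballI allI impI)
    fix p q and u :: real assume "p \<in> T ` \<omega>" "q \<in> T ` \<omega>" and u: "0 \<le> u \<and> u \<le> 1"
    then obtain y z where yz: "y \<in> \<omega>" "p = T y" "z \<in> \<omega>" "q = T z" by blast
    \<comment> \<open>The weights are divided by the last coordinates of the images, so that the
      barycentre of \<open>y\<close> and \<open>z\<close> with weights \<open>a\<close> and
      \<open>b\<close> is mapped to the prescribed point of the segment from \<open>p\<close> to
      \<open>q\<close>.\<close>
    define a where "a = (1 - u) / snd (L (y, 1))"
    define b where "b = u / snd (L (z, 1))"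
    have ab: "0 \<le> a" "0 \<le> b" "0 < a + b"
    proof -
      show "0 \<le> a" "0 \<le> b" using u pos(1)[OF yz(1)] pos(1)[OF yz(3)] by (auto simp: a_def b_def)
      show "0 < a + b"
      proof (cases "u = 0")
        case True then show ?thesis using pos(1)[OF yz(1)] by (simp add: a_def b_def)
      next
        case False
        then have "0 < b" using u pos(1)[OF yz(3)] by (simp add: b_def)
        then show ?thesis using \<open>0 \<le> a\<close> by simp
      qed
    qed
    define s where "s = (a / (a + b)) *\<^sub>R y + (b / (a + b)) *\<^sub>R z"
    have s: "s \<in> \<omega>" unfolding s_def
      by (rule convexD[OF w(2) yz(1,3)]) (use ab in \<open>auto simp: add_divide_distrib[symmetric]\<close>)
    have "(a + b) *\<^sub>R (s, 1::real) = a *\<^sub>R (y, 1) + b *\<^sub>R (z, 1)"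
      using ab(3) by (simp add: s_def scaleR_add_right)
    from arg_cong[OF this, of L]
    have "(a + b) *\<^sub>R L (s, 1) = a *\<^sub>R L (y, 1) + b *\<^sub>R L (z, 1)"
      by (simp only: linear_add[OF L(1)] linear_scale[OF L(1)])
    also have "a *\<^sub>R L (y, 1) = (1 - u) *\<^sub>R (p, 1)"
      using arg_cong[OF hom[OF yz(1)], of "(*\<^sub>R) a"] pos(1)[OF yz(1)] by (simp add: a_def yz(2))
    also have "b *\<^sub>R L (z, 1) = u *\<^sub>R (q, 1)"
      using arg_cong[OF hom[OF yz(3)], of "(*\<^sub>R) b"] pos(1)[OF yz(3)] by (simp add: b_def yz(4))
    finally have eq: "(a + b) *\<^sub>R L (s, 1) = ((1 - u) *\<^sub>R p + u *\<^sub>R q, 1)" by simp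
    have e1: "snd (L (s, 1)) * (a + b) = 1" using arg_cong[OF eq, of snd] by (simp add: mult.commute)
    have e2: "(a + b) *\<^sub>R fst (L (s, 1)) = (1 - u) *\<^sub>R p + u *\<^sub>R q"
      using arg_cong[OF eq, of fst] by simp
    have "inverse (snd (L (s, 1))) = a + b" by (rule inverse_unique[OF e1])
    then have "T s = (1 - u) *\<^sub>R p + u *\<^sub>R q" using e2 by (simp add: T)
    then show "(1 - u) *\<^sub>R p + u *\<^sub>R q \<in> T ` \<omega>" using s by (intro image_eqI[of _ _ s]) simp_all
  qed
  show sub: "T ` \<omega> \<subseteq> orthant" using pos by (auto simp: T orthant_def)
  show "properly_open_convex (T ` \<omega>)" using properly_open_convexI op cv w(3) sub by blast
qed

text \<open>The image of \<open>\<omega>\<close> lies in the orthant, so monotonicity bounds its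
  density below by the explicit one, and the chain rule brings the bound back. The chain rule also
  makes the Jacobian positive, as both densities are.\<close>

lemma density_ge_simplex:
  fixes g :: "(real^'m) set \<Rightarrow> real^'m \<Rightarrow> real" and L :: "(real^'m) \<times> real \<Rightarrow> (real^'m) \<times> real"
  assumes g: "proper_density g" and \<omega>: "properly_open_convex \<omega>" and L: "linear L" "bij L"
    and pos: "\<And>y. y \<in> \<omega> \<Longrightarrow> 0 < snd (L (y, 1))" "\<And>y i. y \<in> \<omega> \<Longrightarrow> 0 < fst (L (y, 1)) $ i"
    and T: "T = (\<lambda>y. fst (L (y, 1)) /\<^sub>R snd (L (y, 1)))" and y: "y \<in> \<omega>"
  shows "g orthant 1 * Jac T y \<le> g \<omega> y * (\<Prod>i\<in>UNIV. T y $ i)" "0 < Jac T y"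
proof -
  note im = properly_open_convex_projective_image[OF \<omega> L pos T]
  have "projective_on \<omega> T"
    unfolding projective_on_def using L pos(1) by (intro exI[of _ L]) (auto simp: T less_imp_neq[THEN not_sym])
  then have chain: "g (T ` \<omega>) (T y) * Jac T y = g \<omega> y"
    by (intro proper_density_chain[OF g] \<omega> y im)
  have Ty: "T y \<in> T ` \<omega>" "T y \<in> orthant" using y im(2) by auto
  have "0 < g \<omega> y" "0 < g (T ` \<omega>) (T y)"
    using proper_density_pos[OF g] \<omega> y im(1) Ty by auto
  then show J: "0 < Jac T y" using zero_less_mult_pos[of "g (T ` \<omega>) (T y)" "Jac T y"] chain by simp
  have "g orthant 1 * Jac T y = g orthant (T y) * Jac T y * (\<Prod>i\<in>UNIV. T y $ i)"
    using density_orthant[OF g Ty(2)] by simp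
  also have "\<dots> \<le> g (T ` \<omega>) (T y) * Jac T y * (\<Prod>i\<in>UNIV. T y $ i)"
    using proper_density_mono[OF g im(1) properly_open_convex_orthant Ty(1) im(2)] J Ty(2)
    by (intro mult_right_mono prod_nonneg) (auto simp: orthant_def less_imp_le)
  finally show "g orthant 1 * Jac T y \<le> g \<omega> y * (\<Prod>i\<in>UNIV. T y $ i)" unfolding chain .
qed

section \<open>Volume of a small ball\<close>

lemma exp_margin:
  fixes \<rho> :: real
  assumes "0 < \<rho>" "\<rho> \<le> 1"
  shows "1 + \<rho> / 4 \<le> exp (2 * (\<rho> / 2)) * (1 - \<rho> / 4)"
proof -
  \<comment> \<open>With relative variation \<open>\<rho> / 4\<close> and distance
    \<open>\<rho> / 2\<close> this yields the hypothesis of \<open>hilbert_dist_near\<close>; half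
    of \<open>\<rho>\<close> leaves room for the strict inequality in the open ball.\<close>
  have "1 + \<rho> / 4 \<le> (1 + \<rho>) * (1 - \<rho> / 4)"
  proof -
    have "\<rho> * \<rho> \<le> \<rho>" using mult_left_mono[of \<rho> 1 \<rho>] assms by simp
    moreover have "(1 + \<rho>) * (1 - \<rho> / 4) = 1 + 3 / 4 * \<rho> - \<rho> * \<rho> / 4" by (simp add: field_simps)
    ultimately show ?thesis using assms by linarith
  qed
  also have "\<dots> \<le> exp \<rho> * (1 - \<rho> / 4)"
    using assms exp_ge_add_one_self[of \<rho>] by (intro mult_right_mono) auto
  finally show ?thesis by simp
qed

lemma affine_eval_normalized:
  fixes \<zeta> :: "'a::euclidean_space \<times> real"
  assumes "\<zeta> \<bullet> (p, 1) \<noteq> 0"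
  shows "\<zeta> \<bullet> (y, 1) = (\<zeta> \<bullet> (p, 1)) * (1 + (fst \<zeta> /\<^sub>R (\<zeta> \<bullet> (p, 1))) \<bullet> (y - p))"
  using assms by (cases \<zeta>) (simp add: distrib_left right_diff_distrib inner_diff_right mult.assoc[symmetric])

context properly_convex begin

text \<open>The polar body of \<open>C\<close> with respect to \<open>p\<close>, up to sign: the
  linear parts of the affine functions that are nonnegative on \<open>C\<close> and equal to 1 at
  \<open>p\<close>.\<close>

definition polar :: "'a \<Rightarrow> 'a set" where
  "polar p = {u. \<forall>y\<in>C. 0 \<le> 1 + u \<bullet> (y - p)}"

lemma pos_affine_polar:
  assumes p: "p \<in> C" and z: "\<zeta> \<in> pos_affine C"
  shows "fst \<zeta> /\<^sub>R (\<zeta> \<bullet> (p, 1)) \<in> polar p"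
  unfolding polar_def
proof safe
  fix y assume y: "y \<in> C"
  have zp: "0 < \<zeta> \<bullet> (p, 1)" by (rule pos_affineD[OF z p])
  have "0 < (\<zeta> \<bullet> (p, 1)) * (1 + (fst \<zeta> /\<^sub>R (\<zeta> \<bullet> (p, 1))) \<bullet> (y - p))"
    using pos_affineD[OF z y] affine_eval_normalized[of \<zeta> p y] zp by simp
  then show "0 \<le> 1 + (fst \<zeta> /\<^sub>R (\<zeta> \<bullet> (p, 1))) \<bullet> (y - p)"
    using zp by (simp add: zero_less_mult_iff)
qed

text \<open>Boundedness comes from a ball around \<open>p\<close> contained in
  \<open>C\<close>.\<close>

lemma compact_polar:
  assumes p: "p \<in> C" shows "compact (polar p)"
  unfolding compact_eq_bounded_closed
proof
  obtain e where e: "e > 0" "cball p e \<subseteq> C" using open_C p open_contains_cball by blast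
  have "norm u \<le> 1 / e" if u: "u \<in> polar p" for u
  proof (cases "u = 0")
    case False
    define y where "y = p - (e / norm u) *\<^sub>R u"
    have "y \<in> C" using e False by (intro subsetD[OF e(2)]) (simp add: y_def dist_norm)
    then have "0 \<le> 1 + u \<bullet> (y - p)" using u by (simp add: polar_def)
    also have "u \<bullet> (y - p) = - (e * norm u)"
      using False by (simp add: y_def power2_norm_eq_inner[symmetric] power2_eq_square)
    finally show ?thesis using e by (simp add: field_simps)
  qed (use e in auto)
  then show "bounded (polar p)" unfolding bounded_iff by blast
  have "polar p = (\<Inter>y\<in>C. {u. 0 \<le> 1 + u \<bullet> (y - p)})" by (auto simp: polar_def)
  then show "closed (polar p)"
    by (simp only:) (intro closed_INT ballI closed_Collect_le continuous_intros)
qed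

text \<open>Here the absence of lines enters: in a direction orthogonal to the polar body all
  positive affine functions are constant, so the whole line through \<open>p\<close> in that
  direction would lie in \<open>C\<close>.\<close>

lemma span_polar:
  assumes p: "p \<in> C" shows "span (polar p) = UNIV"
proof (rule ccontr)
  assume "span (polar p) \<noteq> UNIV"
  then have "span (polar p) \<subset> span UNIV" by auto
  then obtain w where w: "w \<noteq> 0" "\<And>u. u \<in> span (polar p) \<Longrightarrow> orthogonal w u"
    by (rule orthogonal_to_subspace_exists_gen) blast
  obtain t where t: "p + t *\<^sub>R w \<notin> C" using no_line[OF w(1)] by blast
  have "p + t *\<^sub>R w \<in> C"
  proof (rule mem_C_if_pos)
    fix \<zeta> assume z: "\<zeta> \<in> pos_affine C"
    have zp: "0 < \<zeta> \<bullet> (p, 1)" by (rule pos_affineD[OF z p])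
    have "(fst \<zeta> /\<^sub>R (\<zeta> \<bullet> (p, 1))) \<bullet> w = 0"
      using w(2)[OF span_base[OF pos_affine_polar[OF p z]]] by (simp add: orthogonal_def inner_commute)
    then show "0 < \<zeta> \<bullet> (p + t *\<^sub>R w, 1)"
      using zp affine_eval_normalized[of \<zeta> p "p + t *\<^sub>R w"] by simp
  qed
  with t show False by blast
qed

end

text \<open>Let \<open>U\<close> be the matrix of a maximal family \<open>u\<close>. The
  parallelepiped \<open>E\<close> lies in the ball because any normalized functional is a
  combination of the \<open>u i\<close> with coefficients at most 1. On \<open>E\<close> the density
  is at least a multiple of \<open>\<bar>det U\<bar>\<close>, while the volume of \<open>E\<close>
  is \<open>(2 * \<eta>) ^ CARD('n) / \<bar>det U\<bar>\<close>; the determinant cancels.\<close>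

lemma local_volume:
  fixes C :: "(real^'n) set"
  assumes f: "proper_density f" and C: "properly_open_convex C" and p: "p \<in> C" and \<rho>: "0 < \<rho>" "\<rho> \<le> 1"
  shows "ennreal (f orthant 1 * (\<rho> / (4 * CARD('n))) ^ CARD('n)) \<le>
    (\<integral>\<^sup>+ y \<in> hilbert_ball C p \<rho>. ennreal (f C y) \<partial>lborel)"
proof -
  interpret properly_convex C by unfold_locales (rule C)
  have n: "0 < CARD('n)" by simp
  have "dim (polar p) = CARD('n)" using span_polar[OF p] by (metis dim_UNIV dim_span DIM_cart DIM_real mult.right_neutral)
  then obtain u :: "'n \<Rightarrow> real^'n" where u: "\<And>i. u i \<in> polar p"
    and coord: "\<And>x. x \<in> polar p \<Longrightarrow> \<exists>c. x = (\<Sum>i\<in>UNIV. c i *\<^sub>R u i) \<and> (\<forall>i. \<bar>c i\<bar> \<le> 1)"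
    using max_det_basis[OF compact_polar[OF p]] by blast
  \<comment> \<open>Chosen so that every functional normalized at \<open>p\<close> varies on
    \<open>E\<close> by at most \<open>CARD('n) * \<eta> = \<rho> / 4\<close>.\<close>
  define \<eta> where "\<eta> = \<rho> / (4 * CARD('n))"
  have eta: "0 < \<eta>" "CARD('n) * \<eta> = \<rho> / 4" "\<eta> \<le> 1"
  proof -
    have n1: "1 \<le> real CARD('n)" using n by simp
    then show "0 < \<eta>" "CARD('n) * \<eta> = \<rho> / 4" using \<rho> by (simp_all add: \<eta>_def)
    have "\<rho> \<le> 4 * real CARD('n)" using \<rho> n1 by linarith
    with n1 show "\<eta> \<le> 1" unfolding \<eta>_def by (intro divide_le_eq_1_pos[THEN iffD2]) linarith+
  qed
  define U where "U = (\<chi> i. u i)"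
  define E where "E = {y. \<forall>i. \<bar>u i \<bullet> (y - p)\<bar> \<le> \<eta>}"
  have Uv: "(U *v h) $ i = u i \<bullet> h" for h i by (simp add: U_def matrix_vector_mul_component)
  have injU: "h = 0" if "U *v h = 0" for h
  proof -
    have "u i \<bullet> h = 0" for i using Uv[of h i] that by simp
    then have "x \<bullet> h = 0" if "x \<in> polar p" for x
      using coord[OF that] by (auto simp: inner_sum_left)
    then have "span (polar p) \<subseteq> {x. x \<bullet> h = 0}"
      by (intro span_minimal) (auto simp: subspace_def inner_add_left)
    then have "h \<bullet> h = 0" using span_polar[OF p] by blast
    then show ?thesis by simp
  qed
  have linU: "linear ((*v) U)" by simp
  have inj: "inj ((*v) U)" using linear_injective_0[OF linU] injU by blast
  have near: "\<bar>\<zeta> \<bullet> (y, 1) - \<zeta> \<bullet> (p, 1)\<bar> \<le> (\<rho> / 4) * (\<zeta> \<bullet> (p, 1))"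
    if y: "y \<in> E" and z: "\<zeta> \<in> pos_affine C" for y \<zeta>
  proof -
    have zp: "0 < \<zeta> \<bullet> (p, 1)" by (rule pos_affineD[OF z p])
    let ?v = "fst \<zeta> /\<^sub>R (\<zeta> \<bullet> (p, 1))"
    obtain c where c: "?v = (\<Sum>i\<in>UNIV. c i *\<^sub>R u i)" "\<And>i. \<bar>c i\<bar> \<le> 1"
      using coord[OF pos_affine_polar[OF p z]] by blast
    have "\<bar>?v \<bullet> (y - p)\<bar> = \<bar>\<Sum>i\<in>UNIV. c i * (u i \<bullet> (y - p))\<bar>"
      unfolding c(1) by (simp add: inner_sum_left)
    also have "\<dots> \<le> (\<Sum>i\<in>UNIV. \<bar>c i * (u i \<bullet> (y - p))\<bar>)" by (rule sum_abs)
    also have "\<dots> \<le> (\<Sum>i\<in>(UNIV :: 'n set). 1 * \<eta>)"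
      unfolding abs_mult using c(2) y eta by (intro sum_mono mult_mono) (auto simp: E_def)
    also have "\<dots> = \<rho> / 4" using eta by simp
    finally have 1: "\<bar>?v \<bullet> (y - p)\<bar> \<le> \<rho> / 4" .
    have "\<zeta> \<bullet> (y, 1) - \<zeta> \<bullet> (p, 1) = (\<zeta> \<bullet> (p, 1)) * (?v \<bullet> (y - p))"
      using affine_eval_normalized[of \<zeta> p y] zp by (simp add: algebra_simps)
    then show ?thesis using zp 1 by (simp add: abs_mult mult.commute mult_right_mono)
  qed
  have EC: "E \<subseteq> C"
  proof
    fix y assume y: "y \<in> E"
    show "y \<in> C"
    proof (rule mem_C_if_pos)
      fix \<zeta> assume z: "\<zeta> \<in> pos_affine C"
      have "(\<rho> / 4) * (\<zeta> \<bullet> (p, 1)) < 1 * (\<zeta> \<bullet> (p, 1))"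
        using \<rho> pos_affineD[OF z p] by (intro mult_strict_right_mono) auto
      then show "0 < \<zeta> \<bullet> (y, 1)" using near[OF y z] by linarith
    qed
  qed
  have EB: "E \<subseteq> hilbert_ball C p \<rho>"
  proof
    fix y assume y: "y \<in> E"
    have "hilbert_dist C p y \<le> \<rho> / 2"
      by (rule hilbert_dist_near[OF p _ _ _ exp_margin[OF \<rho>] near[OF y]]) (use EC y \<rho> in auto)
    then show "y \<in> hilbert_ball C p \<rho>" using EC y \<rho> by (auto simp: hilbert_ball_def)
  qed
  \<comment> \<open>The affine map with coordinates \<open>1 + u i \<bullet> (y - p)\<close>,
    written in homogeneous coordinates; it sends \<open>C\<close> into the orthant and
    \<open>p\<close> to \<open>1\<close>.\<close>
  let ?L = "\<lambda>(y, w::real). (\<chi> i. u i \<bullet> y + w * (1 - u i \<bullet> p), w)"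
  define T where "T = (\<lambda>y. fst (?L (y, 1)) /\<^sub>R snd (?L (y, 1)))"
  have Tc: "T y $ i = 1 + u i \<bullet> (y - p)" for y i by (simp add: T_def inner_diff_right)
  have linL: "linear ?L"
    by (rule linearI) (auto simp: vec_eq_iff inner_add_right algebra_simps)
  have injL: "inj ?L"
  proof -
    have "q = 0" if "?L q = 0" for q
    proof -
      obtain y w where q: "q = (y, w)" by (cases q)
      have w: "w = 0" and "\<forall>i. u i \<bullet> y + w * (1 - u i \<bullet> p) = 0"
        using that by (auto simp: q zero_prod_def vec_eq_iff)
      then have "U *v y = 0" by (simp add: vec_eq_iff Uv)
      then show ?thesis using injU w by (simp add: q zero_prod_def)
    qed
    then show ?thesis using linear_injective_0[OF linL] by blast
  qed
  have bijL: "bij ?L" using linear_injective_imp_surjective[OF linL injL] injL by (simp add: bij_def)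
  have posT: "0 < 1 + u i \<bullet> (y - p)" if "y \<in> C" for i y
  proof -
    have "(u i, 1 - u i \<bullet> p) \<in> pos_affine C"
      by (rule nonneg_affine_imp_pos_affine[OF open_C _ p])
        (use u[of i] in \<open>auto simp: polar_def inner_diff_right algebra_simps\<close>)
    from pos_affineD[OF this that] show ?thesis by (simp add: inner_diff_right)
  qed
  have JT: "Jac T y = \<bar>det U\<bar>" for y
  proof -
    have "T = (\<lambda>y. (\<chi> i. 1) + U *v (y - p))" by (rule ext) (simp add: vec_eq_iff Tc Uv)
    then have "(T has_derivative (\<lambda>h. U *v h)) (at y)"
      by (auto intro!: derivative_eq_intros bounded_linear.has_derivative[OF matrix_vector_mul_bounded_linear])
    from Jac_derivative[OF this] show ?thesis by simp
  qed
  have fge: "f orthant 1 * \<bar>det U\<bar> / 2 ^ CARD('n) \<le> f C y" if y: "y \<in> E" for y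
  proof -
    have yC: "y \<in> C" using y EC by blast
    have "f orthant 1 * \<bar>det U\<bar> \<le> f C y * (\<Prod>i\<in>UNIV. T y $ i)"
      using density_ge_simplex(1)[OF f C linL bijL _ _ T_def yC] posT unfolding JT
      by (simp add: inner_diff_right algebra_simps)
    also have "\<dots> \<le> f C y * (\<Prod>i\<in>(UNIV::'n set). 2)"
    proof (intro mult_left_mono prod_mono conjI)
      show "0 \<le> T y $ i" for i using posT[OF yC] by (simp add: Tc less_imp_le)
      show "T y $ i \<le> 2" for i using y eta(3) by (auto simp: Tc E_def abs_le_iff intro: order_trans)
      show "0 \<le> f C y" using proper_density_pos[OF f C yC] by simp
    qed
    finally show ?thesis by (simp add: divide_le_eq)
  qed
  have closedE: "closed E"
  proof -
    have "E = (\<Inter>i. {y. \<bar>u i \<bullet> (y - p)\<bar> \<le> \<eta>})" by (auto simp: E_def)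
    then show ?thesis by (simp only:) (intro closed_INT ballI closed_Collect_le continuous_intros)
  qed
  have vol: "ennreal \<bar>det U\<bar> * emeasure lborel E = ennreal ((2 * \<eta>) ^ CARD('n))"
  proof -
    define E0 where "E0 = {h. \<forall>i. \<bar>u i \<bullet> h\<bar> \<le> \<eta>}"
    have E0: "E = (+) p ` E0"
    proof (rule set_eqI, rule iffI)
      fix x assume "x \<in> E"
      then show "x \<in> (+) p ` E0" by (intro image_eqI[of _ _ "x - p"]) (auto simp: E_def E0_def)
    qed (auto simp: E_def E0_def)
    let ?B = "cbox (\<chi> i. - \<eta>) (\<chi> i. \<eta>) :: (real^'n) set"
    have im: "(*v) U ` E0 = ?B"
    proof
      show "(*v) U ` E0 \<subseteq> ?B" by (auto simp: E0_def mem_box_cart Uv abs_le_iff minus_le_iff)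
      show "?B \<subseteq> (*v) U ` E0"
      proof
        fix b assume b: "b \<in> ?B"
        obtain h where h: "b = U *v h" using linear_injective_imp_surjective[OF linU inj] by (metis surjD)
        have "h \<in> E0" using b by (auto simp: h E0_def mem_box_cart Uv abs_le_iff) (metis minus_le_iff)
        then show "b \<in> (*v) U ` E0" using h by blast
      qed
    qed
    have clE0: "closed E0"
    proof -
      have "E0 = (\<Inter>i. {y. \<bar>u i \<bullet> y\<bar> \<le> \<eta>})" by (auto simp: E0_def)
      then show ?thesis by (simp only:) (intro closed_INT ballI closed_Collect_le continuous_intros)
    qed
    have "bounded E0"
    proof -
      obtain B where B: "B > 0" "\<And>x. B * norm x \<le> norm (U *v x)"
        using linear_inj_bounded_below_pos[OF linU inj] by blast
      obtain K where K: "\<And>b. b \<in> ?B \<Longrightarrow> norm b \<le> K" using bounded_cbox bounded_iff by metis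
      have "norm x \<le> K / B" if "x \<in> E0" for x
        using B(2)[of x] K[of "U *v x"] im that B(1) by (force simp: field_simps)
      then show ?thesis unfolding bounded_iff by blast
    qed
    then have "emeasure lborel ((*v) U ` E0) = ennreal \<bar>det (matrix ((*v) U))\<bar> * emeasure lborel E0"
      using clE0 by (intro emeasure_linear_image linU) (auto simp: im)
    then have "ennreal \<bar>det U\<bar> * emeasure lborel E0 = emeasure lborel ?B" unfolding im by simp
    also have "\<dots> = ennreal (measure lborel ?B)"
      using emeasure_bounded_finite[of ?B] by (intro emeasure_eq_ennreal_measure) (auto simp: less_top)
    also have "measure lborel ?B = (2 * \<eta>) ^ CARD('n)"
      using eta(1) by (subst content_cbox_cart) (auto simp: interval_eq_empty_cart)
    also have "emeasure lborel E0 = emeasure lborel E"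
    proof -
      have "emeasure lebesgue ((\<lambda>x. x + p) ` E0) = emeasure lebesgue E0"
        using emeasure_lebesgue_affine[of 1 p E0] by (simp cong: image_cong_simp)
      moreover have "(+) p ` E0 = (\<lambda>x. x + p) ` E0" by (intro image_cong) (auto simp: add.commute)
      ultimately show ?thesis using clE0 closedE by (simp add: E0[symmetric])
    qed
    finally show ?thesis .
  qed
  have c0: "0 \<le> f orthant 1"
    using proper_density_pos[OF f properly_open_convex_orthant, of 1] by (simp add: orthant_def)
  have "ennreal (f orthant 1 * \<eta> ^ CARD('n)) = ennreal (f orthant 1 / 2 ^ CARD('n)) * ennreal ((2 * \<eta>) ^ CARD('n))"
    using c0 eta(1) by (simp add: ennreal_mult[symmetric] power_mult_distrib)
  also have "\<dots> = ennreal (f orthant 1 / 2 ^ CARD('n) * \<bar>det U\<bar>) * emeasure lborel E"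
  proof -
    have "ennreal (f orthant 1 / 2 ^ CARD('n) * \<bar>det U\<bar>) = ennreal (f orthant 1 / 2 ^ CARD('n)) * ennreal \<bar>det U\<bar>"
      using c0 by (intro ennreal_mult) auto
    then show ?thesis unfolding vol[symmetric] by (simp only: mult.assoc)
  qed
  also have "\<dots> = (\<integral>\<^sup>+ y. ennreal (f orthant 1 * \<bar>det U\<bar> / 2 ^ CARD('n)) * indicator E y \<partial>lborel)"
    using closedE by (subst nn_integral_cmult_indicator) (auto simp: mult_ac)
  also have "\<dots> \<le> (\<integral>\<^sup>+ y \<in> hilbert_ball C p \<rho>. ennreal (f C y) \<partial>lborel)"
    by (intro nn_integral_mono) (use fge EB in \<open>auto simp: indicator_def ennreal_leI\<close>)
  finally show ?thesis unfolding \<eta>_def .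
qed

section \<open>Hausdorff measure\<close>

definition fine_cover :: "real \<Rightarrow> 'a::euclidean_space set \<Rightarrow> (nat \<Rightarrow> 'a set) \<Rightarrow> bool" where
  "fine_cover \<delta> A U \<longleftrightarrow> A \<subseteq> (\<Union>i. U i) \<and> (\<forall>i. bounded (U i) \<and> diameter (U i) \<le> \<delta>)"

definition hausdorff_pre :: "nat \<Rightarrow> real \<Rightarrow> 'a::euclidean_space set \<Rightarrow> ennreal" where
  "hausdorff_pre k \<delta> A = (INF U\<in>Collect (fine_cover \<delta> A). \<Sum>i. hausdorff_gauge k (U i))"

lemma hausdorff_outer_eq: "hausdorff_outer k A = (SUP \<delta>\<in>{0<..}. hausdorff_pre k \<delta> A)"
  unfolding hausdorff_outer_def hausdorff_pre_def fine_cover_def ..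

lemma hausdorff_pre_le_outer: "0 < \<delta> \<Longrightarrow> hausdorff_pre k \<delta> A \<le> hausdorff_outer k A"
  unfolding hausdorff_outer_eq by (rule SUP_upper) simp

lemma hausdorff_pre_le: "fine_cover \<delta> A U \<Longrightarrow> hausdorff_pre k \<delta> A \<le> (\<Sum>i. hausdorff_gauge k (U i))"
  unfolding hausdorff_pre_def by (rule INF_lower) simp

lemma hausdorff_outer_mono:
  assumes "A \<subseteq> B" shows "hausdorff_outer k A \<le> hausdorff_outer k B"
  unfolding hausdorff_outer_eq
proof (rule SUP_mono)
  fix \<delta> :: real assume d: "\<delta> \<in> {0<..}"
  have "hausdorff_pre k \<delta> A \<le> hausdorff_pre k \<delta> B"
    unfolding hausdorff_pre_def
  proof (rule INF_superset_mono)
    show "Collect (fine_cover \<delta> B) \<subseteq> Collect (fine_cover \<delta> A)"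
      using assms unfolding fine_cover_def by blast
  qed simp
  with d show "\<exists>m\<in>{0<..}. hausdorff_pre k \<delta> A \<le> hausdorff_pre k m B" by blast
qed

lemma hausdorff_outer_empty [simp]: "hausdorff_outer k {} = 0"
proof -
  have "hausdorff_pre k \<delta> {} \<le> 0" if "\<delta> > 0" for \<delta>
  proof -
    have "fine_cover \<delta> {} (\<lambda>_. {})" using that by (simp add: fine_cover_def)
    from hausdorff_pre_le[OF this, of k] show ?thesis by (simp add: hausdorff_gauge_def)
  qed
  then have "hausdorff_outer k {} \<le> 0" unfolding hausdorff_outer_eq by (intro SUP_least) auto
  then show ?thesis by simp
qed

lemma fine_cover_near_inf:
  assumes "e > 0" "hausdorff_pre k \<delta> A < top"
  obtains U where "fine_cover \<delta> A U" "(\<Sum>i. hausdorff_gauge k (U i)) \<le> hausdorff_pre k \<delta> A + e"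
proof -
  have "hausdorff_pre k \<delta> A < hausdorff_pre k \<delta> A + e"
    using assms by (cases "hausdorff_pre k \<delta> A"; cases e) (auto simp: ennreal_plus[symmetric] ennreal_less_iff simp del: ennreal_plus)
  then obtain U where "fine_cover \<delta> A U" "(\<Sum>i. hausdorff_gauge k (U i)) < hausdorff_pre k \<delta> A + e"
    unfolding hausdorff_pre_def INF_less_iff by auto
  then show thesis using that less_imp_le by blast
qed

lemma hausdorff_outer_subadditive:
  "hausdorff_outer k (\<Union>i. A i) \<le> (\<Sum>i. hausdorff_outer k (A i))"
proof (cases "(\<Sum>i. hausdorff_outer k (A i)) = top")
  case False
  have fin: "hausdorff_outer k (A i) < top" for i
    by (rule ennreal_suminf_lessD[where f = "\<lambda>i. hausdorff_outer k (A i)"]) (use False in \<open>simp add: less_top\<close>)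
  show ?thesis
    unfolding hausdorff_outer_eq[of k "\<Union>i. A i"]
  proof (rule SUP_least, rule ennreal_le_epsilon)
    fix \<delta> e :: real assume d: "\<delta> \<in> {0<..}" and e: "0 < e"
    have "\<exists>U. fine_cover \<delta> (A i) U \<and>
        (\<Sum>j. hausdorff_gauge k (U j)) \<le> hausdorff_outer k (A i) + ennreal (e * (1 / 2) ^ Suc i)" for i
    proof -
      have le: "hausdorff_pre k \<delta> (A i) \<le> hausdorff_outer k (A i)" using d by (intro hausdorff_pre_le_outer) simp
      have e0: "0 < ennreal (e * (1 / 2) ^ Suc i)"
        using e by simp
      obtain U where U: "fine_cover \<delta> (A i) U"
        "(\<Sum>j. hausdorff_gauge k (U j)) \<le> hausdorff_pre k \<delta> (A i) + ennreal (e * (1 / 2) ^ Suc i)"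
        by (rule fine_cover_near_inf[OF e0 le_less_trans[OF le fin]])
      from U(2) add_right_mono[OF le] have
        "(\<Sum>j. hausdorff_gauge k (U j)) \<le> hausdorff_outer k (A i) + ennreal (e * (1 / 2) ^ Suc i)"
        by (rule order_trans)
      with U(1) show ?thesis by blast
    qed
    then obtain U where U: "\<And>i. fine_cover \<delta> (A i) (U i)"
      "\<And>i. (\<Sum>j. hausdorff_gauge k (U i j)) \<le> hausdorff_outer k (A i) + ennreal (e * (1 / 2) ^ Suc i)"
      by metis
    \<comment> \<open>Enumerates the double family of covers; the error in the \<open>i\<close>-th
      cover was \<open>e / 2 ^ (i + 1)\<close>, and these sum to \<open>e\<close>.\<close>
    define V where "V n = (case prod_decode n of (i, j) \<Rightarrow> U i j)" for n
    have "fine_cover \<delta> (\<Union>i. A i) V"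
      unfolding fine_cover_def
    proof (intro conjI allI subsetI)
      fix x assume "x \<in> (\<Union>i. A i)"
      then obtain i where "x \<in> A i" by blast
      then obtain j where "x \<in> U i j" using U(1)[of i] by (auto simp: fine_cover_def)
      then have "x \<in> V (prod_encode (i, j))" by (simp add: V_def)
      then show "x \<in> (\<Union>n. V n)" by blast
    next
      fix n show "bounded (V n)" "diameter (V n) \<le> \<delta>"
        using U(1) by (auto simp: V_def fine_cover_def split: prod.split)
    qed
    then have "hausdorff_pre k \<delta> (\<Union>i. A i) \<le> (\<Sum>n. hausdorff_gauge k (V n))" by (rule hausdorff_pre_le)
    also have "\<dots> = (\<Sum>n. (\<lambda>(i, j). hausdorff_gauge k (U i j)) (prod_decode n))"
      by (intro suminf_cong) (simp add: V_def split: prod.split)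
    also have "\<dots> = (\<Sum>i. \<Sum>j. hausdorff_gauge k (U i j))"
      by (rule suminf_ennreal_2dimen) simp
    also have "\<dots> \<le> (\<Sum>i. hausdorff_outer k (A i) + ennreal (e * (1 / 2) ^ Suc i))"
      by (rule suminf_le[OF U(2)]) auto
    also have "\<dots> = (\<Sum>i. hausdorff_outer k (A i)) + (\<Sum>i. ennreal (e * (1 / 2) ^ Suc i))"
      by (rule suminf_add[symmetric]) auto
    also have "(\<Sum>i. ennreal (e * (1 / 2) ^ Suc i)) = ennreal e"
      using e sums_mult[OF power_half_series, of e] by (intro suminf_ennreal_eq) auto
    finally show "hausdorff_pre k \<delta> (\<Union>i. A i) \<le> (\<Sum>i. hausdorff_outer k (A i)) + ennreal e" .
  qed
qed simp

lemma hausdorff_outer_Un: "hausdorff_outer k (A \<union> B) \<le> hausdorff_outer k A + hausdorff_outer k B"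
proof -
  have "hausdorff_outer k (\<Union>i. (\<lambda>i::nat. if i = 0 then A else if i = 1 then B else {}) i) \<le>
     (\<Sum>i. hausdorff_outer k ((\<lambda>i::nat. if i = 0 then A else if i = 1 then B else {}) i))"
    by (rule hausdorff_outer_subadditive)
  also have "\<dots> = (\<Sum>i\<in>{0, 1}. hausdorff_outer k ((\<lambda>i::nat. if i = 0 then A else if i = 1 then B else {}) i))"
    by (rule suminf_finite) auto
  finally show ?thesis by (auto intro: order_trans[OF hausdorff_outer_mono])
qed

text \<open>A covering set smaller than the gap meets at most one of the two sets, so a fine cover
  of the union splits into a cover of each. As the two scales are independent, both suprema can be
  taken.\<close>

lemma hausdorff_outer_separated:
  assumes d: "d > 0" and sep: "\<And>x y. x \<in> A \<Longrightarrow> y \<in> B \<Longrightarrow> d \<le> dist x y"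
  shows "hausdorff_outer k A + hausdorff_outer k B \<le> hausdorff_outer k (A \<union> B)"
proof -
  have *: "hausdorff_pre k \<delta> A + hausdorff_pre k \<delta>' B \<le> hausdorff_outer k (A \<union> B)"
    if "\<delta> > 0" "\<delta>' > 0" for \<delta> \<delta>'
  proof -
    \<comment> \<open>At most both scales, and strictly below the gap \<open>d\<close>.\<close>
    define t where "t = min (min \<delta> \<delta>') (d / 2)"
    have t: "t > 0" "t \<le> \<delta>" "t \<le> \<delta>'" "t < d" using that d by (auto simp: t_def)
    have "hausdorff_pre k \<delta> A + hausdorff_pre k \<delta>' B \<le> hausdorff_pre k t (A \<union> B)"
      unfolding hausdorff_pre_def[of k t]
    proof (rule INF_greatest)
      fix U assume "U \<in> Collect (fine_cover t (A \<union> B))"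
      then have U: "A \<union> B \<subseteq> (\<Union>i. U i)" "\<And>i. bounded (U i)" "\<And>i. diameter (U i) \<le> t"
        by (auto simp: fine_cover_def)
      define V where "V X i = (if U i \<inter> X = {} then {} else U i)" for X i
      have cov: "X \<subseteq> (\<Union>i. V X i)" if X: "X \<subseteq> A \<union> B" for X
      proof
        fix x assume "x \<in> X"
        then obtain i where "x \<in> U i" using U(1) X by blast
        with \<open>x \<in> X\<close> have "x \<in> V X i" by (auto simp: V_def)
        then show "x \<in> (\<Union>i. V X i)" by blast
      qed
      have small: "bounded (V X i)" "diameter (V X i) \<le> t" for X i using U t by (auto simp: V_def)
      have "fine_cover \<delta> A (V A)" "fine_cover \<delta>' B (V B)"
        using cov[of A] cov[of B] small(1) order_trans[OF small(2) t(2)] order_trans[OF small(2) t(3)]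
        unfolding fine_cover_def by blast+
      then have "hausdorff_pre k \<delta> A + hausdorff_pre k \<delta>' B \<le>
          (\<Sum>i. hausdorff_gauge k (V A i)) + (\<Sum>i. hausdorff_gauge k (V B i))"
        by (intro add_mono hausdorff_pre_le)
      also have "\<dots> = (\<Sum>i. hausdorff_gauge k (V A i) + hausdorff_gauge k (V B i))"
        by (rule suminf_add) auto
      also have "\<dots> \<le> (\<Sum>i. hausdorff_gauge k (U i))"
      proof (rule suminf_le)
        fix i
        have "U i \<inter> A = {} \<or> U i \<inter> B = {}"
        proof (rule ccontr)
          assume "\<not> ?thesis"
          then obtain x y where xy: "x \<in> U i" "x \<in> A" "y \<in> U i" "y \<in> B" by blast
          have "dist x y \<le> t" using diameter_bounded_bound[OF U(2) xy(1,3)] U(3)[of i] by linarith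
          with sep[OF xy(2,4)] t(4) show False by linarith
        qed
        then show "hausdorff_gauge k (V A i) + hausdorff_gauge k (V B i) \<le> hausdorff_gauge k (U i)"
          by (auto simp: V_def hausdorff_gauge_def)
      qed auto
      finally show "hausdorff_pre k \<delta> A + hausdorff_pre k \<delta>' B \<le> (\<Sum>i. hausdorff_gauge k (U i))" .
    qed
    also have "\<dots> \<le> hausdorff_outer k (A \<union> B)" by (rule hausdorff_pre_le_outer[OF t(1)])
    finally show ?thesis .
  qed
  have ne: "{0::real<..} \<noteq> {}"
  proof -
    have "1 \<in> {0::real<..}" by simp
    then show ?thesis by blast
  qed
  have 1: "hausdorff_pre k \<delta> A + hausdorff_outer k B \<le> hausdorff_outer k (A \<union> B)" if "\<delta> > 0" for \<delta>
    unfolding hausdorff_outer_eq[of k B] ennreal_SUP_add_right[OF ne]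
    by (intro SUP_least *) (use that in auto)
  show ?thesis
    unfolding hausdorff_outer_eq[of k A] ennreal_SUP_add_left[OF ne, symmetric]
    by (rule SUP_least, rule 1) simp
qed

text \<open>
  Caratheodory's criterion for metric outer measures. The shells \<open>R n\<close> around \<open>F\<close> with indices of
  equal parity are pairwise separated, hence their measures are summable.
\<close>

lemma hausdorff_outer_closed_split:
  fixes F :: "'a::euclidean_space set"
  assumes F: "closed F"
  shows "hausdorff_outer k (X \<inter> F) + hausdorff_outer k (X - F) \<le> hausdorff_outer k X"
proof (cases "F = {} \<or> hausdorff_outer k X = top")
  case False
  then have Fne: "F \<noteq> {}" and fin: "hausdorff_outer k X < top" by (auto simp: less_top)
  let ?H = "hausdorff_outer k"
  let ?D = "\<lambda>x. infdist x F"
  define R where "R n = {x \<in> X. 1 / (real n + 2) \<le> ?D x \<and> ?D x < 1 / (real n + 1)}" for n :: nat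
  have lip: "?D x - ?D y \<le> dist x y" for x y using infdist_triangle[of x F y] by linarith
  \<comment> \<open>The guard excludes \<open>m = 0\<close>, for which division by zero would give
    \<open>1 / real m = 0\<close> and hence all of \<open>X\<close>.\<close>
  define B where "B m = {x \<in> X. 0 < m \<and> 1 / real m \<le> ?D x}" for m :: nat
  \<comment> \<open>\<open>R m\<close> stays below the distance \<open>1 / (real m + 1)\<close> and
    so at a positive gap from \<open>B m\<close>; the shell in between is skipped to keep that gap,
    whence the step by 2.\<close>
  have shell: "?H (B m) + ?H (R m) \<le> ?H (B (m + 2))" for m
  proof -
    define d where "d = (if m = 0 then 1 else 1 / real m - 1 / (real m + 1))"
    have "1 / (real m + 1) < 1 / real m" if "m \<noteq> 0" using that by (intro divide_strict_left_mono) auto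
    then have "d > 0" by (auto simp: d_def)
    moreover have "d \<le> dist x y" if "x \<in> B m" "y \<in> R m" for x y
      using that lip[of x y] by (auto simp: B_def R_def d_def)
    ultimately have "?H (B m) + ?H (R m) \<le> ?H (B m \<union> R m)" by (rule hausdorff_outer_separated)
    also have "\<dots> \<le> ?H (B (m + 2))"
    proof (rule hausdorff_outer_mono)
      have "1 / (real m + 2) \<le> 1 / real m" if "0 < m" using that by (simp add: field_simps)
      then show "B m \<union> R m \<subseteq> B (m + 2)" by (auto simp: B_def R_def add.commute intro: order_trans)
    qed
    finally show ?thesis .
  qed
  have parity: "(\<Sum>j<N. ?H (R (2 * j + c))) \<le> ?H (B (2 * N + c))" for N c
  proof (induction N)
    case (Suc N)
    have "(\<Sum>j<Suc N. ?H (R (2 * j + c))) \<le> ?H (B (2 * N + c)) + ?H (R (2 * N + c))"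
      using Suc by (simp add: add_right_mono)
    also have "\<dots> \<le> ?H (B (2 * Suc N + c))" using shell[of "2 * N + c"] by (simp add: add.commute)
    finally show ?case .
  qed simp
  have BX: "?H (B m) \<le> ?H X" for m by (rule hausdorff_outer_mono) (auto simp: B_def)
  have split: "(\<Sum>i<2 * N. ?H (R i)) = (\<Sum>j<N. ?H (R (2 * j))) + (\<Sum>j<N. ?H (R (2 * j + 1)))" for N
    by (induction N) (auto simp: algebra_simps)
  have "(\<Sum>i. ?H (R i)) \<le> ?H X + ?H X"
    unfolding suminf_eq_SUP
  proof (rule SUP_least)
    fix N
    have "(\<Sum>i<N. ?H (R i)) \<le> (\<Sum>i<2 * N. ?H (R i))" by (rule sum_mono2) auto
    also have "\<dots> \<le> ?H X + ?H X"
      unfolding split using parity[of 0 N] parity[of 1 N] BX by (intro add_mono) (auto intro: order_trans)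
    finally show "(\<Sum>i<N. ?H (R i)) \<le> ?H X + ?H X" .
  qed
  then have sfin: "(\<Sum>i. ?H (R i)) < top" using fin by (simp add: le_less_trans ennreal_add_less_top)
  define f where "f i = enn2real (?H (R i))" for i
  have RX: "?H (R i) < top" for i
    using ennreal_suminf_lessD[where f = "\<lambda>i. ?H (R i)", OF sfin] by blast
  have Hf: "?H (R i) = ennreal (f i)" for i using RX[of i] by (simp add: f_def less_top)
  have sf: "summable f"
    by (rule summable_suminf_not_top) (use sfin in \<open>auto simp: f_def Hf[symmetric, unfolded f_def] less_top RX\<close>)
  show ?thesis
  proof (rule ennreal_le_epsilon)
    fix e :: real assume e: "0 < e"
    obtain N where N: "\<And>n. n \<ge> N \<Longrightarrow> norm (\<Sum>i. f (i + n)) < e"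
      using suminf_exist_split[OF e sf] by blast
    have "(\<Sum>i. ?H (R (i + N))) = ennreal (\<Sum>i. f (i + N))"
      unfolding Hf by (rule suminf_ennreal2[OF _ summable_ignore_initial_segment[OF sf]]) (simp add: f_def)
    also have "\<dots> \<le> ennreal e" using N[of N] by (intro ennreal_leI) auto
    finally have tail: "(\<Sum>i. ?H (R (i + N))) \<le> ennreal e" .
    \<comment> \<open>Every point of \<open>X\<close> off the closed set \<open>F\<close> has
      positive distance to it. It lies either in \<open>B (N + 1)\<close>, which is separated from
      \<open>F\<close>, or in one of the late shells, whose total measure is at most
      \<open>e\<close>.\<close>
    have "X - F \<subseteq> B (N + 1) \<union> (\<Union>i. R (i + N))"
    proof
      fix x assume x: "x \<in> X - F"
      have pos: "0 < ?D x" using x F Fne by (metis DiffD2 in_closed_iff_infdist_zero infdist_nonneg order_less_le)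
      show "x \<in> B (N + 1) \<union> (\<Union>i. R (i + N))"
      proof (cases "1 / real (N + 1) \<le> ?D x")
        case True then show ?thesis using x by (simp add: B_def)
      next
        case False
        obtain M :: nat where "1 / ?D x < real M" using reals_Archimedean2 by blast
        then have ex: "\<exists>M. 1 / (real M + 2) \<le> ?D x"
          using pos by (intro exI[of _ M]) (simp add: field_simps)
        define m where "m = (LEAST M. 1 / (real M + 2) \<le> ?D x)"
        have m: "1 / (real m + 2) \<le> ?D x" unfolding m_def by (rule LeastI_ex[OF ex])
        have mN: "N \<le> m"
        proof (rule ccontr)
          assume "\<not> N \<le> m"
          then have "1 / real (N + 1) \<le> 1 / (real m + 2)" by (intro divide_left_mono) auto
          with m False show False by linarith
        qed
        have "?D x < 1 / (real m + 1)"
        proof (cases m)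
          case 0 then show ?thesis using mN False by simp
        next
          case (Suc l)
          have "\<not> 1 / (real l + 2) \<le> ?D x" using not_less_Least[of l "\<lambda>M. 1 / (real M + 2) \<le> ?D x"] Suc
            unfolding m_def by auto
          then show ?thesis using Suc by (simp add: add.commute)
        qed
        then have "x \<in> R ((m - N) + N)" using m x mN by (simp add: R_def)
        then show ?thesis by blast
      qed
    qed
    then have "?H (X - F) \<le> ?H (B (N + 1)) + ?H (\<Union>i. R (i + N))"
      by (rule order_trans[OF hausdorff_outer_mono hausdorff_outer_Un])
    also have "?H (\<Union>i. R (i + N)) \<le> ennreal e"
      using hausdorff_outer_subadditive[of k "\<lambda>i. R (i + N)"] tail by (rule order_trans)
    finally have "?H (X \<inter> F) + ?H (X - F) \<le> ?H (X \<inter> F) + (?H (B (N + 1)) + ennreal e)"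
      by (simp add: add_left_mono)
    also have "\<dots> = (?H (X \<inter> F) + ?H (B (N + 1))) + ennreal e" by (simp add: add.assoc)
    also have "?H (X \<inter> F) + ?H (B (N + 1)) \<le> ?H ((X \<inter> F) \<union> B (N + 1))"
    proof (rule hausdorff_outer_separated[of "1 / real (N + 1)"])
      fix x y assume "x \<in> X \<inter> F" "y \<in> B (N + 1)"
      then show "1 / real (N + 1) \<le> dist x y"
        using lip[of y x] by (auto simp: B_def dist_commute)
    qed simp
    also have "\<dots> \<le> ?H X" by (rule hausdorff_outer_mono) (auto simp: B_def)
    finally show "?H (X \<inter> F) + ?H (X - F) \<le> ?H X + ennreal e" by (simp add: add_right_mono)
  qed
qed (auto simp: Un_commute)

text \<open>Closed sets satisfy Caratheodory's criterion, hence so do all Borel sets. Consequently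
  \<open>hausdorff_measure\<close> agrees with \<open>hausdorff_outer\<close> on them instead of
  being replaced by zero in \<open>measure_of\<close>.\<close>

lemma measure_space_hausdorff:
  "measure_space (UNIV :: 'a::euclidean_space set) (sets borel) (hausdorff_outer k)"
proof -
  interpret P: sigma_algebra "UNIV :: 'a set" UNIV by (rule sigma_algebra_Pow[of UNIV, simplified])
  let ?H = "hausdorff_outer k :: 'a set \<Rightarrow> ennreal"
  let ?L = "lambda_system UNIV UNIV ?H"
  have om: "outer_measure_space UNIV ?H"
    unfolding outer_measure_space_def
  proof (intro conjI)
    show "positive UNIV ?H" by (simp add: positive_def)
    show "increasing UNIV ?H" by (simp add: increasing_def hausdorff_outer_mono)
    show "countably_subadditive UNIV ?H"
      unfolding countably_subadditive_def using hausdorff_outer_subadditive by blast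
  qed
  have ms: "measure_space UNIV ?L ?H" by (rule P.caratheodory_lemma[OF om])
  then interpret L: sigma_algebra UNIV ?L by (simp add: measure_space_def)
  have closed: "F \<in> ?L" if "closed F" for F
    unfolding lambda_system_def
  proof safe
    fix X :: "'a set"
    have "?H X \<le> ?H (F \<inter> X) + ?H ((UNIV - F) \<inter> X)"
      by (rule order_trans[OF hausdorff_outer_mono hausdorff_outer_Un]) auto
    moreover have "?H (F \<inter> X) + ?H ((UNIV - F) \<inter> X) \<le> ?H X"
      using hausdorff_outer_closed_split[OF that, of k X] by (simp add: Int_commute Diff_eq)
    ultimately show "?H (F \<inter> X) + ?H ((UNIV - F) \<inter> X) = ?H X" by (rule antisym[rotated])
  qed simp
  have "S \<in> ?L" if "open S" for S
  proof -
    have "UNIV - (- S) \<in> ?L" using that by (intro L.compl_sets closed) auto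
    then show ?thesis by (simp add: Compl_eq_Diff_UNIV[symmetric])
  qed
  then have sub: "sets borel \<subseteq> ?L" unfolding sets_borel by (intro L.sigma_sets_subset) auto
  show ?thesis
    unfolding measure_space_def
  proof (intro conjI)
    show "sigma_algebra UNIV (sets (borel :: 'a measure))" using sets.sigma_algebra_axioms[of "borel :: 'a measure"] by simp
    show "positive (sets borel) ?H" by (simp add: positive_def)
    show "countably_additive (sets borel) ?H"
      using ms sub unfolding measure_space_def countably_additive_def by (meson subset_trans subsetD)
  qed
qed

lemma sets_hausdorff_measure [simp, measurable_cong]: "sets (hausdorff_measure k) = sets borel"
  by (simp add: hausdorff_measure_def sets.sigma_sets_eq[of borel, simplified])

lemma space_hausdorff_measure [simp]: "space (hausdorff_measure k) = UNIV"
  by (simp add: hausdorff_measure_def)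

lemma emeasure_hausdorff_measure:
  assumes "A \<in> sets borel" shows "emeasure (hausdorff_measure k) A = hausdorff_outer k A"
  unfolding hausdorff_measure_def
  by (rule emeasure_measure_of_sigma)
    (use measure_space_hausdorff[of k] assms in \<open>auto simp: measure_space_def\<close>)

section \<open>Normals of convex bodies\<close>

definition unit_normal :: "'a::euclidean_space set \<Rightarrow> 'a \<Rightarrow> 'a \<Rightarrow> bool" where
  "unit_normal K s \<nu> \<longleftrightarrow> norm \<nu> = 1 \<and> (\<forall>y\<in>K. \<nu> \<bullet> (y - s) \<le> 0)"

locale convex_body =
  fixes K :: "'a::euclidean_space set"
  assumes convex_K: "convex K" and closed_K: "closed K" and interior_K: "interior K \<noteq> {}"
begin

lemma frontier_mem: "s \<in> frontier K \<Longrightarrow> s \<in> K"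
  using closed_K frontier_subset_closed by blast

lemma unit_normal_exists:
  assumes "s \<in> frontier K" shows "\<exists>\<nu>. unit_normal K s \<nu>"
proof -
  have "s \<notin> rel_interior K"
    using assms interior_K by (simp add: rel_interior_nonempty_interior frontier_def)
  then obtain a where a: "a \<noteq> 0" "\<And>y. y \<in> K \<Longrightarrow> a \<bullet> s \<le> a \<bullet> y"
    by (rule supporting_hyperplane_rel_boundary[OF convex_K frontier_mem[OF assms]]) blast
  have "unit_normal K s (- (a /\<^sub>R norm a))"
    unfolding unit_normal_def using a by (auto simp: inner_diff_right mult_left_mono)
  then show ?thesis by blast
qed

lemma unit_normal_interior:
  assumes \<nu>: "unit_normal K s \<nu>" and y: "y \<in> interior K"
  shows "\<nu> \<bullet> (y - s) < 0"
proof -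
  obtain e where e: "e > 0" "cball y e \<subseteq> K" using y mem_interior_cball by blast
  have "y + e *\<^sub>R \<nu> \<in> K" using \<nu> e by (intro subsetD[OF e(2)]) (simp add: dist_norm unit_normal_def)
  then have "\<nu> \<bullet> (y + e *\<^sub>R \<nu> - s) \<le> 0" using \<nu> by (simp add: unit_normal_def)
  moreover have "\<nu> \<bullet> \<nu> = 1" using \<nu> by (simp add: unit_normal_def norm_eq_1)
  ultimately show ?thesis using e(1) by (simp add: inner_add_right inner_diff_right)
qed

text \<open>Normals depend upper semicontinuously on the point because being a unit normal is a
  closed relation; where the normal is unique, this is continuity.\<close>

lemma normals_near:
  assumes uniq: "\<And>\<nu>. unit_normal K s \<nu> \<Longrightarrow> \<nu> = \<nu>0" and e: "e > 0"
  shows "\<exists>\<delta>>0. \<forall>p\<in>frontier K \<inter> ball s \<delta>. \<forall>\<nu>. unit_normal K p \<nu> \<longrightarrow> norm (\<nu> - \<nu>0) < e"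
proof -
  \<comment> \<open>Pairs of a nearby point and a normal there that stays away from
    \<open>\<nu>0\<close>. The set is compact, so its projection to the points is closed, and by
    uniqueness it misses \<open>s\<close>.\<close>
  define Z where "Z = {z. fst z \<in> cball s 1} \<inter> {z. norm (snd z) = 1} \<inter>
    (\<Inter>y\<in>K. {z. snd z \<bullet> (y - fst z) \<le> 0}) \<inter> {z. e \<le> norm (snd z - \<nu>0)}"
  have "closed Z"
    unfolding Z_def mem_cball
    by (intro closed_Int closed_INT ballI closed_Collect_le closed_Collect_eq continuous_intros)
  moreover have "bounded Z"
    by (rule bounded_subset[OF bounded_Times[OF bounded_cball[of s 1] bounded_cball[of 0 1]]]) (auto simp: Z_def)
  ultimately have "compact Z" by (simp add: compact_eq_bounded_closed)
  then have "compact (fst ` Z)" by (intro compact_continuous_image continuous_intros)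
  then have "open (- (fst ` Z))" using compact_imp_closed by blast
  moreover have "s \<notin> fst ` Z"
  proof
    assume "s \<in> fst ` Z"
    then obtain \<nu> where \<nu>: "(s, \<nu>) \<in> Z" by (auto simp: image_iff)
    then have "unit_normal K s \<nu>" by (auto simp: Z_def unit_normal_def)
    from uniq[OF this] \<nu> e show False by (simp add: Z_def)
  qed
  ultimately obtain d where d: "d > 0" "ball s d \<subseteq> - (fst ` Z)"
    using open_contains_ball by (metis ComplI)
  have "norm (\<nu> - \<nu>0) < e" if p: "p \<in> ball s (min d 1)" and \<nu>: "unit_normal K p \<nu>" for p \<nu>
  proof (rule ccontr)
    assume "\<not> ?thesis"
    then have "(p, \<nu>) \<in> Z" using p \<nu> by (auto simp: Z_def unit_normal_def)
    then have "p \<in> fst ` Z" by (metis fst_conv imageI)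
    with d(2) p show False by auto
  qed
  then show ?thesis using d(1) by (intro exI[of _ "min d 1"]) auto
qed

text \<open>Each of two frontier points lies on the inner side of a hyperplane supporting
  \<open>K\<close> at the other, and both normals are close to \<open>\<nu>0\<close>. That both
  points vary, as in strict differentiability, is what the covering argument for areas
  needs.\<close>

lemma frontier_flat:
  assumes uniq: "\<And>\<nu>. unit_normal K s \<nu> \<Longrightarrow> \<nu> = \<nu>0" and e: "e > 0"
  shows "\<exists>\<delta>>0. \<forall>p\<in>frontier K \<inter> ball s \<delta>. \<forall>q\<in>frontier K \<inter> ball s \<delta>. \<bar>\<nu>0 \<bullet> (p - q)\<bar> \<le> e * norm (p - q)"
proof -
  obtain d where d: "d > 0"
    "\<And>p \<nu>. p \<in> frontier K \<inter> ball s d \<Longrightarrow> unit_normal K p \<nu> \<Longrightarrow> norm (\<nu> - \<nu>0) < e"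
    using normals_near[OF uniq e] by blast
  have half: "\<nu>0 \<bullet> (q - p) \<le> e * norm (q - p)" if p: "p \<in> frontier K \<inter> ball s d" and q: "q \<in> frontier K \<inter> ball s d" for p q
  proof -
    obtain \<nu> where \<nu>: "unit_normal K p \<nu>" using unit_normal_exists p by blast
    have "\<nu> \<bullet> (q - p) \<le> 0" using \<nu> frontier_mem q by (auto simp: unit_normal_def)
    moreover have "(\<nu>0 - \<nu>) \<bullet> (q - p) \<le> norm (\<nu>0 - \<nu>) * norm (q - p)" by (rule norm_cauchy_schwarz)
    moreover have "norm (\<nu>0 - \<nu>) * norm (q - p) \<le> e * norm (q - p)"
      using d(2)[OF p \<nu>] by (intro mult_right_mono) (auto simp: norm_minus_commute)
    ultimately show ?thesis by (simp add: inner_diff_left)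
  qed
  have "\<bar>\<nu>0 \<bullet> (p - q)\<bar> \<le> e * norm (p - q)" if "p \<in> frontier K \<inter> ball s d" "q \<in> frontier K \<inter> ball s d" for p q
    using half[OF that] half[OF that(2,1)] by (simp add: abs_le_iff inner_diff_right norm_minus_commute)
  then show ?thesis using d(1) by blast
qed

text \<open>If the open ray missed \<open>K\<close>, a hyperplane separating the two would support
  \<open>K\<close> at \<open>s\<close>, so its normal would be \<open>\<nu>0\<close>, against the
  sign of \<open>\<nu>0 \<bullet> d\<close>.\<close>

lemma inward_direction:
  assumes uniq: "\<And>\<nu>. unit_normal K s \<nu> \<Longrightarrow> \<nu> = \<nu>0" and s: "s \<in> K" and d: "\<nu>0 \<bullet> d < 0"
  shows "\<exists>h>0. s + h *\<^sub>R d \<in> K"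
proof (rule ccontr)
  assume none: "\<not> ?thesis"
  let ?A = "(\<lambda>h. s + h *\<^sub>R d) ` {0<..}"
  have "convex ?A"
  proof (rule convexI)
    fix x y and u v :: real assume "x \<in> ?A" "y \<in> ?A" and uv: "0 \<le> u" "0 \<le> v" "u + v = 1"
    then obtain a b where ab: "0 < a" "x = s + a *\<^sub>R d" "0 < b" "y = s + b *\<^sub>R d" by auto
    have "u *\<^sub>R x + v *\<^sub>R y = (u + v) *\<^sub>R s + (u * a + v * b) *\<^sub>R d"
      unfolding ab by (simp add: algebra_simps)
    moreover have "0 < u * a + v * b"
    proof (cases "u = 0")
      case True then show ?thesis using uv ab by simp
    next
      case False then show ?thesis using uv ab by (simp add: add_pos_nonneg)
    qed
    ultimately show "u *\<^sub>R x + v *\<^sub>R y \<in> ?A" using uv(3) by auto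
  qed
  moreover have "?A \<noteq> {}" by (auto simp: image_iff intro: exI[of _ 1])
  moreover have "K \<inter> ?A = {}" using none by auto
  moreover have "K \<noteq> {}" using s by auto
  ultimately obtain a b where ab: "a \<noteq> 0" "\<And>x. x \<in> K \<Longrightarrow> a \<bullet> x \<le> b" "\<And>x. x \<in> ?A \<Longrightarrow> b \<le> a \<bullet> x"
    using separating_hyperplane_sets[OF convex_K, of ?A] by blast
  have lb: "b \<le> a \<bullet> s + h * (a \<bullet> d)" if "h > 0" for h
    using ab(3)[OF imageI[of h]] that by (simp add: inner_add_right)
  have "b \<le> a \<bullet> s"
  proof (rule ccontr)
    assume c: "\<not> ?thesis"
    define h where "h = (b - a \<bullet> s) / (2 * (\<bar>a \<bullet> d\<bar> + 1))"
    have h: "h > 0" using c by (simp add: h_def)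
    have "h * (a \<bullet> d) \<le> h * (\<bar>a \<bullet> d\<bar> + 1)" using h by (intro mult_left_mono) auto
    also have "\<dots> = (b - a \<bullet> s) / 2" by (simp add: h_def field_simps)
    finally have 1: "h * (a \<bullet> d) \<le> (b - a \<bullet> s) / 2" .
    have "b - a \<bullet> s \<le> h * (a \<bullet> d)" using lb[OF h] by simp
    from order_trans[OF this 1] c show False by simp
  qed
  then have eq: "a \<bullet> s = b" using ab(2)[OF s] by simp
  have "unit_normal K s (a /\<^sub>R norm a)"
    unfolding unit_normal_def using ab(1,2) by (auto simp: inner_diff_right eq mult_left_mono)
  from uniq[OF this] have "(a \<bullet> d) / norm a < 0" using d by (auto simp: divide_inverse mult.commute)
  then have "a \<bullet> d < 0" using ab(1) by (simp add: divide_less_0_iff)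
  with lb[of 1] eq show False by simp
qed

text \<open>Existence of the tangent plane is \<open>frontier_flat\<close>. For uniqueness, let
  \<open>w\<close> be the part of another normal orthogonal to \<open>\<nu>0\<close>: if it were not
  zero, the frontier would contain points approaching \<open>s\<close> in directions near
  \<open>w\<close>, along which the quotient does not tend to 0.\<close>

lemma tangent_hyperplane_iff:
  assumes s: "s \<in> frontier K" and n0: "unit_normal K s \<nu>0" and uniq: "\<And>\<nu>. unit_normal K s \<nu> \<Longrightarrow> \<nu> = \<nu>0"
  shows "tangent_hyperplane (frontier K) s H \<longleftrightarrow> H = {q. \<nu>0 \<bullet> (q - s) = 0}"
proof
  assume H: "H = {q. \<nu>0 \<bullet> (q - s) = 0}"
  have "((\<lambda>q. (\<nu>0 \<bullet> (q - s)) / norm (q - s)) \<longlongrightarrow> 0) (at s within frontier K)"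
    unfolding Lim_within
  proof (intro allI impI)
    fix e :: real assume e: "e > 0"
    obtain d where d: "d > 0" "\<forall>p\<in>frontier K \<inter> ball s d. \<forall>q\<in>frontier K \<inter> ball s d. \<bar>\<nu>0 \<bullet> (p - q)\<bar> \<le> (e/2) * norm (p - q)"
      using frontier_flat[of s \<nu>0 "e/2", OF uniq] e by (metis half_gt_zero)
    have "dist ((\<nu>0 \<bullet> (q - s)) / norm (q - s)) 0 < e" if q: "q \<in> frontier K" "0 < dist q s" "dist q s < d" for q
    proof -
      have "\<bar>\<nu>0 \<bullet> (q - s)\<bar> \<le> (e/2) * norm (q - s)"
        by (rule d(2)[rule_format]) (use q s d(1) in \<open>auto simp: dist_commute\<close>)
      then have le: "\<bar>\<nu>0 \<bullet> (q - s)\<bar> / norm (q - s) \<le> e / 2" using q(2) by (simp add: divide_le_eq dist_norm)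
      have eq: "dist ((\<nu>0 \<bullet> (q - s)) / norm (q - s)) 0 = \<bar>\<nu>0 \<bullet> (q - s)\<bar> / norm (q - s)"
        by (simp add: abs_divide)
      show ?thesis unfolding eq by (rule order.strict_trans1[OF le]) (use e in simp)
    qed
    then show "\<exists>d>0. \<forall>x\<in>frontier K. 0 < dist x s \<and> dist x s < d \<longrightarrow> dist ((\<nu>0 \<bullet> (x - s)) / norm (x - s)) 0 < e"
      using d(1) by blast
  qed
  then show "tangent_hyperplane (frontier K) s H"
    unfolding tangent_hyperplane_def using H n0 by (intro exI[of _ \<nu>0]) (auto simp: unit_normal_def)
next
  assume "tangent_hyperplane (frontier K) s H"
  then obtain \<nu> where \<nu>: "\<nu> \<noteq> 0" "H = {q. \<nu> \<bullet> (q - s) = 0}"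
    and lim: "((\<lambda>q. (\<nu> \<bullet> (q - s)) / norm (q - s)) \<longlongrightarrow> 0) (at s within frontier K)"
    unfolding tangent_hyperplane_def by blast
  have n01: "\<nu>0 \<bullet> \<nu>0 = 1" using n0 by (simp add: unit_normal_def norm_eq_1)
  define w where "w = \<nu> - (\<nu> \<bullet> \<nu>0) *\<^sub>R \<nu>0"
  have w0: "\<nu>0 \<bullet> w = 0" using n01 by (simp add: w_def inner_diff_right inner_commute)
  have w1: "\<nu> \<bullet> w = w \<bullet> w" using w0 by (simp add: w_def inner_diff_left inner_commute)
  have "w = 0"
  proof (rule ccontr)
    assume wn: "w \<noteq> 0"
    obtain k where k: "k \<in> interior K" using interior_K by blast
    define c where "c = s - k"
    have c0: "0 < \<nu>0 \<bullet> c" using unit_normal_interior[OF n0 k] by (simp add: c_def inner_diff_right)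
    \<comment> \<open>Small enough for a tilt of \<open>w\<close> by at most \<open>\<theta>\<close>
      along \<open>c\<close> to change \<open>\<nu> \<bullet> w = w \<bullet> w\<close> by at most
      one half of it.\<close>
    define \<theta> where "\<theta> = (w \<bullet> w) / (2 * (\<bar>\<nu> \<bullet> c\<bar> + 1))"
    have th: "0 < \<theta>" "\<theta> * \<bar>\<nu> \<bullet> c\<bar> \<le> (w \<bullet> w) / 2"
    proof -
      show "0 < \<theta>" using wn by (simp add: \<theta>_def)
      then have "\<theta> * \<bar>\<nu> \<bullet> c\<bar> \<le> \<theta> * (\<bar>\<nu> \<bullet> c\<bar> + 1)" by (intro mult_left_mono) auto
      also have "\<dots> = (w \<bullet> w) / 2" by (simp add: \<theta>_def field_simps)
      finally show "\<theta> * \<bar>\<nu> \<bullet> c\<bar> \<le> (w \<bullet> w) / 2" .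
    qed
    define L where "L = norm w + \<theta> * norm c"
    have L: "0 < L" using wn th by (simp add: L_def add_pos_nonneg)
    define \<kappa> where "\<kappa> = (w \<bullet> w) / 2 / L"
    have kap: "\<kappa> > 0" using wn L by (simp add: \<kappa>_def)
    obtain \<delta> where del: "\<delta> > 0" "\<And>q. q \<in> frontier K \<Longrightarrow> 0 < dist q s \<Longrightarrow> dist q s < \<delta> \<Longrightarrow>
        \<bar>(\<nu> \<bullet> (q - s)) / norm (q - s)\<bar> < \<kappa>"
      using lim kap unfolding Lim_within by (metis dist_0_norm dist_commute real_norm_def)
    obtain h1 where h1: "h1 > 0" "s + h1 *\<^sub>R (w - \<theta> *\<^sub>R c) \<in> K"
      using inward_direction[OF uniq frontier_mem[OF s], of "w - \<theta> *\<^sub>R c"] w0 c0 th(1)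
      by (auto simp: inner_diff_right)
    define h where "h = min h1 (\<delta> / (2 * L))"
    have h: "0 < h" "h \<le> h1" "h * L < \<delta>"
    proof -
      show "0 < h" "h \<le> h1" using h1 del(1) L by (auto simp: h_def)
      have "h * L \<le> \<delta> / (2 * L) * L" using L by (intro mult_right_mono) (auto simp: h_def)
      also have "\<dots> = \<delta> / 2" using L by simp
      finally show "h * L < \<delta>" using del(1) by linarith
    qed
    \<comment> \<open>A short transversal path: its start \<open>P (- \<theta>)\<close> is in
      \<open>K\<close> by \<open>inward_direction\<close>, and its end is beyond the supporting
      hyperplane, so it crosses the frontier.\<close>
    define P where "P t = s + h *\<^sub>R (w + t *\<^sub>R c)" for t
    have "P (- \<theta>) \<in> K"
    proof -
      have "P (- \<theta>) = (1 - h / h1) *\<^sub>R s + (h / h1) *\<^sub>R (s + h1 *\<^sub>R (w - \<theta> *\<^sub>R c))"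
        using h1(1) by (simp add: P_def algebra_simps)
      then show ?thesis using h h1 convexD_alt[OF convex_K frontier_mem[OF s] h1(2), of "h / h1"] by simp
    qed
    moreover have "P \<theta> \<notin> K"
    proof
      assume "P \<theta> \<in> K"
      then have "\<nu>0 \<bullet> (P \<theta> - s) \<le> 0" using n0 by (simp add: unit_normal_def)
      then show False using w0 c0 th(1) h(1) by (simp add: P_def inner_add_right mult_le_0_iff)
    qed
    moreover have "connected (P ` {- \<theta>..\<theta>})"
      unfolding P_def by (intro connected_continuous_image continuous_intros) simp
    moreover have "P (- \<theta>) \<in> P ` {- \<theta>..\<theta>}" "P \<theta> \<in> P ` {- \<theta>..\<theta>}" using th(1) by auto
    ultimately have "P ` {- \<theta>..\<theta>} \<inter> frontier K \<noteq> {}"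
      by (intro connected_Int_frontier) blast+
    then obtain t where t: "\<bar>t\<bar> \<le> \<theta>" "P t \<in> frontier K" by (auto simp: abs_le_iff) (metis minus_le_iff)
    have num: "\<nu> \<bullet> (P t - s) \<ge> h * ((w \<bullet> w) / 2)"
    proof -
      have "\<bar>t * (\<nu> \<bullet> c)\<bar> \<le> \<theta> * \<bar>\<nu> \<bullet> c\<bar>" unfolding abs_mult using t(1) by (intro mult_right_mono) auto
      then have "(w \<bullet> w) / 2 \<le> w \<bullet> w + t * (\<nu> \<bullet> c)" using th(2) by (simp add: abs_le_iff)
      then show ?thesis using h(1) by (simp add: P_def inner_add_right w1)
    qed
    have den: "norm (P t - s) \<le> h * L"
    proof -
      have "norm (w + t *\<^sub>R c) \<le> norm w + \<bar>t\<bar> * norm c" using norm_triangle_ineq[of w "t *\<^sub>R c"] by simp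
      also have "\<dots> \<le> L" unfolding L_def using t(1) by (intro add_left_mono mult_right_mono) auto
      finally show ?thesis using h(1) by (simp add: P_def)
    qed
    have "0 < \<nu> \<bullet> (P t - s)"
      using num h(1) wn by (smt (verit) half_gt_zero inner_gt_zero_iff mult_pos_pos)
    then have nz: "0 < norm (P t - s)" by force
    have "\<kappa> \<le> (\<nu> \<bullet> (P t - s)) / norm (P t - s)"
    proof -
      have "\<kappa> * norm (P t - s) \<le> \<kappa> * (h * L)" using den kap by (intro mult_left_mono) auto
      also have "\<dots> = h * ((w \<bullet> w) / 2)" using L by (simp add: \<kappa>_def)
      finally show ?thesis using num nz by (simp add: le_divide_eq)
    qed
    moreover have "\<bar>(\<nu> \<bullet> (P t - s)) / norm (P t - s)\<bar> < \<kappa>"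
      by (rule del(2)[OF t(2)]) (use nz den h(3) in \<open>auto simp: dist_norm\<close>)
    ultimately show False by linarith
  qed
  then have nu: "\<nu> = (\<nu> \<bullet> \<nu>0) *\<^sub>R \<nu>0" by (simp add: w_def)
  with \<nu>(1) have ne: "\<nu> \<bullet> \<nu>0 \<noteq> 0" by auto
  have eq: "\<nu> \<bullet> z = (\<nu> \<bullet> \<nu>0) * (\<nu>0 \<bullet> z)" for z
    using arg_cong[OF nu, of "\<lambda>x. x \<bullet> z"] by (simp only: inner_scaleR_left)
  show "H = {q. \<nu>0 \<bullet> (q - s) = 0}"
    unfolding \<nu>(2) by (intro Collect_cong, subst eq) (simp add: ne)
qed

text \<open>In the expansion of the squared norm of \<open>a - z\<close> the mixed term has the
  favourable sign. So the nearest point projection is constant on \<open>s\<close> plus its normal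
  cone.\<close>

lemma closest_point_normal_cone:
  assumes s: "s \<in> K" and a: "\<And>y. y \<in> K \<Longrightarrow> (a - s) \<bullet> (y - s) \<le> 0"
  shows "closest_point K a = s"
proof -
  have "dist a s \<le> dist a z" if "z \<in> K" for z
  proof -
    have "(norm (a - z))\<^sup>2 = (norm (a - s))\<^sup>2 + (norm (z - s))\<^sup>2 - 2 * ((a - s) \<bullet> (z - s))"
      by (simp add: power2_norm_eq_inner inner_diff_left inner_diff_right inner_commute)
    then have "(norm (a - s))\<^sup>2 \<le> (norm (a - z))\<^sup>2" using a[OF that] zero_le_power2[of "norm (z - s)"] by linarith
    then show ?thesis by (simp add: dist_norm)
  qed
  then show ?thesis using closest_point_unique[OF convex_K closed_K s] by auto
qed

end

section \<open>Isometric parametrizations of hyperplanes, and singular boundary points\<close>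

lemma isometry_affine:
  fixes \<phi> :: "'a::euclidean_space \<Rightarrow> 'b::euclidean_space"
  assumes iso: "\<And>u v. dist (\<phi> u) (\<phi> v) = dist u v"
  shows "linear (\<lambda>u. \<phi> u - \<phi> 0)" "norm (\<phi> u - \<phi> 0) = norm u"
proof -
  define h where "h u = \<phi> u - \<phi> 0" for u
  have n: "norm (h u) = norm u" for u using iso[of u 0] by (simp add: dist_norm h_def)
  then show "norm (\<phi> u - \<phi> 0) = norm u" by (simp add: h_def)
  have d: "norm (h u - h v) = norm (u - v)" for u v using iso[of u v] by (simp add: dist_norm h_def)
  \<comment> \<open>Polarization: norms and distances determine inner products, and linearity then
    follows by expanding squares.\<close>
  have ip: "h u \<bullet> h v = u \<bullet> v" for u v
    using dot_norm_neg[of "h u" "h v"] dot_norm_neg[of u v] n d by simp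
  have "linear h"
  proof (rule linearI)
    fix x y and c :: real
    have "(h (x + y) - h x - h y) \<bullet> (h (x + y) - h x - h y) = 0"
      by (simp only: inner_diff_left inner_diff_right ip) (simp add: inner_add_left inner_add_right inner_commute)
    then have "h (x + y) - h x - h y = 0" by (simp only: inner_eq_zero_iff)
    then show "h (x + y) = h x + h y" by (simp add: algebra_simps)
    have "(h (c *\<^sub>R x) - c *\<^sub>R h x) \<bullet> (h (c *\<^sub>R x) - c *\<^sub>R h x) = 0"
      by (simp only: inner_diff_left inner_diff_right inner_scaleR_left inner_scaleR_right ip) (simp add: algebra_simps)
    then have "h (c *\<^sub>R x) - c *\<^sub>R h x = 0" by (simp only: inner_eq_zero_iff)
    then show "h (c *\<^sub>R x) = c *\<^sub>R h x" by simp
  qed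
  then show "linear (\<lambda>u. \<phi> u - \<phi> 0)" unfolding h_def .
qed

text \<open>Ensures that the choice operator in \<open>slice_density\<close> picks an actual
  parametrization.\<close>

lemma hyperplane_isometry:
  fixes \<nu> :: "real^'n"
  assumes "CARD('n) = CARD('m) + 1" "\<nu> \<noteq> 0"
  shows "\<exists>\<phi> :: real^'m \<Rightarrow> real^'n. (\<forall>u v. dist (\<phi> u) (\<phi> v) = dist u v) \<and> range \<phi> = {q. \<nu> \<bullet> (q - p) = 0}"
proof -
  have "dim (UNIV :: (real^'m) set) = dim {h. \<nu> \<bullet> h = 0}"
    using dim_hyperplane[OF assms(2)] assms(1) by simp
  then obtain f :: "real^'m \<Rightarrow> real^'n" where f: "linear f" "range f = {h. \<nu> \<bullet> h = 0}" "\<And>x. norm (f x) = norm x"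
    using isometry_subspaces[OF subspace_UNIV subspace_hyperplane] by (metis UNIV_I)
  have "range (\<lambda>u. p + f u) = {q. \<nu> \<bullet> (q - p) = 0}"
  proof -
    have "q \<in> range (\<lambda>u. p + f u)" if "\<nu> \<bullet> (q - p) = 0" for q
    proof -
      have "q - p \<in> range f" using f(2) that by blast
      then obtain u where "q - p = f u" by blast
      then have "q = p + f u" by (simp add: algebra_simps)
      then show ?thesis by blast
    qed
    moreover have "\<nu> \<bullet> f u = 0" for u using f(2) by blast
    ultimately show ?thesis by auto
  qed
  moreover have "dist (p + f u) (p + f v) = dist u v" for u v
    using f(3)[of "u - v"] by (simp add: dist_norm linear_diff[OF f(1)])
  ultimately show ?thesis by (intro exI[of _ "\<lambda>u. p + f u"] conjI allI)
qed

text \<open>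
  The fibres of the nearest point projection over points with several normals contain
  two-dimensional pieces. Hence these points are images of countably many rational planes of
  codimension 2, which are negligible in dimension \<open>CARD('m)\<close>.
\<close>

lemma singular_points_negligible:
  fixes K :: "(real^'n) set" and F :: "real^'n \<Rightarrow> real^'m"
  assumes "convex_body K" and dim: "CARD('n) = CARD('m) + 1"
    and lips: "\<And>w. w \<in> W \<Longrightarrow> \<exists>T B. open T \<and> w \<in> T \<and> (\<forall>y\<in>W \<inter> T. norm (F y - F w) \<le> B * norm (y - w))"
  shows "negligible (F ` {s \<in> frontier K \<inter> W. \<not> (\<exists>!\<nu>. unit_normal K s \<nu>)})"
proof -
  interpret convex_body K by fact
  have Kne: "K \<noteq> {}" using interior_K interior_subset by blast
  \<comment> \<open>\<open>i\<close> and \<open>\<rho>\<close> fix the hyperplane of points with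
    \<open>i\<close>-th coordinate \<open>\<rho>\<close>; fixing one more coordinate, of index
    \<open>l\<close>, in the parameter space gives codimension 2.\<close>
  define \<phi> where "\<phi> i \<rho> = (SOME \<phi> :: real^'m \<Rightarrow> real^'n. (\<forall>u v. dist (\<phi> u) (\<phi> v) = dist u v) \<and>
      range \<phi> = {q. axis i 1 \<bullet> (q - axis i \<rho>) = 0})" for i :: 'n and \<rho> :: real
  have phi: "(\<forall>u v. dist (\<phi> i \<rho> u) (\<phi> i \<rho> v) = dist u v) \<and> range (\<phi> i \<rho>) = {q. axis i 1 \<bullet> (q - axis i \<rho>) = 0}" for i \<rho>
  proof -
    have ne: "axis i (1::real) \<noteq> 0" by (simp add: axis_eq_0_iff)
    show ?thesis unfolding \<phi>_def by (rule someI_ex[OF hyperplane_isometry[OF dim ne]])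
  qed
  have iso: "dist (\<phi> i \<rho> u) (\<phi> i \<rho> v) = dist u v" for i \<rho> u v using phi by blast
  have ran: "z \<in> range (\<phi> i \<rho>) \<longleftrightarrow> z $ i = \<rho>" for i \<rho> z
    using phi[of i \<rho>] by (simp add: inner_axis')
  define P where "P i \<rho> x = closest_point K (\<phi> i \<rho> x)" for i \<rho> x
  define A where "A i \<rho> l \<sigma> = {x :: real^'m. x $ l = \<sigma> \<and> P i \<rho> x \<in> W}" for i \<rho> l \<sigma>
  have Plip: "dist (P i \<rho> x) (P i \<rho> y) \<le> dist x y" for i \<rho> x y
    unfolding P_def using closest_point_lipschitz[OF convex_K closed_K Kne] iso by metis
  \<comment> \<open>The parameters fill part of a hyperplane, and the nearest point projection does
    not increase distances, so its composition with \<open>F\<close> is locally Lipschitz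
    there.\<close>
  have neg: "negligible ((\<lambda>x. F (P i \<rho> x)) ` A i \<rho> l \<sigma>)" for i \<rho> l \<sigma>
  proof (rule negligible_locally_Lipschitz_image)
    have "A i \<rho> l \<sigma> \<subseteq> {x. axis l 1 \<bullet> x = \<sigma>}" by (auto simp: A_def inner_axis')
    moreover have "negligible {x :: real^'m. axis l 1 \<bullet> x = \<sigma>}"
      by (rule negligible_hyperplane) (simp add: axis_eq_0_iff)
    ultimately show "negligible (A i \<rho> l \<sigma>)" by (rule negligible_subset[rotated])
    fix x assume x: "x \<in> A i \<rho> l \<sigma>"
    then obtain T B where TB: "open T" "P i \<rho> x \<in> T"
      "\<And>y. y \<in> W \<inter> T \<Longrightarrow> norm (F y - F (P i \<rho> x)) \<le> B * norm (y - P i \<rho> x)"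
      using lips[of "P i \<rho> x"] by (auto simp: A_def)
    obtain e where e: "e > 0" "ball (P i \<rho> x) e \<subseteq> T" using TB(1,2) open_contains_ball by blast
    have "norm (F (P i \<rho> y) - F (P i \<rho> x)) \<le> \<bar>B\<bar> * norm (y - x)" if y: "y \<in> A i \<rho> l \<sigma> \<inter> ball x e" for y
    proof -
      have "P i \<rho> y \<in> W \<inter> T" using y Plip[of i \<rho> x y] e by (auto simp: A_def intro!: subsetD[OF e(2)])
      then have "norm (F (P i \<rho> y) - F (P i \<rho> x)) \<le> B * norm (P i \<rho> y - P i \<rho> x)" by (rule TB(3))
      also have "\<dots> \<le> \<bar>B\<bar> * norm (y - x)"
        using Plip[of i \<rho> y x] by (intro mult_mono) (auto simp: dist_norm)
      finally show ?thesis .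
    qed
    then show "\<exists>T B. open T \<and> x \<in> T \<and> (\<forall>y\<in>A i \<rho> l \<sigma> \<inter> T. norm (F (P i \<rho> y) - F (P i \<rho> x)) \<le> B * norm (y - x))"
      using e(1) by (intro exI[of _ "ball x e"] exI[of _ "\<bar>B\<bar>"]) auto
  qed simp
  let ?I = "(UNIV :: 'n set) \<times> \<rat> \<times> (UNIV :: 'm set) \<times> \<rat>"
  let ?N = "\<Union>(i, \<rho>, l, \<sigma>)\<in>?I. (\<lambda>x. F (P i \<rho> x)) ` A i \<rho> l \<sigma>"
  have cnt: "countable ?I" by (intro countable_SIGMA countable_rat) (auto intro: countable_finite)
  have "negligible ?N"
    by (rule negligible_countable_Union) (use neg cnt in auto)
  moreover have "F ` {s \<in> frontier K \<inter> W. \<not> (\<exists>!\<nu>. unit_normal K s \<nu>)} \<subseteq> ?N"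
  proof (rule image_subsetI)
    fix s assume "s \<in> {s \<in> frontier K \<inter> W. \<not> (\<exists>!\<nu>. unit_normal K s \<nu>)}"
    then have s: "s \<in> frontier K" "s \<in> W" and nu: "\<not> (\<exists>!\<nu>. unit_normal K s \<nu>)" by auto
    obtain \<nu>1 where n1: "unit_normal K s \<nu>1" using unit_normal_exists[OF s(1)] by blast
    with nu obtain \<nu>2 where n2: "unit_normal K s \<nu>2" "\<nu>2 \<noteq> \<nu>1" by blast
    have norms: "norm \<nu>1 = 1" "norm \<nu>2 = 1" using n1 n2 by (auto simp: unit_normal_def)
    \<comment> \<open>Opposite normals are impossible because \<open>K\<close> has interior
      points.\<close>
    have indep: "\<nu>2 \<noteq> t *\<^sub>R \<nu>1" for t
    proof
      assume eq: "\<nu>2 = t *\<^sub>R \<nu>1"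
      then have "\<bar>t\<bar> = 1" using norms by simp
      then consider "t = 1" | "t = - 1" by linarith
      then show False
      proof cases
        case 1 then show ?thesis using eq n2(2) by simp
      next
        case 2
        obtain y where y: "y \<in> interior K" using interior_K by blast
        show ?thesis using unit_normal_interior[OF n1 y] unit_normal_interior[OF n2(1) y] eq 2 by simp
      qed
    qed
    have "\<nu>1 \<noteq> 0" using norms by auto
    then obtain i where i: "\<nu>1 $ i \<noteq> 0" by (auto simp: vec_eq_iff)
    define c where "c = s $ i + \<nu>2 $ i"
    define t where "t = \<nu>2 $ i / \<nu>1 $ i"
    have "min c (c + \<nu>1 $ i) < max c (c + \<nu>1 $ i)" using i by (auto simp: min_def max_def)
    then obtain \<rho> where rho: "\<rho> \<in> \<rat>" "min c (c + \<nu>1 $ i) < \<rho>" "\<rho> < max c (c + \<nu>1 $ i)"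
      using Rats_dense_in_real by blast
    define a where "a = (\<rho> - c) / \<nu>1 $ i"
    have a: "0 < a" using rho i by (auto simp: a_def min_def max_def divide_neg_neg split: if_splits)
    define h where "h = a / (2 * (\<bar>t\<bar> + 1))"
    have h: "0 < h" "h * \<bar>t\<bar> < a"
    proof -
      show "0 < h" using a by (simp add: h_def)
      then have "h * \<bar>t\<bar> < h * (2 * (\<bar>t\<bar> + 1))" by (intro mult_strict_left_mono) auto
      also have "\<dots> = a" by (simp add: h_def field_simps)
      finally show "h * \<bar>t\<bar> < a" .
    qed
    \<comment> \<open>A segment in \<open>s\<close> plus the normal cone with constant
      \<open>i\<close>-th coordinate: it starts at \<open>s + a *\<^sub>R \<nu>1 + \<nu>2\<close>,
      where that coordinate is the rational \<open>\<rho>\<close>, and runs along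
      \<open>\<nu>2 - t *\<^sub>R \<nu>1\<close>. The bound on \<open>h\<close> keeps the
      coefficient of \<open>\<nu>1\<close> nonnegative.\<close>
    define z where "z \<theta> = s + (a - \<theta> * (h * t)) *\<^sub>R \<nu>1 + (1 + \<theta> * h) *\<^sub>R \<nu>2" for \<theta>
    have zi: "z \<theta> $ i = \<rho>" for \<theta>
    proof -
      have 1: "t * \<nu>1 $ i = \<nu>2 $ i" "a * \<nu>1 $ i = \<rho> - c" using i by (auto simp: t_def a_def)
      have "z \<theta> $ i = c + a * \<nu>1 $ i + \<theta> * h * (\<nu>2 $ i - t * \<nu>1 $ i)"
        by (simp add: z_def c_def algebra_simps)
      then show ?thesis by (simp add: 1)
    qed
    have cp: "closest_point K (z \<theta>) = s" if th: "0 \<le> \<theta>" "\<theta> \<le> 1" for \<theta>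
    proof (rule closest_point_normal_cone[OF frontier_mem[OF s(1)]])
      fix y assume y: "y \<in> K"
      have "\<theta> * (h * t) \<le> \<theta> * (h * \<bar>t\<bar>)" using th h(1) by (intro mult_left_mono) auto
      moreover have "\<theta> * (h * \<bar>t\<bar>) \<le> 1 * (h * \<bar>t\<bar>)" using th h(1) by (intro mult_right_mono) auto
      ultimately have "\<theta> * (h * t) \<le> h * \<bar>t\<bar>" by linarith
      then have "0 \<le> a - \<theta> * (h * t)" using h(2) by linarith
      moreover have "0 \<le> 1 + \<theta> * h" using th h(1) by simp
      ultimately have "(a - \<theta> * (h * t)) * (\<nu>1 \<bullet> (y - s)) \<le> 0" "(1 + \<theta> * h) * (\<nu>2 \<bullet> (y - s)) \<le> 0"
        using n1 n2(1) y by (auto simp: unit_normal_def mult_nonneg_nonpos)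
      then show "(z \<theta> - s) \<bullet> (y - s) \<le> 0" by (simp add: z_def inner_add_left)
    qed
    have ne: "z 0 \<noteq> z 1"
    proof
      assume "z 0 = z 1"
      then have "h *\<^sub>R (\<nu>2 - t *\<^sub>R \<nu>1) = 0" by (simp add: z_def algebra_simps)
      then show False using h(1) indep[of t] by simp
    qed
    obtain x0 x1 where x: "\<phi> i \<rho> x0 = z 0" "\<phi> i \<rho> x1 = z 1" using ran zi by (metis imageE)
    have "x0 \<noteq> x1" using ne x by auto
    \<comment> \<open>Some coordinate of the parameter changes along the segment and therefore takes
      a rational value on it.\<close>
    then obtain l where l: "x0 $ l \<noteq> x1 $ l" by (auto simp: vec_eq_iff)
    have "min (x0 $ l) (x1 $ l) < max (x0 $ l) (x1 $ l)" using l by (auto simp: min_def max_def)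
    then obtain \<sigma> where sig: "\<sigma> \<in> \<rat>" "min (x0 $ l) (x1 $ l) < \<sigma>" "\<sigma> < max (x0 $ l) (x1 $ l)"
      using Rats_dense_in_real by blast
    define \<theta> where "\<theta> = (\<sigma> - x0 $ l) / (x1 $ l - x0 $ l)"
    have th: "0 \<le> \<theta>" "\<theta> \<le> 1"
      using sig l by (auto simp: \<theta>_def min_def max_def divide_le_eq divide_nonpos_neg zero_le_divide_iff split: if_splits)
    define x where "x = x0 + \<theta> *\<^sub>R (x1 - x0)"
    have xl: "x $ l = \<sigma>" using l by (simp add: x_def \<theta>_def)
    have "\<phi> i \<rho> x = z \<theta>"
    proof -
      let ?h = "\<lambda>u. \<phi> i \<rho> u - \<phi> i \<rho> 0"
      have lin: "linear ?h" by (rule isometry_affine(1)[OF iso])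
      have "?h x = ?h x0 + \<theta> *\<^sub>R (?h x1 - ?h x0)"
        unfolding x_def by (simp only: linear_add[OF lin] linear_scale[OF lin] linear_diff[OF lin])
      then have "\<phi> i \<rho> x = z 0 + \<theta> *\<^sub>R (z 1 - z 0)" by (simp add: \<open>\<phi> i \<rho> x0 = z 0\<close> \<open>\<phi> i \<rho> x1 = z 1\<close> algebra_simps)
      also have "\<dots> = z \<theta>" by (simp add: z_def algebra_simps)
      finally show ?thesis .
    qed
    then have "P i \<rho> x = s" using cp[OF th] by (simp add: P_def)
    then have "x \<in> A i \<rho> l \<sigma>" using xl s(2) by (simp add: A_def)
    then have "F s \<in> (\<lambda>x. F (P i \<rho> x)) ` A i \<rho> l \<sigma>" using \<open>P i \<rho> x = s\<close> by (metis (mono_tags, lifting) imageI)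
    then show "F s \<in> ?N" using rho(1) sig(1) by blast
  qed
  ultimately show ?thesis by (rule negligible_subset)
qed

section \<open>Area under projections\<close>

lemma emeasure_lborel_translation:
  fixes S :: "'a::euclidean_space set"
  assumes "closed S" shows "emeasure lborel ((+) a ` S) = emeasure lborel S"
proof -
  have "emeasure lebesgue ((\<lambda>x. x + a) ` S) = emeasure lebesgue S"
    using emeasure_lebesgue_affine[of 1 a S] by (simp cong: image_cong_simp)
  moreover have "(+) a ` S = (\<lambda>x. x + a) ` S" by (intro image_cong) (auto simp: add.commute)
  moreover have "closed ((+) a ` S)" using assms by (rule closed_translation)
  ultimately show ?thesis using assms by simp
qed

lemma orthogonal_split:
  fixes Q :: "'a::euclidean_space \<Rightarrow> 'b::euclidean_space"
  assumes n: "norm \<nu> = 1" and Q: "\<And>h. \<nu> \<bullet> h = 0 \<Longrightarrow> h \<in> range Q" and iso: "\<And>h. norm (Q h) = norm h"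
  obtains w where "x = Q w + (\<nu> \<bullet> x) *\<^sub>R \<nu>" "norm w \<le> norm x" "norm x \<le> norm w + \<bar>\<nu> \<bullet> x\<bar>"
proof -
  have nn: "\<nu> \<bullet> \<nu> = 1" using n by (simp add: norm_eq_1)
  have "\<nu> \<bullet> (x - (\<nu> \<bullet> x) *\<^sub>R \<nu>) = 0" by (simp add: inner_diff_right nn)
  from Q[OF this] obtain w where w: "x - (\<nu> \<bullet> x) *\<^sub>R \<nu> = Q w" by blast
  then have x: "x = Q w + (\<nu> \<bullet> x) *\<^sub>R \<nu>" by (simp add: algebra_simps)
  have "Q w \<bullet> Q w = x \<bullet> x - (\<nu> \<bullet> x)\<^sup>2"
    unfolding w[symmetric] by (simp add: inner_diff_left inner_diff_right nn inner_commute power2_eq_square)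
  then have "Q w \<bullet> Q w \<le> x \<bullet> x" by simp
  then have "norm (Q w) \<le> norm x" by (simp only: norm_le)
  then have "norm w \<le> norm x" by (simp only: iso)
  moreover have "norm x \<le> norm w + \<bar>\<nu> \<bullet> x\<bar>"
    using norm_triangle_ineq[of "Q w" "(\<nu> \<bullet> x) *\<^sub>R \<nu>"] x iso n by simp
  ultimately show thesis using x that by blast
qed

text \<open>A covering set of diameter \<open>d\<close> is mapped into a translate of the image
  under \<open>B\<close> of a ball of radius \<open>2 * d\<close>, whereas the gauge charges a ball
  of radius \<open>d / 2\<close>; hence the factor \<open>4 ^ CARD('m)\<close>. The conclusion
  speaks of a Borel superset because \<open>X\<close> is arbitrary and its image may fail to be
  measurable.\<close>

lemma measurable_hull_of_image:
  fixes F :: "real^'n \<Rightarrow> real^'m" and B :: "real^'m \<Rightarrow> real^'m"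
  assumes B: "linear B" "det (matrix B) \<noteq> 0"
    and F: "\<And>p q. p \<in> X \<Longrightarrow> q \<in> X \<Longrightarrow> F p - F q \<in> B ` cball 0 (2 * norm (p - q))"
  shows "\<exists>G\<in>sets borel. F ` X \<subseteq> G \<and>
    emeasure lborel G \<le> ennreal (4 ^ CARD('m) * \<bar>det (matrix B)\<bar>) * hausdorff_outer CARD('m) X"
proof (cases "hausdorff_outer CARD('m) X = top")
  case True
  then show ?thesis using B(2)
    by (intro bexI[of _ UNIV]) (auto simp: ennreal_mult_top)
next
  case False
  let ?H = "hausdorff_outer CARD('m)"
  define c where "c = 4 ^ CARD('m) * \<bar>det (matrix B)\<bar>"
  have c: "0 < c" using B(2) by (simp add: c_def)
  have compB: "compact (B ` cball 0 r)" for r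
    by (intro compact_continuous_image linear_continuous_on linear_conv_bounded_linear[THEN iffD1] B compact_cball)
  have volB: "emeasure lborel (B ` cball 0 (2 * d)) = ennreal (c * (unit_ball_vol (real CARD('m)) * (d / 2) ^ CARD('m)))"
    if d: "d \<ge> 0" for d
  proof -
    have "emeasure lborel (B ` cball 0 (2 * d)) = ennreal \<bar>det (matrix B)\<bar> * emeasure lborel (cball (0::real^'m) (2 * d))"
      using compact_imp_closed[OF compB[of "2 * d"]] by (intro emeasure_linear_image B) auto
    also have "\<dots> = ennreal (\<bar>det (matrix B)\<bar> * (unit_ball_vol (real CARD('m)) * (2 * d) ^ CARD('m)))"
    proof -
      have "emeasure lborel (cball (0::real^'m) (2 * d)) = ennreal (unit_ball_vol (real CARD('m)) * (2 * d) ^ CARD('m))"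
        using d emeasure_cball[of "2 * d" "0::real^'m"] by simp
      moreover have "0 \<le> unit_ball_vol (real CARD('m)) * (2 * d) ^ CARD('m)" using d by simp
      ultimately show ?thesis by (simp only: ennreal_mult[OF abs_ge_zero])
    qed
    also have "\<bar>det (matrix B)\<bar> * (unit_ball_vol (real CARD('m)) * (2 * d) ^ CARD('m)) =
        c * (unit_ball_vol (real CARD('m)) * (d / 2) ^ CARD('m))"
    proof -
      have "2 * d = 4 * (d / 2)" by simp
      then have "(2 * d) ^ CARD('m) = 4 ^ CARD('m) * (d / 2) ^ CARD('m)" by (simp only: power_mult_distrib)
      then show ?thesis unfolding c_def by (simp only: mult_ac)
    qed
    finally show ?thesis .
  qed
  have ex: "\<exists>G\<in>sets borel. F ` X \<subseteq> G \<and> emeasure lborel G \<le> ennreal c * (?H X + ennreal e)" if e: "e > 0" for e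
  proof -
    have le: "hausdorff_pre CARD('m) 1 X \<le> ?H X" by (rule hausdorff_pre_le_outer) simp
    have e': "0 < ennreal e" using e by simp
    have fin: "hausdorff_pre CARD('m) 1 X < top" using le False by (simp add: le_less_trans less_top)
    obtain U where U: "fine_cover 1 X U" "(\<Sum>i. hausdorff_gauge CARD('m) (U i)) \<le> hausdorff_pre CARD('m) 1 X + ennreal e"
      by (rule fine_cover_near_inf[OF e' fin])
    have bU: "bounded (U i)" for i using U(1) by (simp add: fine_cover_def)
    define q where "q i = (SOME q. q \<in> U i \<inter> X)" for i
    have q: "q i \<in> U i \<inter> X" if "U i \<inter> X \<noteq> {}" for i
      unfolding q_def by (rule someI_ex[of "\<lambda>q. q \<in> U i \<inter> X"]) (use that in blast)
    define G where "G i = (if U i \<inter> X = {} then {} else (+) (F (q i)) ` B ` cball 0 (2 * diameter (U i)))" for i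
    have clG: "closed (G i)" for i
      by (cases "U i \<inter> X = {}") (simp_all add: G_def closed_translation compact_imp_closed compB)
    have volG: "emeasure lborel (G i) \<le> ennreal c * hausdorff_gauge CARD('m) (U i)" for i
    proof (cases "U i \<inter> X = {}")
      case False
      then have "U i \<noteq> {}" by auto
      have d: "0 \<le> diameter (U i)" by (rule diameter_ge_0[OF bU])
      have "emeasure lborel (G i) = emeasure lborel (B ` cball 0 (2 * diameter (U i)))"
        using False by (simp add: G_def emeasure_lborel_translation compact_imp_closed compB)
      also have "\<dots> = ennreal c * hausdorff_gauge CARD('m) (U i)"
        using \<open>U i \<noteq> {}\<close> c d unfolding volB[OF d] hausdorff_gauge_def by (simp add: ennreal_mult)
      finally show ?thesis by simp
    qed (simp add: G_def)
    have "F ` X \<subseteq> (\<Union>i. G i)"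
    proof (rule image_subsetI)
      fix p assume p: "p \<in> X"
      then obtain i where i: "p \<in> U i" using U(1) by (auto simp: fine_cover_def)
      then have ne: "U i \<inter> X \<noteq> {}" using p by blast
      have qi: "q i \<in> U i" "q i \<in> X" using q[OF ne] by auto
      have "norm (p - q i) \<le> diameter (U i)" using diameter_bounded_bound[OF bU i qi(1)] by (simp add: dist_norm)
      then have "F p - F (q i) \<in> B ` cball 0 (2 * diameter (U i))"
        using F[OF p qi(2)] by (auto intro: order_trans)
      then have "F p \<in> (+) (F (q i)) ` B ` cball 0 (2 * diameter (U i))"
        by (rule image_eqI[rotated]) simp
      then show "F p \<in> (\<Union>i. G i)" using ne by (auto simp: G_def)
    qed
    moreover have "(\<Union>i. G i) \<in> sets borel" using clG by (intro sets.countable_UN) auto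
    moreover have "emeasure lborel (\<Union>i. G i) \<le> ennreal c * (?H X + ennreal e)"
    proof -
      have "emeasure lborel (\<Union>i. G i) \<le> (\<Sum>i. emeasure lborel (G i))"
        using clG by (intro emeasure_subadditive_countably) auto
      also have "\<dots> \<le> (\<Sum>i. ennreal c * hausdorff_gauge CARD('m) (U i))"
        by (intro suminf_le volG) auto
      also have "\<dots> = ennreal c * (\<Sum>i. hausdorff_gauge CARD('m) (U i))" by simp
      also have "\<dots> \<le> ennreal c * (?H X + ennreal e)"
        by (intro mult_left_mono order_trans[OF U(2)] add_right_mono le) simp
      finally show ?thesis .
    qed
    ultimately show ?thesis by blast
  qed
  have "\<exists>G\<in>sets borel. F ` X \<subseteq> G \<and> emeasure lborel G \<le> ennreal c * (?H X + ennreal (1 / real (Suc n)))" for n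
    by (rule ex) simp
  then obtain G where G: "\<And>n. G n \<in> sets borel" "\<And>n. F ` X \<subseteq> G n"
    "\<And>n. emeasure lborel (G n) \<le> ennreal c * (?H X + ennreal (1 / real (Suc n)))" by metis
  \<comment> \<open>The errors tend to 0 with \<open>n\<close>, so the intersection is one Borel set
    that serves for all of them.\<close>
  have "emeasure lborel (\<Inter>n. G n) \<le> ennreal c * ?H X"
  proof (rule ennreal_le_epsilon)
    fix e :: real assume e: "0 < e"
    obtain n where n: "c / e < real (Suc n)" using reals_Archimedean2[of "c / e"] by (metis less_trans lessI of_nat_less_iff)
    have "emeasure lborel (\<Inter>n. G n) \<le> emeasure lborel (G n)" using G(1) by (intro emeasure_mono) auto
    also have "\<dots> \<le> ennreal c * ?H X + ennreal c * ennreal (1 / real (Suc n))" using G(3)[of n] by (simp add: distrib_left)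
    also have "ennreal c * ennreal (1 / real (Suc n)) \<le> ennreal e"
      using c e n by (simp add: ennreal_mult[symmetric] field_simps)
    finally show "emeasure lborel (\<Inter>n. G n) \<le> ennreal c * ?H X + ennreal e" by (simp add: add_left_mono)
  qed
  moreover have "(\<Inter>n. G n) \<in> sets borel" using G(1) by (intro sets.countable_INT) auto
  ultimately show ?thesis using G(2) unfolding c_def by (intro bexI[of _ "\<Inter>n. G n"]) auto
qed

text \<open>\<open>B = A \<circ> Q\<close> is the derivative of \<open>F\<close> along the tangent
  plane. The deviations from flatness and from linearity are made smaller than the lower bound
  \<open>M\<close> of \<open>B\<close>, so they can be absorbed into the argument of
  \<open>B\<close>, whose length is at most doubled by this.\<close>

lemma local_area_inequality:
  fixes F :: "real^'n \<Rightarrow> real^'m" and Q :: "real^'m \<Rightarrow> real^'n" and A :: "real^'n \<Rightarrow> real^'m"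
  assumes n1: "norm \<nu> = 1" and linQ: "linear Q" and iso: "\<And>h. norm (Q h) = norm h"
    and ran: "\<And>h. \<nu> \<bullet> h = 0 \<Longrightarrow> h \<in> range Q" and linA: "linear A" and det: "det (matrix (A \<circ> Q)) \<noteq> 0"
    and flat: "\<And>e. e > 0 \<Longrightarrow> \<exists>\<delta>>0. \<forall>p\<in>S \<inter> ball s \<delta>. \<forall>q\<in>S \<inter> ball s \<delta>. \<bar>\<nu> \<bullet> (p - q)\<bar> \<le> e * norm (p - q)"
    and strict: "\<And>e. e > 0 \<Longrightarrow> \<exists>\<delta>>0. \<forall>p\<in>S \<inter> ball s \<delta>. \<forall>q\<in>S \<inter> ball s \<delta>.
        norm (F p - F q - A (p - q)) \<le> e * norm (p - q)"
  shows "\<exists>\<delta>>0. \<forall>X\<subseteq>S \<inter> ball s \<delta>. \<exists>G\<in>sets borel. F ` X \<subseteq> G \<and>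
    emeasure lborel G \<le> ennreal (4 ^ CARD('m) * \<bar>det (matrix (A \<circ> Q))\<bar>) * hausdorff_outer CARD('m) X"
proof -
  define B where "B = A \<circ> Q"
  have linB: "linear B" unfolding B_def by (rule linear_compose[OF linQ linA])
  have injB: "inj B" using det det_nz_iff_inj[OF linB] by (simp add: B_def)
  have surjB: "surj B" using linear_injective_imp_surjective linB injB by blast
  obtain M where M: "M > 0" "\<And>x. M * norm x \<le> norm (B x)"
    using linear_inj_bounded_below_pos[OF linB injB] by blast
  obtain KA where KA: "KA > 0" "\<And>x. norm (A x) \<le> KA * norm x"
    using linear_bounded_pos[OF linA] by blast
  \<comment> \<open>The two errors, \<open>e * KA\<close> from the normal component and
    \<open>e\<close> from the remainder, then add up to \<open>M\<close>.\<close>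
  define e where "e = M / (KA + 1)"
  have e: "e > 0" "e * (KA + 1) = M" using M KA by (auto simp: e_def)
  obtain d1 where d1: "d1 > 0" "\<And>p q. p \<in> S \<inter> ball s d1 \<Longrightarrow> q \<in> S \<inter> ball s d1 \<Longrightarrow> \<bar>\<nu> \<bullet> (p - q)\<bar> \<le> e * norm (p - q)"
    using flat[OF e(1)] by blast
  obtain d2 where d2: "d2 > 0" "\<And>p q. p \<in> S \<inter> ball s d2 \<Longrightarrow> q \<in> S \<inter> ball s d2 \<Longrightarrow>
      norm (F p - F q - A (p - q)) \<le> e * norm (p - q)"
    using strict[OF e(1)] by blast
  define d where "d = min d1 d2"
  have key: "F p - F q \<in> B ` cball 0 (2 * norm (p - q))" if p: "p \<in> S \<inter> ball s d" and q: "q \<in> S \<inter> ball s d" for p q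
  proof -
    have p12: "p \<in> S \<inter> ball s d1" "q \<in> S \<inter> ball s d1" "p \<in> S \<inter> ball s d2" "q \<in> S \<inter> ball s d2"
      using p q by (auto simp: d_def)
    let ?t = "\<nu> \<bullet> (p - q)"
    obtain w where w: "p - q = Q w + ?t *\<^sub>R \<nu>" "norm w \<le> norm (p - q)"
      using orthogonal_split[OF n1 ran iso, of "p - q"] by blast
    define r where "r = ?t *\<^sub>R A \<nu> + (F p - F q - A (p - q))"
    obtain v where v: "B v = r" using surjB by (metis surjD)
    have "A (p - q) = B w + ?t *\<^sub>R A \<nu>"
      using arg_cong[OF w(1), of A] by (simp add: linear_add[OF linA] linear_scale[OF linA] B_def)
    then have "F p - F q = B w + r" by (simp add: r_def)
    then have eq: "F p - F q = B (w + v)" by (simp add: v linear_add[OF linB])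
    have "norm r \<le> \<bar>?t\<bar> * norm (A \<nu>) + norm (F p - F q - A (p - q))"
      unfolding r_def by (rule order_trans[OF norm_triangle_ineq]) simp
    also have "\<dots> \<le> (e * norm (p - q)) * KA + e * norm (p - q)"
      using d1(2)[OF p12(1,2)] d2(2)[OF p12(3,4)] KA(2)[of \<nu>] n1 e(1) by (intro add_mono mult_mono) auto
    also have "\<dots> = M * norm (p - q)" using e(2) by (simp add: algebra_simps flip: e(2))
    finally have "M * norm v \<le> M * norm (p - q)" using M(2)[of v] v by simp
    then have "norm v \<le> norm (p - q)" using M(1) by simp
    then have "norm (w + v) \<le> 2 * norm (p - q)" using norm_triangle_ineq[of w v] w(2) by linarith
    then show ?thesis unfolding eq by (intro imageI) simp
  qed
  have "\<exists>G\<in>sets borel. F ` X \<subseteq> G \<and>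
    emeasure lborel G \<le> ennreal (4 ^ CARD('m) * \<bar>det (matrix B)\<bar>) * hausdorff_outer CARD('m) X"
    if X: "X \<subseteq> S \<inter> ball s d" for X
  proof (rule measurable_hull_of_image[OF linB])
    show "det (matrix B) \<noteq> 0" using det by (simp add: B_def)
    fix p q assume "p \<in> X" "q \<in> X"
    then show "F p - F q \<in> B ` cball 0 (2 * norm (p - q))" using X by (intro key) auto
  qed
  then show ?thesis using d1(1) d2(1) unfolding B_def by (intro exI[of _ d]) (auto simp: d_def)
qed

text \<open>The image of the unit ball contains the ball of radius 1/2; compare volumes.\<close>

lemma det_ge_of_expanding:
  fixes C :: "real^'m \<Rightarrow> real^'m"
  assumes C: "linear C" and exp: "\<And>h. norm h \<le> 2 * norm (C h)"
  shows "1 \<le> 2 ^ CARD('m) * \<bar>det (matrix C)\<bar>"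
proof -
  have "inj C"
    unfolding linear_injective_0[OF C]
  proof (intro allI impI)
    fix a assume "C a = 0" with exp[of a] show "a = 0" by simp
  qed
  then have surj: "surj C" using linear_injective_imp_surjective C by blast
  have sub: "cball 0 (1 / 2) \<subseteq> C ` cball (0 :: real^'m) 1"
  proof
    fix y :: "real^'m" assume y: "y \<in> cball 0 (1 / 2)"
    obtain x where x: "C x = y" using surj by (metis surjD)
    then show "y \<in> C ` cball 0 1" using exp[of x] y by (intro image_eqI[of _ _ x]) auto
  qed
  have cl: "closed (C ` cball (0 :: real^'m) 1)"
    by (intro compact_imp_closed compact_continuous_image linear_continuous_on linear_conv_bounded_linear[THEN iffD1] C compact_cball)
  let ?v = "unit_ball_vol (real CARD('m))"
  have v: "0 < ?v" by simp
  have "ennreal (?v * (1 / 2) ^ CARD('m)) = emeasure lborel (cball (0 :: real^'m) (1 / 2))"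
    using emeasure_cball[of "1/2" "0 :: real^'m"] by simp
  also have "\<dots> \<le> emeasure lborel (C ` cball (0 :: real^'m) 1)"
    using sub cl by (intro emeasure_mono) auto
  also have "\<dots> = ennreal \<bar>det (matrix C)\<bar> * emeasure lborel (cball (0 :: real^'m) 1)"
    using cl by (intro emeasure_linear_image C) auto
  also have "\<dots> = ennreal (\<bar>det (matrix C)\<bar> * ?v)"
    using emeasure_cball[of 1 "0 :: real^'m"] v by (simp add: ennreal_mult)
  finally have "?v * (1 / 2) ^ CARD('m) \<le> \<bar>det (matrix C)\<bar> * ?v"
    using v by (simp add: ennreal_le_iff)
  then have "?v * (1 / 2) ^ CARD('m) \<le> ?v * \<bar>det (matrix C)\<bar>" by (simp only: mult.commute)
  then have "(1 / 2) ^ CARD('m) \<le> \<bar>det (matrix C)\<bar>" using v by (rule mult_left_le_imp_le)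
  then show ?thesis by (simp add: power_divide divide_le_eq mult.commute)
qed

text \<open>The isometries \<open>Q\<close> and \<open>Q'\<close> onto two nearby tangent planes
  come from independent choices and may be far from each other. So closeness is asked of the planes
  only, and \<open>A' \<circ> Q'\<close> is factored through \<open>A \<circ> Q\<close>: the other
  factor \<open>C\<close> shortens no vector to less than half its length.\<close>

lemma jacobian_lower_semicontinuous:
  fixes Q :: "real^'m \<Rightarrow> real^'n" and A :: "real^'n \<Rightarrow> real^'m"
  assumes n1: "norm \<nu> = 1" and linQ: "linear Q" and iso: "\<And>h. norm (Q h) = norm h"
    and ran: "\<And>h. \<nu> \<bullet> h = 0 \<Longrightarrow> h \<in> range Q" and linA: "linear A" and det: "det (matrix (A \<circ> Q)) \<noteq> 0"
  shows "\<exists>e>0. \<forall>A' Q'. linear A' \<longrightarrow> linear Q' \<longrightarrow> (\<forall>h. norm (Q' h) = norm h) \<longrightarrow>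
     (\<forall>h. \<bar>\<nu> \<bullet> Q' h\<bar> \<le> e * norm h) \<longrightarrow> (\<forall>h. norm (A' h - A h) \<le> e * norm h) \<longrightarrow>
     \<bar>det (matrix (A \<circ> Q))\<bar> \<le> 2 ^ CARD('m) * \<bar>det (matrix (A' \<circ> Q'))\<bar>"
proof -
  define B where "B = A \<circ> Q"
  have linB: "linear B" unfolding B_def by (rule linear_compose[OF linQ linA])
  have injB: "inj B" using det det_nz_iff_inj[OF linB] by (simp add: B_def)
  have surjB: "surj B" using linear_injective_imp_surjective linB injB by blast
  obtain g where g: "linear g" "g \<circ> B = id" using linear_injective_left_inverse[OF linB injB] by blast
  have gB: "g (B x) = x" for x using g(2) by (metis comp_apply id_apply)
  have Bg: "B (g y) = y" for y using gB surjB by (metis surjD)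
  obtain M where M: "M > 0" "\<And>x. norm (g x) \<le> M * norm x" using linear_bounded_pos[OF g(1)] by blast
  obtain KA where KA: "KA > 0" "\<And>x. norm (A x) \<le> KA * norm x" using linear_bounded_pos[OF linA] by blast
  \<comment> \<open>Makes the total relative error, after applying the inverse \<open>g\<close> of
    \<open>B\<close>, at most one half.\<close>
  define e where "e = 1 / (2 * (1 + M * (KA + 1)))"
  have den: "0 < 1 + M * (KA + 1)" using M KA by (simp add: add_pos_pos)
  have e: "e > 0" "e * (1 + M * (KA + 1)) = 1 / 2" using den by (auto simp: e_def)
  have "\<bar>det (matrix B)\<bar> \<le> 2 ^ CARD('m) * \<bar>det (matrix (A' \<circ> Q'))\<bar>"
    if A': "linear A'" and Q': "linear Q'" "\<And>h. norm (Q' h) = norm h" "\<And>h. \<bar>\<nu> \<bullet> Q' h\<bar> \<le> e * norm h"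
      and close: "\<And>h. norm (A' h - A h) \<le> e * norm h" for A' :: "real^'n \<Rightarrow> real^'m" and Q' :: "real^'m \<Rightarrow> real^'n"
  proof -
    define C where "C = g \<circ> (A' \<circ> Q')"
    have linC: "linear C" unfolding C_def by (intro linear_compose A' Q' g)
    have BC: "A' \<circ> Q' = B \<circ> C" by (rule ext) (simp add: C_def Bg)
    have exp: "norm h \<le> 2 * norm (C h)" for h
    proof -
      let ?t = "\<nu> \<bullet> Q' h"
      obtain w where w: "Q' h = Q w + ?t *\<^sub>R \<nu>" "norm (Q' h) \<le> norm w + \<bar>?t\<bar>"
        using orthogonal_split[OF n1 ran iso, of "Q' h"] by blast
      define r where "r = ?t *\<^sub>R A \<nu> + (A' (Q' h) - A (Q' h))"
      have "A (Q' h) = B w + ?t *\<^sub>R A \<nu>"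
        using arg_cong[OF w(1), of A] by (simp add: linear_add[OF linA] linear_scale[OF linA] B_def)
      then have "A' (Q' h) = B w + r" by (simp add: r_def)
      then have Ch: "C h = w + g r" by (simp add: C_def linear_add[OF g(1)] gB)
      have "norm r \<le> \<bar>?t\<bar> * norm (A \<nu>) + norm (A' (Q' h) - A (Q' h))"
        unfolding r_def by (rule order_trans[OF norm_triangle_ineq]) simp
      also have "\<dots> \<le> (e * norm h) * KA + e * norm h"
        using Q'(3)[of h] close[of "Q' h"] Q'(2) KA(2)[of \<nu>] n1 e(1) by (intro add_mono mult_mono) auto
      finally have r: "norm r \<le> e * norm h * (KA + 1)" by (simp add: algebra_simps)
      have "norm (g r) \<le> M * (e * norm h * (KA + 1))"
        using M(1) r by (intro order_trans[OF M(2)] mult_left_mono) auto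
      moreover have "norm w \<le> norm (C h) + norm (g r)"
        using norm_triangle_ineq4[of "C h" "g r"] by (simp add: Ch)
      moreover have "norm h \<le> norm w + e * norm h" using w(2) Q'(2,3)[of h] by simp
      ultimately have "norm h \<le> norm (C h) + M * (e * norm h * (KA + 1)) + e * norm h" by linarith
      also have "\<dots> = norm (C h) + (e * (1 + M * (KA + 1))) * norm h" by (simp add: algebra_simps)
      finally show ?thesis unfolding e(2) by simp
    qed
    have "matrix (A' \<circ> Q') = matrix B ** matrix C" unfolding BC by (rule matrix_compose[OF linC linB])
    then have "\<bar>det (matrix (A' \<circ> Q'))\<bar> = \<bar>det (matrix B)\<bar> * \<bar>det (matrix C)\<bar>" by (simp add: det_mul abs_mult)
    moreover have "\<bar>det (matrix B)\<bar> * 1 \<le> \<bar>det (matrix B)\<bar> * (2 ^ CARD('m) * \<bar>det (matrix C)\<bar>)"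
      by (intro mult_left_mono det_ge_of_expanding[OF linC exp]) simp
    ultimately show ?thesis by (simp add: mult_ac)
  qed
  then show ?thesis using e(1) unfolding B_def by blast
qed

section \<open>Coordinates adapted to a point of a sphere\<close>

text \<open>
  Coordinates adapted to the line through \<open>x\<close> and \<open>p\<close>: the functionals \<open>\<alpha>\<close> and \<open>\<beta>\<close> support \<open>C\<close>
  at its two ends, \<open>q\<close> is the point of the line on the hyperplane \<open>\<alpha> + \<beta> = 0\<close> (in homogeneous
  coordinates) and the \<open>\<delta> i\<close>, vanishing along the line, describe the projection from \<open>q\<close>.
\<close>

locale adapted_frame = properly_convex C for C :: "(real^'n) set" +
  fixes x p :: "real^'n" and r :: real and \<alpha> \<beta> q :: "(real^'n) \<times> real"
    and \<delta> :: "'m::finite \<Rightarrow> (real^'n) \<times> real" and \<chi>' \<tau> :: "(real^'n) \<times> real"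
  defines "\<chi>' \<equiv> (1/2) *\<^sub>R (\<alpha> + \<beta>)" and "\<tau> \<equiv> (1/2) *\<^sub>R (\<alpha> - \<beta>)"
  assumes x: "x \<in> C" and p: "p \<in> C" and dist: "hilbert_dist C x p = r" and r: "0 < r"
    and dim: "CARD('n) = CARD('m) + 1"
    and \<alpha>: "\<alpha> \<in> pos_affine C" and \<beta>: "\<beta> \<in> pos_affine C"
    and \<alpha>p: "\<alpha> \<bullet> (p, 1) = 1" and \<beta>p: "\<beta> \<bullet> (p, 1) = 1" and \<alpha>q: "\<alpha> \<bullet> q = 1" and \<beta>q: "\<beta> \<bullet> q = - 1"
    and \<beta>x: "\<beta> \<bullet> (x, 1) = exp (2 * r) * (\<alpha> \<bullet> (x, 1))"
    and x_rep: "\<exists>c>0. (x, 1) = c *\<^sub>R ((p, 1) - ((exp (2 * r) - 1) / (exp (2 * r) + 1)) *\<^sub>R q)"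
    and q_bound: "\<And>\<zeta>. \<zeta> \<in> pos_affine C \<Longrightarrow> \<bar>\<zeta> \<bullet> q\<bar> \<le> \<zeta> \<bullet> (p, 1)"
    and \<delta>p: "\<And>i. \<delta> i \<bullet> (p, 1) = 0" and \<delta>q: "\<And>i. \<delta> i \<bullet> q = 0"
    and \<delta>pos: "\<And>i. \<chi>' + \<delta> i \<in> pos_affine C"
    and frame: "\<And>\<zeta>. \<zeta> \<in> pos_affine C \<Longrightarrow> \<zeta> \<bullet> (p, 1) = 1 \<Longrightarrow>
      \<exists>c. (\<forall>i. \<bar>c i\<bar> \<le> 1) \<and> \<zeta> = \<chi>' + (\<zeta> \<bullet> q) *\<^sub>R \<tau> + 2 *\<^sub>R (\<Sum>i\<in>UNIV. c i *\<^sub>R \<delta> i)"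

context properly_convex begin

text \<open>A nonzero vector killed by all these functionals would have last coordinate 0 and be the
  direction of a line in \<open>C\<close> through \<open>p\<close>.\<close>

lemma annihilated_vector_zero:
  assumes p: "p \<in> C" and Y: "\<And>\<zeta>. \<zeta> \<in> pos_affine C \<Longrightarrow> \<zeta> \<bullet> (p, 1) = 1 \<Longrightarrow> \<zeta> \<bullet> Y = 0"
  shows "Y = 0"
proof -
  obtain v w where Yvw: "Y = (v, w)" by (cases Y)
  have w: "w = 0" using Y[OF one_pos_affine] by (simp add: Yvw)
  have "v = 0"
  proof (rule ccontr)
    assume "v \<noteq> 0"
    then obtain t where t: "p + t *\<^sub>R v \<notin> C" using no_line by blast
    have "p + t *\<^sub>R v \<in> C"
    proof (rule mem_C_if_pos)
      fix \<zeta> assume z: "\<zeta> \<in> pos_affine C"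
      have zp: "0 < \<zeta> \<bullet> (p, 1)" by (rule pos_affineD[OF z p])
      have "((1 / (\<zeta> \<bullet> (p, 1))) *\<^sub>R \<zeta>) \<bullet> Y = 0"
        by (rule Y) (use zp in \<open>auto intro!: pos_affine_scaleR[OF z]\<close>)
      then have "\<zeta> \<bullet> (v, 0) = 0" using zp by (simp add: Yvw w)
      moreover have "(p + t *\<^sub>R v, 1::real) = (p, 1) + t *\<^sub>R (v, 0)" by simp
      ultimately have "\<zeta> \<bullet> (p + t *\<^sub>R v, 1) = \<zeta> \<bullet> (p, 1)"
        by (simp only: inner_add_right inner_scaleR_right)
      then show "0 < \<zeta> \<bullet> (p + t *\<^sub>R v, 1)" using zp by simp
    qed
    with t show False by blast
  qed
  then show ?thesis using w Yvw by (simp add: zero_prod_def)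
qed

text \<open>A ball around \<open>p\<close> in \<open>C\<close> bounds the linear part of
  \<open>\<delta>\<close>, and vanishing at \<open>p\<close> then bounds its constant part.\<close>

lemma compact_transversal_polar:
  assumes p: "p \<in> C" and c: "c \<in> pos_affine C"
  shows "compact {\<delta>. \<delta> \<bullet> (p, 1) = 0 \<and> \<delta> \<bullet> q = 0 \<and> (\<forall>y\<in>C. 0 \<le> (c + \<delta>) \<bullet> (y, 1))}" (is "compact ?D")
  unfolding compact_eq_bounded_closed
proof
  have "?D = {\<delta>. \<delta> \<bullet> (p, 1) = 0} \<inter> {\<delta>. \<delta> \<bullet> q = 0} \<inter> (\<Inter>y\<in>C. {\<delta>. 0 \<le> (c + \<delta>) \<bullet> (y, 1)})" by auto
  then show "closed ?D"
    by (simp only:) (intro closed_Int closed_INT ballI closed_Collect_le closed_Collect_eq continuous_intros)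
  obtain e where e: "e > 0" "ball p e \<subseteq> C" using open_C p open_contains_ball by blast
  have cp: "0 < c \<bullet> (p, 1)" by (rule pos_affineD[OF c p])
  define K where "K = 4 * (c \<bullet> (p, 1)) / e"
  have "norm \<delta> \<le> K + K * norm p" if d: "\<delta> \<in> ?D" for \<delta>
  proof -
    obtain u k where uk: "\<delta> = (u, k)" by (cases \<delta>)
    have k: "k = - (u \<bullet> p)" using d by (simp add: uk)
    have u: "norm u \<le> K"
    proof (cases "u = 0")
      case False
      define y where "y = p - (e / (2 * norm u)) *\<^sub>R u"
      have y: "y \<in> ball p e" using False e by (simp add: y_def dist_norm)
      have dy: "dist p y = e / 2" using False e by (simp add: y_def dist_norm)
      have "u \<bullet> (y - p) = - (e / 2 * norm u)"
        using False by (simp add: y_def power2_norm_eq_inner[symmetric] power2_eq_square)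
      then have "\<delta> \<bullet> (y, 1) = - (e / 2 * norm u)" by (simp add: uk k inner_diff_right)
      moreover have "0 \<le> c \<bullet> (y, 1) + \<delta> \<bullet> (y, 1)" using d y e by (auto simp: inner_add_left)
      moreover have "c \<bullet> (y, 1) \<le> 2 * (c \<bullet> (p, 1))"
      proof -
        have h: "e / 2 / e = 1 / 2" using e(1) by simp
        have "\<bar>c \<bullet> (y, 1) - c \<bullet> (p, 1)\<bar> \<le> 1 / 2 * (c \<bullet> (p, 1))"
          using pos_affine_ball[OF e(2,1) y c] unfolding dy h .
        then show ?thesis using cp by linarith
      qed
      ultimately show ?thesis using e(1) by (simp add: K_def field_simps)
    qed (use cp e in \<open>simp add: K_def\<close>)
    have "norm \<delta> \<le> norm u + norm k" unfolding uk by (rule norm_Pair_le)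
    also have "norm k \<le> norm u * norm p" unfolding k using Cauchy_Schwarz_ineq2[of u p] by simp
    also have "norm u * norm p \<le> K * norm p" using u by (intro mult_right_mono) auto
    finally show ?thesis using u by simp
  qed
  then show "bounded ?D" unfolding bounded_iff by blast
qed

end

text \<open>\<open>\<alpha>\<close> and \<open>\<beta>\<close> attain the two exit ratios between
  \<open>x\<close> and \<open>p\<close>, and \<open>q\<close> arises by normalizing \<open>x\<close>
  and \<open>p\<close> with respect to \<open>\<alpha> + \<beta>\<close>. For the transversal
  directions, any functional with value 1 at \<open>p\<close> is corrected by multiples of
  \<open>\<chi>'\<close> and \<open>\<tau>\<close> so as to vanish along the line; half of the
  result lies in a compact set, from which a family of maximal determinant is taken.\<close>

lemma adapted_frame_exists:
  fixes C :: "(real^'n) set"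
  assumes C: "properly_open_convex C" and dim: "CARD('n) = CARD('m) + 1"
    and x: "x \<in> C" and p: "p \<in> C" and dist: "hilbert_dist C x p = r" and r: "0 < r"
  obtains \<alpha> \<beta> q and \<delta> :: "'m::finite \<Rightarrow> (real^'n) \<times> real" where "adapted_frame C x p r \<alpha> \<beta> q \<delta>"
proof -
  interpret properly_convex C by unfold_locales (rule C)
  define a where "a = 1 / exit_ratio C p x"
  define b where "b = exit_ratio C x p"
  have ge: "1 \<le> exit_ratio C p x" "1 \<le> exit_ratio C x p" using exit_ratio_ge_1 x p by auto
  have a: "0 < a" and b: "0 < b" using ge by (auto simp: a_def b_def)
  have ba: "b = exp (2 * r) * a"
    using exp_hilbert_dist[OF x p] dist ge by (simp add: a_def b_def)
  have E: "exp (2 * r) > 1" using r by simp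
  have ltba: "a < b" using mult_strict_right_mono[OF E a] by (simp add: ba)
  obtain \<alpha>0 where \<alpha>0: "\<alpha>0 \<in> pos_affine C" "\<alpha>0 \<bullet> (p, 1) = exit_ratio C p x * (\<alpha>0 \<bullet> (x, 1))"
    using exit_ratio_attain[OF p x] by blast
  obtain \<beta>0 where \<beta>0: "\<beta>0 \<in> pos_affine C" "\<beta>0 \<bullet> (x, 1) = exit_ratio C x p * (\<beta>0 \<bullet> (p, 1))"
    using exit_ratio_attain[OF x p] by blast
  define \<alpha> where "\<alpha> = (1 / (\<alpha>0 \<bullet> (p, 1))) *\<^sub>R \<alpha>0"
  define \<beta> where "\<beta> = (1 / (\<beta>0 \<bullet> (p, 1))) *\<^sub>R \<beta>0"
  have pos0: "0 < \<alpha>0 \<bullet> (p, 1)" "0 < \<beta>0 \<bullet> (p, 1)" using pos_affineD[OF \<alpha>0(1) p] pos_affineD[OF \<beta>0(1) p] by auto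
  have \<alpha>: "\<alpha> \<in> pos_affine C" "\<alpha> \<bullet> (p, 1) = 1" "\<alpha> \<bullet> (x, 1) = a"
  proof -
    show "\<alpha> \<in> pos_affine C" "\<alpha> \<bullet> (p, 1) = 1" using pos0 by (auto simp: \<alpha>_def intro!: pos_affine_scaleR[OF \<alpha>0(1)])
    have "\<alpha>0 \<bullet> (x, 1) = a * (\<alpha>0 \<bullet> (p, 1))" using \<alpha>0(2) ge(1) by (simp add: a_def)
    then show "\<alpha> \<bullet> (x, 1) = a" using pos0(1) by (simp add: \<alpha>_def)
  qed
  have \<beta>: "\<beta> \<in> pos_affine C" "\<beta> \<bullet> (p, 1) = 1" "\<beta> \<bullet> (x, 1) = b"
  proof -
    show "\<beta> \<in> pos_affine C" "\<beta> \<bullet> (p, 1) = 1" using pos0 by (auto simp: \<beta>_def intro!: pos_affine_scaleR[OF \<beta>0(1)])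
    show "\<beta> \<bullet> (x, 1) = b" using pos0(2) \<beta>0(2) by (simp add: \<beta>_def b_def)
  qed
  \<comment> \<open>The hyperbolic tangent of \<open>r\<close>, since
    \<open>b / a = exp (2 * r)\<close>.\<close>
  define t where "t = (b - a) / (b + a)"
  have t: "0 < t" using ltba a b by (simp add: t_def)
  have t': "t = (exp (2 * r) - 1) / (exp (2 * r) + 1)"
  proof -
    have "b - a = (exp (2 * r) - 1) * a" "b + a = (exp (2 * r) + 1) * a" by (simp_all add: ba algebra_simps)
    then show ?thesis using a by (simp add: t_def)
  qed
  have ab: "(a + b) * t = b - a" using a b by (simp add: t_def add.commute)
  \<comment> \<open>Scaled so that \<open>X\<close> and \<open>(p, 1)\<close> both have value 1
    under \<open>(\<alpha> + \<beta>) / 2\<close>; their difference then lies in its kernel, and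
    division by \<open>t\<close> gives \<open>\<alpha>\<close> and \<open>\<beta>\<close> the values
    1 and -1 there.\<close>
  define X where "X = (2 / (a + b)) *\<^sub>R (x, 1::real)"
  define q where "q = (1 / t) *\<^sub>R ((p, 1) - X)"
  define c where "c = (1/2) *\<^sub>R (\<alpha> + \<beta>)"
  define \<tau> where "\<tau> = (1/2) *\<^sub>R (\<alpha> - \<beta>)"
  have Xeq: "X = (p, 1) - t *\<^sub>R q" using t by (simp add: q_def)
  have ap: "a + b > 0" using a b by simp
  have \<alpha>q: "\<alpha> \<bullet> q = 1"
  proof -
    have f: "(a + b) * (2 / (a + b) * a) = 2 * a" using ap by simp
    have "(a + b) * (1 - 2 / (a + b) * a) = (a + b) * t"
      unfolding right_diff_distrib mult_1_right ab f by linarith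
    then have eq: "1 - 2 / (a + b) * a = t" using ap by (simp only: mult_left_cancel[OF less_imp_neq[OF ap, symmetric]])
    show ?thesis
      unfolding q_def X_def inner_scaleR_right inner_diff_right \<alpha> eq using t by simp
  qed
  have \<beta>q: "\<beta> \<bullet> q = - 1"
  proof -
    have f: "(a + b) * (2 / (a + b) * b) = 2 * b" using ap by simp
    have "(a + b) * (1 - 2 / (a + b) * b) = (a + b) * (- t)"
      unfolding right_diff_distrib mult_1_right mult_minus_right ab f by linarith
    then have eq: "1 - 2 / (a + b) * b = - t" by (simp only: mult_left_cancel[OF less_imp_neq[OF ap, symmetric]])
    show ?thesis
      unfolding q_def X_def inner_scaleR_right inner_diff_right \<beta> eq using t by simp
  qed
  have cp: "c \<bullet> (p, 1) = 1" and cq: "c \<bullet> q = 0" and \<tau>p: "\<tau> \<bullet> (p, 1) = 0" and \<tau>q: "\<tau> \<bullet> q = 1"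
    using \<alpha> \<beta> \<alpha>q \<beta>q by (auto simp: c_def \<tau>_def inner_add_left inner_diff_left)
  have cpos: "c \<in> pos_affine C"
    using \<alpha>(1) \<beta>(1) by (auto simp: c_def pos_affine_def inner_add_left add_pos_pos)
  \<comment> \<open>The two bounds are the Harnack inequalities between \<open>x\<close> and
    \<open>p\<close> in the two directions.\<close>
  have q_bound: "\<bar>\<zeta> \<bullet> q\<bar> \<le> \<zeta> \<bullet> (p, 1)" if z: "\<zeta> \<in> pos_affine C" for \<zeta>
  proof -
    let ?P = "\<zeta> \<bullet> (p, 1)" and ?X = "\<zeta> \<bullet> (x, 1)"
    have 1: "?X \<le> b * ?P" using exit_ratio_ge[OF x p z] by (simp add: b_def)
    have 2: "a * ?P \<le> ?X" using exit_ratio_ge[OF p x z] ge by (simp add: a_def field_simps)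
    have "\<zeta> \<bullet> X = 2 / (a + b) * ?X" by (simp only: X_def inner_scaleR_right)
    then have zX: "(a + b) * (\<zeta> \<bullet> X) = 2 * ?X" using ap by simp
    have "(a + b) * (t * (\<zeta> \<bullet> q)) = (a + b) * ?P - 2 * ?X"
    proof -
      have "\<zeta> \<bullet> X = ?P - t * (\<zeta> \<bullet> q)"
        using arg_cong[OF Xeq, of "\<lambda>Y. \<zeta> \<bullet> Y"] by (simp only: inner_diff_right inner_scaleR_right)
      then have tq: "t * (\<zeta> \<bullet> q) = ?P - \<zeta> \<bullet> X" by linarith
      show ?thesis unfolding tq right_diff_distrib zX ..
    qed
    then have eq: "(b - a) * (\<zeta> \<bullet> q) = (a + b) * ?P - 2 * ?X" using ab by (simp add: mult.assoc[symmetric])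
    have h: "(b - a) * (\<zeta> \<bullet> q) \<le> (b - a) * ?P" "(b - a) * (- ?P) \<le> (b - a) * (\<zeta> \<bullet> q)"
      unfolding eq using 1 2 by (simp_all add: algebra_simps)
    have bap: "0 < b - a" using ltba by simp
    show ?thesis
      using mult_left_le_imp_le[OF h(1) bap] mult_left_le_imp_le[OF h(2) bap] by linarith
  qed
  define D where "D = {\<delta>. \<delta> \<bullet> (p, 1) = 0 \<and> \<delta> \<bullet> q = 0 \<and> (\<forall>y\<in>C. 0 \<le> (c + \<delta>) \<bullet> (y, 1))}"
  have cD: "compact D" unfolding D_def by (rule compact_transversal_polar[OF p cpos])
  \<comment> \<open>Halving preserves nonnegativity: adding \<open>c\<close> gives half of
    \<open>\<zeta>\<close> plus a combination of \<open>\<alpha>\<close> and \<open>\<beta>\<close>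
    with the nonnegative coefficients \<open>(1 - k) / 4\<close> and \<open>(1 + k) / 4\<close>.
    This is the origin of the factor 2 in \<open>frame\<close>.\<close>
  have inD: "(1/2) *\<^sub>R (\<zeta> - c - (\<zeta> \<bullet> q) *\<^sub>R \<tau>) \<in> D" if z: "\<zeta> \<in> pos_affine C" and zp: "\<zeta> \<bullet> (p, 1) = 1" for \<zeta>
  proof -
    define k where "k = \<zeta> \<bullet> q"
    have k: "\<bar>k\<bar> \<le> 1" using q_bound[OF z] zp by (simp add: k_def)
    let ?d = "(1/2) *\<^sub>R (\<zeta> - c - k *\<^sub>R \<tau>)"
    have "0 \<le> (c + ?d) \<bullet> (y, 1)" if y: "y \<in> C" for y
    proof -
      have "0 \<le> \<zeta> \<bullet> (y, 1)" "0 \<le> (1 - k) * (\<alpha> \<bullet> (y, 1))" "0 \<le> (1 + k) * (\<beta> \<bullet> (y, 1))"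
        using pos_affineD[OF z y] pos_affineD[OF \<alpha>(1) y] pos_affineD[OF \<beta>(1) y] k by auto
      moreover have "(c + ?d) \<bullet> (y, 1) = (1/2) * (\<zeta> \<bullet> (y, 1)) + (1/4) * ((1 - k) * (\<alpha> \<bullet> (y, 1)) + (1 + k) * (\<beta> \<bullet> (y, 1)))"
        by (simp add: c_def \<tau>_def inner_add_left inner_diff_left algebra_simps)
      ultimately show ?thesis by simp
    qed
    moreover have "?d \<bullet> (p, 1) = 0" by (simp add: inner_diff_left zp cp \<tau>p)
    moreover have "?d \<bullet> q = 0" by (simp add: inner_diff_left cq \<tau>q k_def)
    ultimately show ?thesis by (simp add: D_def k_def)
  qed
  have kill: "Y = 0" if Y: "c \<bullet> Y = 0" "\<tau> \<bullet> Y = 0" "\<And>\<delta>. \<delta> \<in> D \<Longrightarrow> \<delta> \<bullet> Y = 0" for Y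
  proof (rule annihilated_vector_zero[OF p])
    fix \<zeta> assume z: "\<zeta> \<in> pos_affine C" "\<zeta> \<bullet> (p, 1) = 1"
    from Y(3)[OF inD[OF z]] show "\<zeta> \<bullet> Y = 0" by (simp add: inner_diff_left Y(1,2))
  qed
  define W where "W = {w. w \<bullet> (p, 1) = 0 \<and> w \<bullet> q = 0}"
  have sW: "subspace W" by (auto simp: W_def subspace_def inner_add_left)
  have "span D = W"
  proof (rule ccontr)
    assume "span D \<noteq> W"
    moreover have sp: "span W = W" using sW by (simp only: span_eq_iff)
    moreover have "span D \<subseteq> W" by (rule span_minimal[OF _ sW]) (auto simp: D_def W_def)
    ultimately have "span D \<subset> span W" by blast
    then obtain w where w: "w \<noteq> 0" "w \<in> span W" "\<And>y. y \<in> span D \<Longrightarrow> orthogonal w y"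
      by (rule orthogonal_to_subspace_exists_gen) blast
    have wW: "w \<bullet> (p, 1) = 0" "w \<bullet> q = 0" using w(2) unfolding sp by (auto simp: W_def)
    define Y where "Y = w - (c \<bullet> w) *\<^sub>R (p, 1) - (\<tau> \<bullet> w) *\<^sub>R q"
    have "Y = 0"
    proof (rule kill)
      show "c \<bullet> Y = 0" by (simp only: Y_def inner_diff_right inner_scaleR_right cp cq, simp?)
      show "\<tau> \<bullet> Y = 0" by (simp only: Y_def inner_diff_right inner_scaleR_right \<tau>p \<tau>q, simp?)
      fix \<delta> assume d: "\<delta> \<in> D"
      then have "\<delta> \<bullet> (p, 1) = 0" "\<delta> \<bullet> q = 0" by (auto simp: D_def)
      moreover have "\<delta> \<bullet> w = 0" using w(3)[OF span_base[OF d]] by (simp add: orthogonal_def inner_commute)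
      ultimately show "\<delta> \<bullet> Y = 0" by (simp only: Y_def inner_diff_right inner_scaleR_right, simp?)
    qed
    then have "w = (c \<bullet> w) *\<^sub>R (p, 1) + (\<tau> \<bullet> w) *\<^sub>R q" by (simp add: Y_def algebra_simps)
    from arg_cong[OF this, of "\<lambda>v. w \<bullet> v"] have "w \<bullet> w = 0"
      by (simp only: inner_add_right inner_scaleR_right wW, simp?)
    with w(1) show False by simp
  qed
  \<comment> \<open>Two independent conditions on a space of dimension
    \<open>CARD('n) + 1 = CARD('m) + 2\<close>.\<close>
  moreover have "dim W = CARD('m)"
  proof -
    have ne: "(p, 1) \<noteq> q"
    proof
      assume "(p, 1) = q" with cp cq show False by simp
    qed
    have "independent {(p, 1), q}"
      unfolding independent_insert
    proof (simp add: ne independent_empty, intro conjI notI)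
      assume "q = 0" with \<tau>q show False by simp
    next
      assume "(p, 1) \<in> span {q}"
      then obtain k where "(p, 1) = k *\<^sub>R q" by (auto simp: span_singleton)
      from arg_cong[OF this, of "\<lambda>v. c \<bullet> v"] show False using cp cq by simp
    qed
    then have d2: "dim (span {(p, 1), q}) = 2" using ne by (simp add: dim_eq_card_independent)
    have "{y \<in> UNIV. \<forall>x\<in>span {(p, 1), q}. orthogonal x y} = W"
    proof -
      have "(\<forall>x\<in>span {(p, 1), q}. orthogonal x y) \<longleftrightarrow> y \<in> W" for y
      proof
        assume "\<forall>x\<in>span {(p, 1), q}. orthogonal x y"
        then have "orthogonal (p, 1) y" "orthogonal q y" by (auto intro: span_base)
        then show "y \<in> W" unfolding W_def orthogonal_def mem_Collect_eq by (simp only: inner_commute)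
      next
        assume "y \<in> W"
        then have "{(p, 1), q} \<subseteq> {v. orthogonal v y}" by (auto simp: W_def orthogonal_def inner_commute)
        then have "span {(p, 1), q} \<subseteq> {v. orthogonal v y}"
          by (rule span_minimal) (auto simp: subspace_def orthogonal_def inner_add_left)
        then show "\<forall>x\<in>span {(p, 1), q}. orthogonal x y" by blast
      qed
      then show ?thesis by blast
    qed
    with dim_subspace_orthogonal_to_vectors[OF subspace_span subspace_UNIV, of "{(p, 1), q}"] d2 dim
    show ?thesis by simp
  qed
  ultimately have "dim D = CARD('m)" by (metis dim_span)
  then obtain \<delta> :: "'m \<Rightarrow> (real^'n) \<times> real" where \<delta>: "\<And>i. \<delta> i \<in> D"
    "\<And>x. x \<in> D \<Longrightarrow> \<exists>c. x = (\<Sum>i\<in>UNIV. c i *\<^sub>R \<delta> i) \<and> (\<forall>i. \<bar>c i\<bar> \<le> 1)"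
    using max_det_basis[OF cD] by blast
  have "adapted_frame C x p r \<alpha> \<beta> q \<delta>"
  proof (unfold_locales, fold c_def \<tau>_def)
    show "\<exists>k>0. (x, 1) = k *\<^sub>R ((p, 1) - ((exp (2 * r) - 1) / (exp (2 * r) + 1)) *\<^sub>R q)"
    proof (intro exI[of _ "(a + b) / 2"] conjI)
      have k: "(a + b) / 2 * (2 / (a + b)) = 1" using ap by simp
      show "(x, 1) = ((a + b) / 2) *\<^sub>R ((p, 1) - ((exp (2 * r) - 1) / (exp (2 * r) + 1)) *\<^sub>R q)"
        unfolding t'[symmetric] Xeq[symmetric] unfolding X_def scaleR_scaleR k by simp
    qed (use ap in simp)
    show "\<bar>\<zeta> \<bullet> q\<bar> \<le> \<zeta> \<bullet> (p, 1)" if "\<zeta> \<in> pos_affine C" for \<zeta> using q_bound that .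
    show "c + \<delta> i \<in> pos_affine C" for i
    proof (rule nonneg_affine_imp_pos_affine[OF open_C _ p])
      show "0 \<le> (c + \<delta> i) \<bullet> (y, 1)" if "y \<in> C" for y using \<delta>(1)[of i] that unfolding D_def by blast
      have "\<delta> i \<bullet> (p, 1) = 0" using \<delta>(1)[of i] unfolding D_def by blast
      then show "0 < (c + \<delta> i) \<bullet> (p, 1)" by (simp only: inner_add_left cp, simp?)
    qed
    fix \<zeta> assume z: "\<zeta> \<in> pos_affine C" "\<zeta> \<bullet> (p, 1) = 1"
    obtain k where k: "(1/2) *\<^sub>R (\<zeta> - c - (\<zeta> \<bullet> q) *\<^sub>R \<tau>) = (\<Sum>i\<in>UNIV. k i *\<^sub>R \<delta> i)" "\<forall>i. \<bar>k i\<bar> \<le> 1"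
      using \<delta>(2)[OF inD[OF z]] by blast
    have "\<zeta> = c + (\<zeta> \<bullet> q) *\<^sub>R \<tau> + 2 *\<^sub>R ((1/2) *\<^sub>R (\<zeta> - c - (\<zeta> \<bullet> q) *\<^sub>R \<tau>))" by simp
    then show "\<exists>k. (\<forall>i. \<bar>k i\<bar> \<le> 1) \<and> \<zeta> = c + (\<zeta> \<bullet> q) *\<^sub>R \<tau> + 2 *\<^sub>R (\<Sum>i\<in>UNIV. k i *\<^sub>R \<delta> i)"
      unfolding k(1) using k(2) by blast
  qed (use \<alpha> \<beta> \<alpha>q \<beta>q x p dist r dim ba \<delta>(1) in \<open>auto simp: D_def\<close>)
  then show thesis by (rule that)
qed

lemma tanh_bound:
  fixes \<rho> r :: real
  assumes "0 < \<rho>" "\<rho> \<le> 1" "\<rho> \<le> r"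
  shows "\<rho> / 2 \<le> (exp (2 * r) - 1) / (exp (2 * r) + 1)"
proof -
  have "1 + 2 * \<rho> \<le> exp (2 * r)" using exp_ge_add_one_self[of "2 * r"] assms by linarith
  then have "(1 + 2 * \<rho>) * (1 - \<rho> / 2) \<le> exp (2 * r) * (1 - \<rho> / 2)" using assms by (intro mult_right_mono) auto
  moreover have "1 + \<rho> / 2 \<le> (1 + 2 * \<rho>) * (1 - \<rho> / 2)"
  proof -
    have "\<rho> * \<rho> \<le> \<rho>" using mult_left_mono[of \<rho> 1 \<rho>] assms by simp
    moreover have "(1 + 2 * \<rho>) * (1 - \<rho> / 2) = 1 + 3 / 2 * \<rho> - \<rho> * \<rho>" by (simp add: field_simps)
    ultimately show ?thesis by linarith
  qed
  ultimately have "\<rho> / 2 * (exp (2 * r) + 1) \<le> exp (2 * r) - 1" by (simp add: algebra_simps)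
  moreover have "0 < exp (2 * r) + 1" by (simp add: add_pos_pos)
  ultimately show ?thesis by (simp only: pos_le_divide_eq)
qed

section \<open>Points in frame coordinates\<close>

context adapted_frame begin

lemma chi_q: "\<chi>' \<bullet> q = 0" and tau_q: "\<tau> \<bullet> q = 1"
  unfolding \<chi>'_def \<tau>_def inner_scaleR_left inner_add_left inner_diff_left \<alpha>q \<beta>q by simp_all

lemma chi_pos: "\<chi>' \<in> pos_affine C"
proof -
  have "0 < \<chi>' \<bullet> (y, 1)" if "y \<in> C" for y
    using pos_affineD[OF \<alpha> that] pos_affineD[OF \<beta> that]
    unfolding \<chi>'_def inner_scaleR_left inner_add_left by simp
  then show ?thesis by (simp add: pos_affine_def)
qed

lemma frame_kill:
  assumes "\<chi>' \<bullet> Y = 0" "\<tau> \<bullet> Y = 0" "\<And>i. \<delta> i \<bullet> Y = 0"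
  shows "Y = 0"
proof (rule annihilated_vector_zero[OF p])
  fix \<zeta> assume z: "\<zeta> \<in> pos_affine C" "\<zeta> \<bullet> (p, 1) = 1"
  obtain c where "\<zeta> = \<chi>' + (\<zeta> \<bullet> q) *\<^sub>R \<tau> + 2 *\<^sub>R (\<Sum>i\<in>UNIV. c i *\<^sub>R \<delta> i)" using frame[OF z] by blast
  from arg_cong[OF this, of "\<lambda>v. v \<bullet> Y"] show "\<zeta> \<bullet> Y = 0"
    by (simp add: inner_add_left inner_sum_left assms)
qed

text \<open>After normalization at \<open>p\<close>, the expansion of \<open>\<zeta>\<close> in the
  frame has coefficients at most 1 in front of \<open>2 *\<^sub>R \<delta> i\<close>. So for every
  positive functional \<open>Y\<close> behaves like the vector
  \<open>(p, 1) + (\<tau> \<bullet> Y) *\<^sub>R q\<close> of the line, up to a relative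
  error.\<close>

lemma frame_estimate:
  fixes \<eta> :: real
  assumes z: "\<zeta> \<in> pos_affine C" and Y: "\<chi>' \<bullet> Y = 1" "\<And>i. \<bar>\<delta> i \<bullet> Y\<bar> \<le> \<eta>"
  shows "\<bar>\<zeta> \<bullet> Y - \<zeta> \<bullet> (p, 1) - (\<tau> \<bullet> Y) * (\<zeta> \<bullet> q)\<bar> \<le> 2 * CARD('m) * \<eta> * (\<zeta> \<bullet> (p, 1))"
proof -
  define P where "P = \<zeta> \<bullet> (p, 1)"
  have P: "0 < P" unfolding P_def by (rule pos_affineD[OF z p])
  define \<xi> where "\<xi> = (1 / P) *\<^sub>R \<zeta>"
  have zeta: "\<zeta> = P *\<^sub>R \<xi>" using P by (simp add: \<xi>_def)
  have xi: "\<xi> \<in> pos_affine C" "\<xi> \<bullet> (p, 1) = 1"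
    using P by (auto simp: \<xi>_def P_def intro!: pos_affine_scaleR[OF z])
  obtain c where c: "\<And>i. \<bar>c i\<bar> \<le> 1" and eq: "\<xi> = \<chi>' + (\<xi> \<bullet> q) *\<^sub>R \<tau> + 2 *\<^sub>R (\<Sum>i\<in>UNIV. c i *\<^sub>R \<delta> i)"
    using frame[OF xi] by blast
  from arg_cong[OF eq, of "\<lambda>v. v \<bullet> Y"]
  have "\<xi> \<bullet> Y - 1 - (\<tau> \<bullet> Y) * (\<xi> \<bullet> q) = 2 * (\<Sum>i\<in>UNIV. c i * (\<delta> i \<bullet> Y))"
    by (simp add: inner_add_left inner_sum_left Y(1))
  moreover have "\<bar>\<Sum>i\<in>UNIV. c i * (\<delta> i \<bullet> Y)\<bar> \<le> CARD('m) * \<eta>"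
  proof -
    have "\<bar>\<Sum>i\<in>UNIV. c i * (\<delta> i \<bullet> Y)\<bar> \<le> (\<Sum>i\<in>UNIV. \<bar>c i * (\<delta> i \<bullet> Y)\<bar>)" by (rule sum_abs)
    also have "\<dots> \<le> (\<Sum>i\<in>(UNIV::'m set). 1 * \<eta>)"
      unfolding abs_mult using c Y(2) by (intro sum_mono mult_mono) auto
    finally show ?thesis by simp
  qed
  ultimately have "\<bar>\<xi> \<bullet> Y - 1 - (\<tau> \<bullet> Y) * (\<xi> \<bullet> q)\<bar> \<le> 2 * CARD('m) * \<eta>" by (simp add: abs_mult)
  then have "P * \<bar>\<xi> \<bullet> Y - 1 - (\<tau> \<bullet> Y) * (\<xi> \<bullet> q)\<bar> \<le> P * (2 * CARD('m) * \<eta>)" using P by (intro mult_left_mono) auto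
  moreover have "P * \<bar>\<xi> \<bullet> Y - 1 - (\<tau> \<bullet> Y) * (\<xi> \<bullet> q)\<bar> = \<bar>\<zeta> \<bullet> Y - P - (\<tau> \<bullet> Y) * (\<zeta> \<bullet> q)\<bar>"
  proof -
    have "\<zeta> \<bullet> Y - P - (\<tau> \<bullet> Y) * (\<zeta> \<bullet> q) = P * (\<xi> \<bullet> Y - 1 - (\<tau> \<bullet> Y) * (\<xi> \<bullet> q))"
      unfolding zeta inner_scaleR_left by (simp add: algebra_simps)
    then show ?thesis using P by (simp only: abs_mult abs_of_pos)
  qed
  ultimately show ?thesis by (simp add: P_def mult.commute)
qed

text \<open>The functionals \<open>\<chi>'\<close>, \<open>\<tau>\<close> and
  \<open>\<delta> i\<close> are \<open>CARD('n) + 1\<close> in number and have only the zero vector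
  as common zero, so they are linear coordinates on homogeneous vectors.\<close>

lemma realize:
  fixes u :: "real^'m" and t :: real
  obtains Y where "\<chi>' \<bullet> Y = 1" "\<tau> \<bullet> Y = t" "\<And>i. \<delta> i \<bullet> Y = u $ i"
proof -
  define \<Phi> where "\<Phi> Y = (\<chi>' \<bullet> Y, \<tau> \<bullet> Y, \<chi> i. \<delta> i \<bullet> Y)" for Y
  have lin: "linear \<Phi>"
    by (rule linearI) (auto simp: \<Phi>_def inner_add_right vec_eq_iff)
  have inj: "inj \<Phi>"
    unfolding linear_injective_0[OF lin]
  proof (intro allI impI)
    fix Y assume "\<Phi> Y = 0"
    then have "\<chi>' \<bullet> Y = 0" "\<tau> \<bullet> Y = 0" "\<delta> i \<bullet> Y = 0" for i
      by (simp_all add: \<Phi>_def zero_prod_def vec_eq_iff)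
    then show "Y = 0" by (rule frame_kill)
  qed
  have "surj \<Phi>"
    by (rule linear_injective_imp_surjective[OF lin inj]) (simp add: dim)
  then obtain Y where "(1, t, u) = \<Phi> Y" by (rule surjE)
  then show thesis using that[of Y] by (auto simp: \<Phi>_def)
qed

definition point :: "(real^'n) \<times> real \<Rightarrow> real^'n" where
  "point Y = fst Y /\<^sub>R snd Y"

lemma point_eval: "0 < snd Y \<Longrightarrow> \<zeta> \<bullet> (point Y, 1) = (\<zeta> \<bullet> Y) / snd Y"
proof -
  assume w: "0 < snd Y"
  then have "(point Y, 1) = (1 / snd Y) *\<^sub>R Y" by (simp add: point_def prod_eq_iff divide_inverse)
  then show ?thesis by simp
qed

lemma point_scaled:
  assumes "0 < \<chi>' \<bullet> (s, 1)"
  shows "point ((1 / (\<chi>' \<bullet> (s, 1))) *\<^sub>R (s, 1)) = s"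
  using assms unfolding point_def fst_scaleR snd_scaleR by simp

lemma point_mem:
  fixes \<eta> :: real
  assumes Y: "\<chi>' \<bullet> Y = 1" "\<And>i. \<bar>\<delta> i \<bullet> Y\<bar> \<le> \<eta>" and s: "2 * CARD('m) * \<eta> + \<bar>\<tau> \<bullet> Y\<bar> < 1"
  shows "0 < snd Y" "point Y \<in> C"
proof -
  have pos: "0 < \<zeta> \<bullet> Y" if z: "\<zeta> \<in> pos_affine C" for \<zeta>
  proof -
    have P: "0 < \<zeta> \<bullet> (p, 1)" by (rule pos_affineD[OF z p])
    have "\<bar>(\<tau> \<bullet> Y) * (\<zeta> \<bullet> q)\<bar> \<le> \<bar>\<tau> \<bullet> Y\<bar> * (\<zeta> \<bullet> (p, 1))"
      unfolding abs_mult by (intro mult_left_mono q_bound z) simp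
    moreover have "(2 * CARD('m) * \<eta> + \<bar>\<tau> \<bullet> Y\<bar>) * (\<zeta> \<bullet> (p, 1)) < 1 * (\<zeta> \<bullet> (p, 1))"
      using s P by (intro mult_strict_right_mono)
    ultimately show ?thesis using frame_estimate[OF z Y] unfolding distrib_right by linarith
  qed
  from pos[OF one_pos_affine] show w: "0 < snd Y" by (cases Y) simp
  show "point Y \<in> C"
    by (rule mem_C_if_pos) (use pos w in \<open>simp add: point_eval\<close>)
qed

text \<open>The last coordinate of \<open>Y\<close>, which is not controlled, cancels in the product
  of the two Harnack constants.\<close>

lemma point_dist_p:
  fixes \<eta> t0 \<sigma> R :: real
  assumes Y: "\<chi>' \<bullet> Y = 1" "\<And>i. \<bar>\<delta> i \<bullet> Y\<bar> \<le> \<eta>" "\<bar>\<tau> \<bullet> Y\<bar> \<le> t0" and \<sigma>: "2 * CARD('m) * \<eta> + t0 = \<sigma>" "\<sigma> < 1" "0 \<le> \<sigma>"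
    and R: "1 + \<sigma> \<le> exp (2 * R) * (1 - \<sigma>)"
  shows "hilbert_dist C p (point Y) \<le> R"
proof -
  have s: "2 * CARD('m) * \<eta> + \<bar>\<tau> \<bullet> Y\<bar> < 1" using Y(3) \<sigma> by linarith
  note pm = point_mem[OF Y(1,2) s]
  have near: "\<bar>\<zeta> \<bullet> Y - \<zeta> \<bullet> (p, 1)\<bar> \<le> \<sigma> * (\<zeta> \<bullet> (p, 1))" if z: "\<zeta> \<in> pos_affine C" for \<zeta>
  proof -
    have P: "0 < \<zeta> \<bullet> (p, 1)" by (rule pos_affineD[OF z p])
    have "\<bar>(\<tau> \<bullet> Y) * (\<zeta> \<bullet> q)\<bar> \<le> t0 * (\<zeta> \<bullet> (p, 1))"
      unfolding abs_mult using Y(3) P by (intro mult_mono q_bound z) auto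
    then show ?thesis using frame_estimate[OF z Y(1,2)] unfolding \<sigma>(1)[symmetric] distrib_right by linarith
  qed
  show ?thesis
  proof (rule hilbert_dist_le[OF p pm(2), of "snd Y / (1 - \<sigma>)" "(1 + \<sigma>) / snd Y"])
    fix \<zeta> assume z: "\<zeta> \<in> pos_affine C"
    have "(1 - \<sigma>) * (\<zeta> \<bullet> (p, 1)) \<le> \<zeta> \<bullet> Y" using near[OF z] unfolding left_diff_distrib by linarith
    then have "\<zeta> \<bullet> (p, 1) \<le> (\<zeta> \<bullet> Y) / (1 - \<sigma>)" using \<sigma> by (simp only: pos_le_divide_eq mult.commute)
    also have "\<dots> = snd Y / (1 - \<sigma>) * (\<zeta> \<bullet> (point Y, 1))" using pm(1) by (simp add: point_eval)
    finally show "\<zeta> \<bullet> (p, 1) \<le> snd Y / (1 - \<sigma>) * (\<zeta> \<bullet> (point Y, 1))" .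
    have "\<zeta> \<bullet> Y \<le> (1 + \<sigma>) * (\<zeta> \<bullet> (p, 1))" using near[OF z] unfolding distrib_right by linarith
    then show "\<zeta> \<bullet> (point Y, 1) \<le> (1 + \<sigma>) / snd Y * (\<zeta> \<bullet> (p, 1))"
      using pm(1) divide_right_mono[of _ _ "snd Y"] by (simp add: point_eval)
  next
    show "snd Y / (1 - \<sigma>) * ((1 + \<sigma>) / snd Y) \<le> exp (2 * R)"
    proof -
      have "snd Y / (1 - \<sigma>) * ((1 + \<sigma>) / snd Y) = (1 + \<sigma>) / (1 - \<sigma>)" using pm(1) by simp
      also have "\<dots> \<le> exp (2 * R)" using R \<sigma>(2) by (simp only: pos_divide_le_eq diff_gt_0_iff_gt)
      finally show ?thesis .
    qed
  qed
qed

text \<open>Moving from \<open>p\<close> towards \<open>x\<close> by \<open>t0\<close> leads into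
  the ball if the transversal error \<open>\<epsilon>\<close> is smaller than \<open>t0\<close>; the
  bound on \<open>t0\<close> by \<open>t * (1 - \<epsilon>)\<close> keeps the point from
  overshooting \<open>x\<close>. The estimates are affine in \<open>k = \<zeta> \<bullet> q\<close>,
  which ranges over \<open>[-P, P]\<close>; \<open>A\<close> is determined by the end
  \<open>k = - P\<close> and \<open>B\<close> by the end \<open>k = P\<close>.\<close>

lemma point_inside:
  fixes \<eta> t0 \<epsilon> t :: real
  assumes Y: "\<chi>' \<bullet> Y = 1" "\<And>i. \<bar>\<delta> i \<bullet> Y\<bar> \<le> \<eta>" "\<tau> \<bullet> Y = - t0" and \<epsilon>: "2 * CARD('m) * \<eta> = \<epsilon>" "0 \<le> \<epsilon>" "\<epsilon> < t0"
    and t: "t = (exp (2 * r) - 1) / (exp (2 * r) + 1)" "\<epsilon> + t0 < 1" "t0 \<le> t * (1 - \<epsilon>)"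
  shows "hilbert_dist C x (point Y) < r"
proof -
  have s: "2 * CARD('m) * \<eta> + \<bar>\<tau> \<bullet> Y\<bar> < 1" using Y(3) \<epsilon> t(2) by simp
  note pm = point_mem[OF Y(1,2) s]
  have E: "exp (2 * r) > 1" using r by simp
  have D: "exp (2 * r) + 1 > 0" using E by linarith
  have t01: "0 < t" "t < 1" using E D by (auto simp: t(1))
  have Et: "exp (2 * r) * (1 - t) = 1 + t"
  proof -
    have "t * (exp (2 * r) + 1) = exp (2 * r) - 1" using D by (simp add: t(1))
    then show ?thesis by (simp add: algebra_simps)
  qed
  obtain c where c: "c > 0" "(x, 1) = c *\<^sub>R ((p, 1) - t *\<^sub>R q)" using x_rep unfolding t(1) by blast
  have zx: "\<zeta> \<bullet> (x, 1) = c * (\<zeta> \<bullet> (p, 1) - t * (\<zeta> \<bullet> q))" for \<zeta>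
    unfolding c(2) inner_scaleR_right inner_diff_right ..
  define w where "w = snd Y"
  have w: "0 < w" using pm(1) by (simp add: w_def)
  have zy: "\<zeta> \<bullet> (point Y, 1) = (\<zeta> \<bullet> Y) / w" for \<zeta> using point_eval[OF pm(1)] by (simp add: w_def)
  define A where "A = c * (1 + t) * w / (1 + t0 - \<epsilon>)"
  define B where "B = (1 - t0 + \<epsilon>) / ((1 - t) * c * w)"
  have dA: "0 < 1 + t0 - \<epsilon>" using \<epsilon> by linarith
  have "exit_ratio C x (point Y) \<le> A"
  proof (rule exit_ratio_le[OF x pm(2)])
    fix \<zeta> assume z: "\<zeta> \<in> pos_affine C"
    define P k where "P = \<zeta> \<bullet> (p, 1)" and "k = \<zeta> \<bullet> q"
    have k: "\<bar>k\<bar> \<le> P" using q_bound[OF z] by (simp add: P_def k_def)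
    have zY: "P - t0 * k - \<epsilon> * P \<le> \<zeta> \<bullet> Y"
      using frame_estimate[OF z Y(1,2)] unfolding \<epsilon>(1) Y(3) P_def k_def by (simp add: abs_le_iff)
    have "0 \<le> (t * (1 - \<epsilon>) - t0) * (P + k)" using t(3) k by (intro mult_nonneg_nonneg) auto
    then have "(P - t * k) * (1 + t0 - \<epsilon>) \<le> (1 + t) * (P - t0 * k - \<epsilon> * P)" by (simp add: algebra_simps)
    also have "\<dots> \<le> (1 + t) * (\<zeta> \<bullet> Y)" using zY t01 by (intro mult_left_mono) auto
    finally have "P - t * k \<le> (1 + t) * (\<zeta> \<bullet> Y) / (1 + t0 - \<epsilon>)" by (simp only: pos_le_divide_eq[OF dA])
    then have "c * (P - t * k) \<le> c * ((1 + t) * (\<zeta> \<bullet> Y) / (1 + t0 - \<epsilon>))" using c(1) by (intro mult_left_mono) auto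
    also have "\<dots> = A * (\<zeta> \<bullet> (point Y, 1))" using w by (simp add: A_def zy)
    finally show "\<zeta> \<bullet> (x, 1) \<le> A * (\<zeta> \<bullet> (point Y, 1))" unfolding zx P_def k_def .
  qed
  moreover have "exit_ratio C (point Y) x \<le> B"
  proof (rule exit_ratio_le[OF pm(2) x])
    fix \<zeta> assume z: "\<zeta> \<in> pos_affine C"
    define P k where "P = \<zeta> \<bullet> (p, 1)" and "k = \<zeta> \<bullet> q"
    have k: "\<bar>k\<bar> \<le> P" using q_bound[OF z] by (simp add: P_def k_def)
    have zY: "\<zeta> \<bullet> Y \<le> P - t0 * k + \<epsilon> * P"
      using frame_estimate[OF z Y(1,2)] unfolding \<epsilon>(1) Y(3) P_def k_def by (simp add: abs_le_iff)
    have "t * (1 - \<epsilon>) \<le> t * (1 + \<epsilon>)" using t01 \<epsilon>(2) by (intro mult_left_mono) auto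
    then have "0 \<le> (t * (1 + \<epsilon>) - t0) * (P - k)" using t(3) k by (intro mult_nonneg_nonneg) auto
    then have "(1 - t) * (P - t0 * k + \<epsilon> * P) \<le> (1 - t0 + \<epsilon>) * (P - t * k)" by (simp add: algebra_simps)
    moreover have "(1 - t) * (\<zeta> \<bullet> Y) \<le> (1 - t) * (P - t0 * k + \<epsilon> * P)" using zY t01 by (intro mult_left_mono) auto
    ultimately have "(\<zeta> \<bullet> Y) * (1 - t) \<le> (1 - t0 + \<epsilon>) * (P - t * k)" by (simp add: mult.commute)
    then have "\<zeta> \<bullet> Y \<le> (1 - t0 + \<epsilon>) * (P - t * k) / (1 - t)" using t01 by (simp only: pos_le_divide_eq diff_gt_0_iff_gt)
    then have "(\<zeta> \<bullet> Y) / w \<le> (1 - t0 + \<epsilon>) * (P - t * k) / (1 - t) / w" using w by (intro divide_right_mono) auto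
    also have "\<dots> = B * (c * (P - t * k))" using w c(1) t01 by (simp add: B_def)
    finally show "\<zeta> \<bullet> (point Y, 1) \<le> B * (\<zeta> \<bullet> (x, 1))" unfolding zy zx P_def k_def .
  qed
  ultimately have "exit_ratio C (point Y) x * exit_ratio C x (point Y) \<le> B * A"
    using exit_ratio_ge_1[OF x pm(2)] exit_ratio_ge_1[OF pm(2) x] by (intro mult_mono) auto
  also have "B * A < exp (2 * r)"
  proof -
    have "B * A = (1 + t) / (1 - t) * ((1 - t0 + \<epsilon>) / (1 + t0 - \<epsilon>))"
      using c(1) w t01 dA by (simp add: A_def B_def)
    also have "(1 + t) / (1 - t) = exp (2 * r)" using Et t01 by (simp add: field_simps)
    also have "exp (2 * r) * ((1 - t0 + \<epsilon>) / (1 + t0 - \<epsilon>)) < exp (2 * r) * 1"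
      using dA \<epsilon>(3) by (intro mult_strict_left_mono) auto
    finally show ?thesis by simp
  qed
  finally have "exp (2 * hilbert_dist C x (point Y)) < exp (2 * r)" by (simp only: exp_hilbert_dist[OF x pm(2)])
  then show ?thesis by simp
qed

text \<open>Here \<open>\<alpha>\<close> and \<open>\<beta>\<close> suffice: they attain the
  distance from \<open>x\<close> to \<open>p\<close>, and beyond \<open>p\<close> their cross-ratio
  grows by the factor \<open>(1 + t0) / (1 - t0)\<close>.\<close>

lemma point_outside:
  fixes t0 :: real
  assumes Y: "\<chi>' \<bullet> Y = 1" "\<tau> \<bullet> Y = t0" "0 < t0" "t0 < 1" and pm: "0 < snd Y" "point Y \<in> C"
  shows "r < hilbert_dist C x (point Y)"
proof -
  have "\<alpha> = \<chi>' + \<tau>" "\<beta> = \<chi>' - \<tau>" by (simp_all add: \<chi>'_def \<tau>_def scaleR_add_right scaleR_diff_right flip: scaleR_left.add)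
  then have aY: "\<alpha> \<bullet> Y = 1 + t0" "\<beta> \<bullet> Y = 1 - t0" by (simp_all only: inner_add_left inner_diff_left Y)
  let ?e = "exp (2 * hilbert_dist C x (point Y))"
  have ax: "0 < \<alpha> \<bullet> (x, 1)" by (rule pos_affineD[OF \<alpha> x])
  have "(\<beta> \<bullet> (x, 1)) * (\<alpha> \<bullet> (point Y, 1)) \<le> ?e * ((\<beta> \<bullet> (point Y, 1)) * (\<alpha> \<bullet> (x, 1)))"
    by (rule hilbert_dist_ge[OF x pm(2) \<beta> \<alpha>])
  then have "(\<alpha> \<bullet> (x, 1) / snd Y) * (exp (2 * r) * (1 + t0)) \<le> (\<alpha> \<bullet> (x, 1) / snd Y) * (?e * (1 - t0))"
    unfolding \<beta>x point_eval[OF pm(1)] aY by (simp add: mult_ac)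
  moreover have "0 < \<alpha> \<bullet> (x, 1) / snd Y" using ax pm(1) by simp
  ultimately have 1: "exp (2 * r) * (1 + t0) \<le> ?e * (1 - t0)" by (rule mult_left_le_imp_le)
  have "exp (2 * r) * (1 - t0) < exp (2 * r) * (1 + t0)" using Y(3) by (intro mult_strict_left_mono) auto
  with 1 have "exp (2 * r) * (1 - t0) < ?e * (1 - t0)" by linarith
  then have "exp (2 * r) < ?e" by (rule mult_right_less_imp_less) (use Y(4) in simp)
  then show ?thesis by simp
qed

text \<open>Central projection from \<open>q\<close>, in the chart where \<open>\<chi>'\<close>
  equals 1: numerators and denominator are unchanged when a multiple of \<open>q\<close> is added to
  \<open>(s, 1)\<close>.\<close>

definition proj :: "real^'n \<Rightarrow> real^'m" where
  "proj s = (\<chi> i. (\<delta> i \<bullet> (s, 1)) / (\<chi>' \<bullet> (s, 1)))"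

text \<open>With \<open>\<eta> = \<rho> / (24 * CARD('m))\<close> the transversal error
  \<open>2 * CARD('m) * \<eta>\<close> is \<open>\<rho> / 12\<close>, below the longitudinal bound
  \<open>\<rho> / 6\<close> as \<open>point_inside\<close> demands; together they make
  \<open>\<rho> / 4\<close>, the variation allowed by \<open>exp_margin\<close>. Multiplying by
  \<open>\<chi>' \<bullet> (s, 1)\<close> instead of dividing makes the conditions visibly
  closed.\<close>

definition piece :: "real \<Rightarrow> (real^'n) set" where
  "piece \<rho> = {s \<in> hilbert_sphere C x r. (\<forall>i. \<bar>\<delta> i \<bullet> (s, 1)\<bar> \<le> \<rho> / (24 * CARD('m)) * (\<chi>' \<bullet> (s, 1))) \<and>
     \<bar>\<tau> \<bullet> (s, 1)\<bar> \<le> \<rho> / 6 * (\<chi>' \<bullet> (s, 1))}"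

context
  fixes \<rho> :: real
  assumes \<rho>: "0 < \<rho>" "\<rho> \<le> 1" "\<rho> \<le> r"
begin

lemma eps_eq: "2 * CARD('m) * (\<rho> / (24 * CARD('m))) = \<rho> / 12"
  by simp

lemma point_in_ball:
  assumes Y: "\<chi>' \<bullet> Y = 1" "\<tau> \<bullet> Y = - (\<rho> / 6)" "\<And>i. \<bar>\<delta> i \<bullet> Y\<bar> \<le> \<rho> / (24 * CARD('m))"
  shows "0 < snd Y" "point Y \<in> C" "hilbert_dist C x (point Y) < r"
proof -
  show "0 < snd Y" "point Y \<in> C" using point_mem[OF Y(1,3)] \<rho> by (simp_all add: eps_eq Y)
  \<comment> \<open>\<open>\<rho> / 2\<close> is a lower bound for the hyperbolic tangent of
    \<open>r\<close>, the parameter \<open>t\<close> of \<open>point_inside\<close>.\<close>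
  have "\<rho> / 6 \<le> \<rho> / 2 * (1 - \<rho> / 12)"
  proof -
    have "\<rho> * \<rho> \<le> \<rho>" using mult_left_mono[of \<rho> 1 \<rho>] \<rho> by simp
    then show ?thesis using \<rho> by (simp add: field_simps)
  qed
  also have "\<dots> \<le> (exp (2 * r) - 1) / (exp (2 * r) + 1) * (1 - \<rho> / 12)"
    using \<rho> by (intro mult_right_mono tanh_bound) auto
  finally show "hilbert_dist C x (point Y) < r"
    using \<rho> by (intro point_inside[OF Y(1,3,2) eps_eq _ _ refl]) auto
qed

text \<open>In the fibre of the projection over \<open>u\<close>, the point with
  \<open>\<tau>\<close>-coordinate \<open>- \<rho> / 6\<close> is inside the ball and the one with
  \<open>\<rho> / 6\<close> outside. The segment between them stays in the fibre and meets the
  sphere.\<close>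

lemma box_subset_proj:
  assumes u: "\<And>i. \<bar>u $ i\<bar> \<le> \<rho> / (24 * CARD('m))"
  shows "u \<in> proj ` piece \<rho>"
proof -
  let ?\<eta> = "\<rho> / (24 * CARD('m))" and ?t = "\<rho> / 6"
  obtain Y0 where Y0: "\<chi>' \<bullet> Y0 = 1" "\<tau> \<bullet> Y0 = - ?t" "\<And>i. \<delta> i \<bullet> Y0 = u $ i"
    by (rule realize[where t = "- ?t" and u = u]) blast
  obtain Y1 where Y1: "\<chi>' \<bullet> Y1 = 1" "\<tau> \<bullet> Y1 = ?t" "\<And>i. \<delta> i \<bullet> Y1 = u $ i"
    by (rule realize[where t = ?t and u = u]) blast
  have b0: "\<bar>\<delta> i \<bullet> Y0\<bar> \<le> ?\<eta>" and b1: "\<bar>\<delta> i \<bullet> Y1\<bar> \<le> ?\<eta>" for i using u by (simp_all add: Y0 Y1)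
  note pm0 = point_in_ball[OF Y0(1,2) b0]
  have pm1: "0 < snd Y1" "point Y1 \<in> C" using point_mem[OF Y1(1) b1] \<rho> by (simp_all add: eps_eq Y1)
  have "r < hilbert_dist C x (point Y1)"
    by (rule point_outside[OF Y1(1,2) _ _ pm1]) (use \<rho> in auto)
  with pm0(3) have lr: "hilbert_dist C x (point Y0) < r" "r < hilbert_dist C x (point Y1)" .
  let ?S = "closed_segment (point Y0) (point Y1)"
  have sub: "?S \<subseteq> C" using closed_segment_subset convex_C pm0 pm1 by blast
  have "connected (hilbert_dist C x ` ?S)"
    by (rule connected_continuous_image) (use continuous_on_subset[OF continuous_on_hilbert_dist[OF x] sub] in auto)
  then have "{hilbert_dist C x (point Y0)..hilbert_dist C x (point Y1)} \<subseteq> hilbert_dist C x ` ?S"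
    by (rule connected_contains_Icc) auto
  then have "r \<in> hilbert_dist C x ` ?S" using lr by auto
  then obtain s where s: "s \<in> ?S" "hilbert_dist C x s = r" by auto
  then have sS: "s \<in> hilbert_sphere C x r" using sub by (auto simp: hilbert_sphere_def)
  obtain l where l: "0 \<le> l" "l \<le> 1" "s = point Y0 + l *\<^sub>R (point Y1 - point Y0)"
    using s(1) by (auto simp: in_segment(1) algebra_simps)
  \<comment> \<open>\<open>(s, 1)\<close> is \<open>a\<close> times \<open>Y0\<close> plus
    \<open>b\<close> times \<open>Y1\<close>, with nonnegative coefficients, so it inherits the
    bounds of both.\<close>
  define a b where "a = (1 - l) / snd Y0" and "b = l / snd Y1"
  have ab: "0 \<le> a" "0 \<le> b" using l pm0 pm1 by (auto simp: a_def b_def)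
  have ev: "\<zeta> \<bullet> (s, 1) = a * (\<zeta> \<bullet> Y0) + b * (\<zeta> \<bullet> Y1)" for \<zeta>
    unfolding l(3) affine_eval_between point_eval[OF pm0(1)] point_eval[OF pm1(1)]
    by (simp add: a_def b_def algebra_simps diff_divide_distrib)
  have chi: "\<chi>' \<bullet> (s, 1) = a + b" by (simp add: ev Y0 Y1)
  have pos: "0 < a + b" using pos_affineD[OF chi_pos, of s] sS chi by (simp add: hilbert_sphere_def)
  have del: "\<delta> i \<bullet> (s, 1) = (a + b) * u $ i" for i by (simp add: ev Y0 Y1 algebra_simps)
  have "\<bar>\<delta> i \<bullet> (s, 1)\<bar> \<le> ?\<eta> * (a + b)" for i
    unfolding del abs_mult abs_of_pos[OF pos] mult.commute[of "a + b"]
    by (intro mult_right_mono u) (use pos in auto)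
  moreover have "\<bar>\<tau> \<bullet> (s, 1)\<bar> \<le> ?t * (a + b)"
  proof -
    have t: "\<tau> \<bullet> (s, 1) = ?t * (b - a)" by (simp add: ev Y0 Y1 algebra_simps)
    have "\<bar>b - a\<bar> \<le> a + b" using ab by linarith
    then show ?thesis unfolding t abs_mult using \<rho>(1) by (simp add: mult_left_mono)
  qed
  ultimately have "s \<in> piece \<rho>" using sS by (simp add: piece_def chi)
  moreover have "proj s = u" using pos by (simp add: proj_def vec_eq_iff chi del)
  ultimately show ?thesis by blast
qed

lemma piece_normalized:
  assumes s: "s \<in> piece \<rho>"
  defines "Y \<equiv> (1 / (\<chi>' \<bullet> (s, 1))) *\<^sub>R (s, 1)"
  shows "\<chi>' \<bullet> Y = 1" "\<And>i. \<bar>\<delta> i \<bullet> Y\<bar> \<le> \<rho> / (24 * CARD('m))" "\<bar>\<tau> \<bullet> Y\<bar> \<le> \<rho> / 6" "point Y = s"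
    "0 < \<chi>' \<bullet> (s, 1)"
proof -
  have sC: "s \<in> C" using s by (simp add: piece_def hilbert_sphere_def)
  show pos: "0 < \<chi>' \<bullet> (s, 1)" by (rule pos_affineD[OF chi_pos sC])
  show "\<chi>' \<bullet> Y = 1" unfolding Y_def inner_scaleR_right using pos by simp
  show "\<bar>\<delta> i \<bullet> Y\<bar> \<le> \<rho> / (24 * CARD('m))" for i
  proof -
    have "\<bar>\<delta> i \<bullet> (s, 1)\<bar> / (\<chi>' \<bullet> (s, 1)) \<le> \<rho> / (24 * CARD('m))"
      using s by (simp only: pos_divide_le_eq[OF pos]) (simp add: piece_def)
    then show ?thesis unfolding Y_def inner_scaleR_right abs_mult using pos by simp
  qed
  show "\<bar>\<tau> \<bullet> Y\<bar> \<le> \<rho> / 6"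
  proof -
    have "\<bar>\<tau> \<bullet> (s, 1)\<bar> / (\<chi>' \<bullet> (s, 1)) \<le> \<rho> / 6"
      using s by (simp only: pos_divide_le_eq[OF pos]) (simp add: piece_def)
    then show ?thesis unfolding Y_def inner_scaleR_right abs_mult using pos by simp
  qed
  show "point Y = s" unfolding Y_def by (rule point_scaled[OF pos])
qed

lemma piece_subset_ball: "piece \<rho> \<subseteq> hilbert_sphere C x r \<inter> hilbert_ball C p \<rho>"
proof
  fix s assume s: "s \<in> piece \<rho>"
  note Y = piece_normalized[OF s]
  have "hilbert_dist C p s \<le> \<rho> / 2"
    using point_dist_p[OF Y(1,2,3) _ _ _ exp_margin[OF \<rho>(1,2)]] \<rho> unfolding eps_eq Y(4) by simp
  then show "s \<in> hilbert_sphere C x r \<inter> hilbert_ball C p \<rho>"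
    using s \<rho>(1) by (auto simp: piece_def hilbert_ball_def hilbert_sphere_def)
qed

text \<open>The fibre through \<open>s\<close> also contains an interior point of the ball, where
  the supporting functional at \<open>s\<close> is negative. As it vanishes at \<open>s\<close>, it
  is not constant along the fibre, so it does not vanish at \<open>q\<close>. This makes the
  projection injective on tangent planes.\<close>

lemma piece_transversal:
  assumes s: "s \<in> piece \<rho>" and \<nu>: "unit_normal (closed_ball x r) s \<nu>"
  shows "(\<nu>, - (\<nu> \<bullet> s)) \<bullet> q \<noteq> 0"
proof -
  define Y where "Y = (1 / (\<chi>' \<bullet> (s, 1))) *\<^sub>R (s, 1::real)"
  note Ys = piece_normalized[OF s, folded Y_def]
  let ?\<eta> = "\<rho> / (24 * CARD('m))" and ?t = "\<rho> / 6"
  obtain Y0 where Y0: "\<chi>' \<bullet> Y0 = 1" "\<tau> \<bullet> Y0 = - ?t" "\<And>i. \<delta> i \<bullet> Y0 = (\<chi> i. \<delta> i \<bullet> Y) $ i"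
    by (rule realize[where t = "- ?t" and u = "\<chi> i. \<delta> i \<bullet> Y"]) blast
  have b0: "\<bar>\<delta> i \<bullet> Y0\<bar> \<le> ?\<eta>" for i using Ys(2) by (simp add: Y0)
  note pm0 = point_in_ball[OF Y0(1,2) b0]
  then have int: "point Y0 \<in> interior (closed_ball x r)"
    using hilbert_ball_subset_interior[OF x] pm0(2,3) by (auto simp: hilbert_ball_def)
  interpret K: convex_body "closed_ball x r"
    by unfold_locales (use convex_closed_ball[OF x] closed_closed_ball[OF x] int in auto)
  have neg: "\<nu> \<bullet> (point Y0 - s) < 0" by (rule K.unit_normal_interior[OF \<nu> int])
  define \<kappa> where "\<kappa> = (\<nu>, - (\<nu> \<bullet> s))"
  have "\<kappa> \<bullet> (point Y0, 1) < 0" using neg by (simp add: \<kappa>_def inner_diff_right)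
  then have k0: "\<kappa> \<bullet> Y0 \<noteq> 0" unfolding point_eval[OF pm0(1)] by auto
  have kY: "\<kappa> \<bullet> Y = 0" unfolding Y_def inner_scaleR_right by (simp add: \<kappa>_def)
  have "Y - Y0 - (\<tau> \<bullet> Y + ?t) *\<^sub>R q = 0"
  proof (rule frame_kill)
    show "\<chi>' \<bullet> (Y - Y0 - (\<tau> \<bullet> Y + ?t) *\<^sub>R q) = 0"
      by (simp only: inner_diff_right inner_scaleR_right Ys(1) Y0(1) chi_q, simp?)
    show "\<tau> \<bullet> (Y - Y0 - (\<tau> \<bullet> Y + ?t) *\<^sub>R q) = 0"
      by (simp only: inner_diff_right inner_scaleR_right Y0(2) tau_q, simp?)
    show "\<delta> i \<bullet> (Y - Y0 - (\<tau> \<bullet> Y + ?t) *\<^sub>R q) = 0" for i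
      by (simp only: inner_diff_right inner_scaleR_right Y0(3) \<delta>q, simp?)
  qed
  from arg_cong[OF this, of "\<lambda>v. \<kappa> \<bullet> v"] have "(\<tau> \<bullet> Y + ?t) * (\<kappa> \<bullet> q) = - (\<kappa> \<bullet> Y0)"
    by (simp only: inner_diff_right inner_scaleR_right kY inner_zero_right, simp?)
  with k0 show ?thesis unfolding \<kappa>_def by auto
qed

end

end

section \<open>The area density and the differential of the projection\<close>

definition area_density :: "((real^'m) set \<Rightarrow> real^'m \<Rightarrow> real) \<Rightarrow> (real^'n) set \<Rightarrow> (real^'n) set \<Rightarrow> real^'n \<Rightarrow> ennreal" where
  "area_density g C S s =
     (if \<exists>!H. tangent_hyperplane S s H then ennreal (slice_density g C (THE H. tangent_hyperplane S s H) s) else 0)"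

context adapted_frame begin

definition grad :: "'m \<Rightarrow> real^'n \<Rightarrow> real^'n \<Rightarrow> real^'n" where
  "grad i a b = (1 / (\<chi>' \<bullet> (a, 1))) *\<^sub>R fst (\<delta> i) - (\<delta> i \<bullet> (b, 1) / (\<chi>' \<bullet> (a, 1) * (\<chi>' \<bullet> (b, 1)))) *\<^sub>R fst \<chi>'"

text \<open>A divided difference of the projection: it is exact for any two points of
  \<open>C\<close>, linear in \<open>h\<close>, and has coefficients continuous in the pair. On the
  diagonal it is the derivative, so strict differentiability follows from continuity.\<close>

definition secant :: "real^'n \<Rightarrow> real^'n \<Rightarrow> real^'n \<Rightarrow> real^'m" where
  "secant a b h = (\<chi> i. grad i a b \<bullet> h)"

lemma linear_secant: "linear (secant a b)"
  by (rule linearI) (auto simp: secant_def inner_add_right vec_eq_iff)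

lemma proj_diff:
  assumes "a \<in> C" "b \<in> C"
  shows "proj a - proj b = secant a b (a - b)"
proof (rule vec_eq_iff[THEN iffD2, rule_format])
  fix i
  have pos: "0 < \<chi>' \<bullet> (a, 1)" "0 < \<chi>' \<bullet> (b, 1)" using pos_affineD[OF chi_pos] assms by auto
  define ca cb da db where "ca = \<chi>' \<bullet> (a, 1)" and "cb = \<chi>' \<bullet> (b, 1)" and "da = \<delta> i \<bullet> (a, 1)" and "db = \<delta> i \<bullet> (b, 1)"
  have c: "fst \<chi>' \<bullet> (a - b) = ca - cb" and d: "fst (\<delta> i) \<bullet> (a - b) = da - db"
    by (cases \<chi>'; cases "\<delta> i"; simp add: ca_def cb_def da_def db_def inner_diff_right)+
  have "grad i a b \<bullet> (a - b) = (1 / ca) * (da - db) - (db / (ca * cb)) * (ca - cb)"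
    unfolding grad_def inner_diff_left inner_scaleR_left c d by (simp add: ca_def cb_def da_def db_def)
  also have "\<dots> = da / ca - db / cb" using pos by (simp add: ca_def[symmetric] cb_def[symmetric] field_simps)
  finally show "(proj a - proj b) $ i = secant a b (a - b) $ i"
    by (simp add: proj_def secant_def ca_def cb_def da_def db_def)
qed

lemma secant_near:
  assumes s: "s \<in> C" and e: "e > 0"
  shows "\<exists>d>0. ball s d \<subseteq> C \<and> (\<forall>a\<in>ball s d. \<forall>b\<in>ball s d. \<forall>h. norm (secant a b h - secant s s h) \<le> e * norm h)"
proof -
  \<comment> \<open>Bounds the operator norm of the difference of the secants; it is continuous at
    \<open>(s, s)\<close> and vanishes there.\<close>
  define N where "N z = (\<Sum>i\<in>UNIV. norm (grad i (fst z) (snd z) - grad i s s))" for z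
  have "isCont N (s, s)"
    unfolding N_def grad_def using pos_affineD[OF chi_pos s] by (intro continuous_intros) auto
  then have "\<exists>d>0. \<forall>z. dist z (s, s) < d \<longrightarrow> dist (N z) (N (s, s)) < e"
    using e unfolding continuous_at_eps_delta by blast
  then obtain d where d: "d > 0" "\<And>z. dist z (s, s) < d \<Longrightarrow> dist (N z) (N (s, s)) < e" by blast
  obtain d' where d': "d' > 0" "ball s d' \<subseteq> C" using open_C s open_contains_ball by blast
  have N0: "N (s, s) = 0" by (simp add: N_def)
  show ?thesis
  proof (intro exI[of _ "min d' (d / 2)"] conjI ballI allI)
    show "min d' (d / 2) > 0" "ball s (min d' (d / 2)) \<subseteq> C" using d d' by auto
    fix a b h assume ab: "a \<in> ball s (min d' (d / 2))" "b \<in> ball s (min d' (d / 2))"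
    have "dist (a, b) (s, s) \<le> dist a s + dist b s"
      unfolding dist_Pair_Pair using sqrt_sum_squares_le_sum[of "dist a s" "dist b s"] by simp
    also have "\<dots> < d" using ab by (simp add: dist_commute)
    finally have "N (a, b) < e" using d(2)[of "(a, b)"] by (simp add: N0 dist_real_def)
    have "norm (secant a b h - secant s s h) \<le> (\<Sum>i\<in>UNIV. \<bar>(secant a b h - secant s s h) $ i\<bar>)"
      by (rule norm_le_l1_cart)
    also have "\<dots> = (\<Sum>i\<in>UNIV. \<bar>(grad i a b - grad i s s) \<bullet> h\<bar>)" by (simp add: secant_def inner_diff_left)
    also have "\<dots> \<le> (\<Sum>i\<in>UNIV. norm (grad i a b - grad i s s) * norm h)"
      by (intro sum_mono Cauchy_Schwarz_ineq2)
    also have "\<dots> = N (a, b) * norm h" by (simp add: N_def sum_distrib_right)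
    also have "\<dots> \<le> e * norm h" using \<open>N (a, b) < e\<close> by (intro mult_right_mono) auto
    finally show "norm (secant a b h - secant s s h) \<le> e * norm h" .
  qed
qed

lemma proj_strict:
  assumes s: "s \<in> C" and e: "e > 0"
  shows "\<exists>d>0. \<forall>a\<in>ball s d. \<forall>b\<in>ball s d. norm (proj a - proj b - secant s s (a - b)) \<le> e * norm (a - b)"
proof -
  obtain d where d: "d > 0" "ball s d \<subseteq> C"
    "\<And>a b h. a \<in> ball s d \<Longrightarrow> b \<in> ball s d \<Longrightarrow> norm (secant a b h - secant s s h) \<le> e * norm h"
    using secant_near[OF s e] by blast
  have "norm (proj a - proj b - secant s s (a - b)) \<le> e * norm (a - b)" if "a \<in> ball s d" "b \<in> ball s d" for a b
  proof -
    have "a \<in> C" "b \<in> C" using d(2) that by blast+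
    then show ?thesis unfolding proj_diff[OF \<open>a \<in> C\<close> \<open>b \<in> C\<close>] by (intro d(3) that)
  qed
  with d(1) show ?thesis by blast
qed

lemma proj_has_derivative:
  assumes s: "s \<in> C" shows "(proj has_derivative secant s s) (at s)"
  unfolding has_derivative_at_alt
proof (intro conjI allI impI)
  show "bounded_linear (secant s s)" using linear_secant by (simp add: linear_conv_bounded_linear)
  fix e :: real assume "e > 0"
  then obtain d where "d > 0" "\<And>a b. a \<in> ball s d \<Longrightarrow> b \<in> ball s d \<Longrightarrow> norm (proj a - proj b - secant s s (a - b)) \<le> e * norm (a - b)"
    using proj_strict[OF s] by blast
  then show "\<exists>d>0. \<forall>y. norm (y - s) < d \<longrightarrow> norm (proj y - proj s - secant s s (y - s)) \<le> e * norm (y - s)"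
    by (intro exI[of _ d]) (auto simp: dist_norm norm_minus_commute)
qed

lemma continuous_on_proj: "continuous_on C proj"
  by (rule continuous_at_imp_continuous_on) (use proj_has_derivative has_derivative_continuous in blast)

lemma proj_lipschitz:
  assumes s: "s \<in> C"
  shows "\<exists>T B. open T \<and> s \<in> T \<and> (\<forall>y\<in>C \<inter> T. norm (proj y - proj s) \<le> B * norm (y - s))"
proof -
  obtain d where d: "d > 0" "\<And>a b. a \<in> ball s d \<Longrightarrow> b \<in> ball s d \<Longrightarrow> norm (proj a - proj b - secant s s (a - b)) \<le> 1 * norm (a - b)"
    using proj_strict[OF s, of 1] by auto
  have bl: "bounded_linear (secant s s)" using linear_secant by (simp add: linear_conv_bounded_linear)
  have "norm (proj y - proj s) \<le> (onorm (secant s s) + 1) * norm (y - s)" if "y \<in> ball s d" for y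
  proof -
    have "norm (proj y - proj s) \<le> norm (proj y - proj s - secant s s (y - s)) + norm (secant s s (y - s))"
      using norm_triangle_ineq[of "proj y - proj s - secant s s (y - s)" "secant s s (y - s)"] by simp
    also have "\<dots> \<le> 1 * norm (y - s) + onorm (secant s s) * norm (y - s)"
      using that d(1) by (intro add_mono d(2) onorm[OF bl]) auto
    finally show ?thesis by (simp add: algebra_simps)
  qed
  then show ?thesis using d(1) by (intro exI[of _ "ball s d"] exI[of _ "onorm (secant s s) + 1"]) auto
qed

lemma convex_body_closed_ball: "convex_body (closed_ball x r)"
proof
  show "convex (closed_ball x r)" by (rule convex_closed_ball[OF x])
  show "closed (closed_ball x r)" by (rule closed_closed_ball[OF x])
  have "x \<in> hilbert_ball C x r" using x r by (simp add: hilbert_ball_def hilbert_dist_refl)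
  then show "interior (closed_ball x r) \<noteq> {}" using hilbert_ball_subset_interior[OF x] by blast
qed

text \<open>The quotients of \<open>\<chi>' + \<delta> i\<close> by \<open>\<chi>'\<close> map the
  tangent slice of \<open>C\<close> into the orthant. In the chosen parametrization this map is
  \<open>1 + proj\<close>, so its Jacobian is that of the projection along the tangent plane,
  nonzero because \<open>q\<close> is off that plane.\<close>

lemma area_density_ge:
  fixes g :: "(real^'m) set \<Rightarrow> real^'m \<Rightarrow> real"
  assumes g: "proper_density g" and \<rho>: "0 < \<rho>" "\<rho> \<le> 1" "\<rho> \<le> r" and s: "s \<in> piece \<rho>"
    and n: "unit_normal (closed_ball x r) s \<nu>" and uniq: "\<And>\<nu>'. unit_normal (closed_ball x r) s \<nu>' \<Longrightarrow> \<nu>' = \<nu>"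
  obtains Q :: "real^'m \<Rightarrow> real^'n" where "linear Q" "\<forall>h. norm (Q h) = norm h" "range Q = {h. \<nu> \<bullet> h = 0}"
    "det (matrix (secant s s \<circ> Q)) \<noteq> 0"
    "ennreal (g orthant 1 / 2 ^ CARD('m) * \<bar>det (matrix (secant s s \<circ> Q))\<bar>) \<le> area_density g C (hilbert_sphere C x r) s"
proof -
  interpret K: convex_body "closed_ball x r" by (rule convex_body_closed_ball)
  have sS: "s \<in> hilbert_sphere C x r" and sC: "s \<in> C" using s by (auto simp: piece_def hilbert_sphere_def)
  note fr = frontier_closed_ball[OF x r]
  define H where "H = {q. \<nu> \<bullet> (q - s) = 0}"
  have "tangent_hyperplane (hilbert_sphere C x r) s H' \<longleftrightarrow> H' = H" for H'
    using K.tangent_hyperplane_iff[OF _ n uniq] sS unfolding fr H_def by blast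
  then have tang: "tangent_hyperplane (hilbert_sphere C x r) s = (\<lambda>H'. H' = H)" by blast
  define \<phi> where "\<phi> = (SOME \<phi> :: real^'m \<Rightarrow> real^'n. (\<forall>u v. dist (\<phi> u) (\<phi> v) = dist u v) \<and> range \<phi> = H)"
  have n0: "\<nu> \<noteq> 0" using n by (auto simp: unit_normal_def)
  have "\<exists>\<phi> :: real^'m \<Rightarrow> real^'n. (\<forall>u v. dist (\<phi> u) (\<phi> v) = dist u v) \<and> range \<phi> = H"
    unfolding H_def by (rule hyperplane_isometry[OF dim n0])
  from someI_ex[OF this] have iso: "\<And>u v. dist (\<phi> u) (\<phi> v) = dist u v" and ran: "range \<phi> = H" unfolding \<phi>_def by blast+
  define Q where "Q u = \<phi> u - \<phi> 0" for u
  have linQ: "linear Q" and normQ: "\<And>u. norm (Q u) = norm u"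
    unfolding Q_def using isometry_affine[OF iso] by auto
  have phiQ: "\<phi> u = \<phi> 0 + Q u" for u by (simp add: Q_def)
  define o' where "o' = \<phi> 0"
  have phi_fun: "\<phi> = (\<lambda>u. o' + Q u)" by (simp add: Q_def o'_def)
  have in_H: "\<nu> \<bullet> (\<phi> u - s) = 0" for u using ran by (auto simp: H_def)
  have nQ: "\<nu> \<bullet> Q u = 0" for u using in_H[of u] in_H[of 0] by (simp add: Q_def inner_diff_right)
  have ranQ: "range Q = {h. \<nu> \<bullet> h = 0}"
  proof
    show "range Q \<subseteq> {h. \<nu> \<bullet> h = 0}" using nQ by blast
    show "{h. \<nu> \<bullet> h = 0} \<subseteq> range Q"
    proof
      fix h assume "h \<in> {h. \<nu> \<bullet> h = 0}"
      then have "\<phi> 0 + h \<in> H" using in_H[of 0] by (simp add: H_def inner_diff_right inner_add_right)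
      then obtain u where "\<phi> u = \<phi> 0 + h" using ran by (metis rangeE)
      then have "Q u = h" by (simp add: Q_def)
      then show "h \<in> range Q" by blast
    qed
  qed
  have "s \<in> range \<phi>" unfolding ran by (simp add: H_def)
  then have phiy: "\<phi> (inv \<phi> s) = s" by (rule f_inv_into_f)
  define y where "y = inv \<phi> s"
  define \<omega> where "\<omega> = \<phi> -` C"
  have y: "y \<in> \<omega>" "\<phi> y = s" using phiy sC by (auto simp: \<omega>_def y_def)
  have contphi: "continuous_on UNIV \<phi>"
    unfolding phi_fun by (intro continuous_on_add continuous_on_const linear_continuous_on linQ[unfolded linear_conv_bounded_linear])
  have \<omega>: "properly_open_convex \<omega>"
    unfolding properly_open_convex_def
  proof (intro conjI)
    show op: "open \<omega>" unfolding \<omega>_def by (rule open_vimage[OF open_C contphi])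
    show "convex \<omega>"
    proof (rule convexI)
      fix u v :: "real^'m" and a b :: real
      assume uv: "u \<in> \<omega>" "v \<in> \<omega>" "0 \<le> a" "0 \<le> b" "a + b = 1"
      have "a *\<^sub>R \<phi> u + b *\<^sub>R \<phi> v \<in> C" using uv by (intro convexD[OF convex_C]) (auto simp: \<omega>_def)
      also have "a *\<^sub>R \<phi> u + b *\<^sub>R \<phi> v = (a + b) *\<^sub>R o' + Q (a *\<^sub>R u + b *\<^sub>R v)"
        by (simp add: phi_fun linear_add[OF linQ] linear_scale[OF linQ] algebra_simps)
      finally show "a *\<^sub>R u + b *\<^sub>R v \<in> \<omega>" by (simp add: \<omega>_def phi_fun uv(5))
    qed
    show "\<omega> \<noteq> {}" using y by blast
    show "\<not> (\<exists>p v. v \<noteq> 0 \<and> range (\<lambda>t::real. p + t *\<^sub>R v) \<subseteq> \<omega>)"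
    proof clarify
      fix u v :: "real^'m" assume v: "v \<noteq> 0" "range (\<lambda>t::real. u + t *\<^sub>R v) \<subseteq> \<omega>"
      have "Q v \<noteq> 0" using normQ[of v] v(1) by auto
      then obtain t where "\<phi> u + t *\<^sub>R Q v \<notin> C" using no_line by blast
      moreover have "\<phi> (u + t *\<^sub>R v) = \<phi> u + t *\<^sub>R Q v"
        by (simp add: phiQ[of "u + t *\<^sub>R v"] phiQ[of u] linear_add[OF linQ] linear_scale[OF linQ])
      moreover have "\<phi> (u + t *\<^sub>R v) \<in> C" using v(2) by (auto simp: \<omega>_def)
      ultimately show False by simp
    qed
  qed
  \<comment> \<open>\<open>Z\<close> extends the parametrization linearly to homogeneous
    coordinates; \<open>L\<close> collects the numerators \<open>\<chi>' + \<delta> i\<close> and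
    the denominator \<open>\<chi>'\<close>.\<close>
  define Z :: "(real^'m) \<times> real \<Rightarrow> (real^'n) \<times> real" where "Z z = (Q (fst z) + snd z *\<^sub>R \<phi> 0, snd z)" for z
  define L :: "(real^'m) \<times> real \<Rightarrow> (real^'m) \<times> real" where "L z = ((\<chi> i. (\<chi>' + \<delta> i) \<bullet> Z z), \<chi>' \<bullet> Z z)" for z
  have linZ: "linear Z"
    by (rule linearI) (auto simp: Z_def linear_add[OF linQ] linear_scale[OF linQ] algebra_simps)
  have linL: "linear L"
    by (rule linearI) (simp_all add: L_def linear_add[OF linZ] linear_scale[OF linZ] inner_add_right vec_eq_iff)
  have "inj L"
    unfolding linear_injective_0[OF linL]
  proof (intro allI impI)
    fix z assume z: "L z = 0"
    then have c0: "\<chi>' \<bullet> Z z = 0" and d0: "(\<chi>' + \<delta> i) \<bullet> Z z = 0" for i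
      by (simp_all add: L_def zero_prod_def vec_eq_iff)
    then have d0: "\<delta> i \<bullet> Z z = 0" for i using d0[of i] c0 unfolding inner_add_left by linarith
    have "Z z - (\<tau> \<bullet> Z z) *\<^sub>R q = 0"
      by (rule frame_kill; simp only: inner_diff_right inner_scaleR_right c0 d0 chi_q tau_q \<delta>q, simp?)
    then have Zq: "Z z = (\<tau> \<bullet> Z z) *\<^sub>R q" by simp
    \<comment> \<open>\<open>Z\<close> takes values in the kernel of the functional that defines the
      tangent plane, and \<open>q\<close> is outside it.\<close>
    have "(\<nu>, - (\<nu> \<bullet> s)) \<bullet> Z z = 0"
      using in_H[of 0] by (simp add: Z_def inner_add_right nQ inner_diff_right)
    then have "(\<tau> \<bullet> Z z) * ((\<nu>, - (\<nu> \<bullet> s)) \<bullet> q) = 0" by (metis Zq inner_scaleR_right)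
    then have "\<tau> \<bullet> Z z = 0" using piece_transversal[OF \<rho> s n] by simp
    with Zq have Z0: "Z z = 0" by simp
    then have "snd z = 0" "Q (fst z) = 0" by (auto simp: Z_def zero_prod_def)
    then show "z = 0" using normQ[of "fst z"] by (simp add: prod_eq_iff)
  qed
  then have bijL: "bij L" using linear_injective_imp_surjective[OF linL] by (simp add: bij_def)
  have Z1: "Z (u, 1) = (\<phi> u, 1)" for u by (simp add: Z_def phiQ[of u] add.commute)
  have posL: "0 < snd (L (u, 1))" "0 < fst (L (u, 1)) $ i" if "u \<in> \<omega>" for u i
    using that pos_affineD[OF chi_pos] pos_affineD[OF \<delta>pos] by (auto simp: L_def Z1 \<omega>_def)
  define T where "T = (\<lambda>u. fst (L (u, 1)) /\<^sub>R snd (L (u, 1)))"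
  have T: "T u = 1 + proj (\<phi> u)" if "u \<in> \<omega>" for u
  proof (rule vec_eq_iff[THEN iffD2, rule_format])
    fix i
    have "0 < \<chi>' \<bullet> (\<phi> u, 1)" using that pos_affineD[OF chi_pos] by (auto simp: \<omega>_def)
    then show "T u $ i = (1 + proj (\<phi> u)) $ i"
      by (simp add: T_def L_def Z1 proj_def inner_add_left divide_inverse_commute distrib_left)
  qed
  have "(\<phi> has_derivative Q) (at y)"
    unfolding phi_fun using linear_imp_has_derivative[OF linQ] by (auto intro!: derivative_eq_intros)
  then have "(proj \<circ> \<phi> has_derivative secant s s \<circ> Q) (at y)"
    using proj_has_derivative[OF sC] unfolding y(2)[symmetric] by (rule diff_chain_at)
  then have "((\<lambda>u. 1 + proj (\<phi> u)) has_derivative secant s s \<circ> Q) (at y)"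
    by (auto intro!: derivative_eq_intros simp: comp_def)
  then have "(T has_derivative secant s s \<circ> Q) (at y)"
    by (rule has_derivative_transform_within_open[OF _ _ y(1)]) (use \<omega> T in \<open>auto simp: properly_open_convex_def\<close>)
  then have Jac: "Jac T y = \<bar>det (matrix (secant s s \<circ> Q))\<bar>" by (rule Jac_derivative)
  note ge = density_ge_simplex[OF g \<omega> linL bijL posL T_def y(1), unfolded Jac]
  have g0: "0 < g \<omega> y" by (rule proper_density_pos[OF g \<omega> y(1)])
  have "(\<Prod>i\<in>UNIV. T y $ i) \<le> (\<Prod>i\<in>(UNIV::'m set). 2)"
  proof (intro prod_mono conjI)
    fix i
    have Ti: "T y $ i = 1 + proj s $ i" using T[OF y(1)] y(2) by simp
    show "0 \<le> T y $ i" using posL[OF y(1)] by (simp add: T_def less_imp_le)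
    note Y = piece_normalized[OF \<rho> s]
    have "proj s $ i = \<delta> i \<bullet> ((1 / (\<chi>' \<bullet> (s, 1))) *\<^sub>R (s, 1))"
      unfolding inner_scaleR_right by (simp add: proj_def)
    then have "\<bar>proj s $ i\<bar> \<le> \<rho> / (24 * CARD('m))" using Y(2)[of i] by simp
    also have "\<dots> \<le> 1"
    proof -
      have "(1::real) \<le> CARD('m)" by (simp add: Suc_leI)
      then have "\<rho> \<le> 24 * real CARD('m)" using \<rho> by linarith
      then show ?thesis by (simp add: divide_le_eq)
    qed
    finally show "T y $ i \<le> 2" using Ti by linarith
  qed
  then have "g \<omega> y * (\<Prod>i\<in>UNIV. T y $ i) \<le> g \<omega> y * 2 ^ CARD('m)" using g0 by (intro mult_left_mono) auto
  with ge(1) have "g orthant 1 * \<bar>det (matrix (secant s s \<circ> Q))\<bar> \<le> g \<omega> y * 2 ^ CARD('m)" by linarith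
  then have "g orthant 1 / 2 ^ CARD('m) * \<bar>det (matrix (secant s s \<circ> Q))\<bar> \<le> g \<omega> y" by (simp add: field_simps)
  moreover have "area_density g C (hilbert_sphere C x r) s = ennreal (g \<omega> y)"
    by (simp add: area_density_def tang slice_density_def Let_def \<phi>_def[symmetric] \<omega>_def y_def)
  ultimately have "ennreal (g orthant 1 / 2 ^ CARD('m) * \<bar>det (matrix (secant s s \<circ> Q))\<bar>) \<le> area_density g C (hilbert_sphere C x r) s"
    by (simp add: ennreal_leI)
  with ge(2) linQ normQ ranQ show thesis by (intro that[of Q]) auto
qed

end

text \<open>
  A countable cover turns the local minorants into a Borel function; this avoids measurability questions
  about the density itself.
\<close>

lemma integral_minorant_of_local:
  fixes F :: "real^'n \<Rightarrow> real^'m" and dens :: "real^'n \<Rightarrow> ennreal" and k :: ennreal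
  assumes E: "E \<in> sets borel"
    and loc: "\<And>s. s \<in> E \<Longrightarrow> \<exists>d>0. \<exists>v. (\<forall>t\<in>E \<inter> ball s d. v \<le> dens t) \<and>
      (\<forall>X\<subseteq>E \<inter> ball s d. \<exists>G\<in>sets borel. F ` X \<subseteq> G \<and> k * emeasure lborel G \<le> v * hausdorff_outer j X)"
  shows "\<exists>w\<in>borel_measurable borel. (\<forall>s. w s \<le> dens s * indicator E s) \<and>
    (\<exists>G\<in>sets borel. F ` E \<subseteq> G \<and> k * emeasure lborel G \<le> (\<integral>\<^sup>+ s. w s \<partial>hausdorff_measure j))"
proof (cases "E = {}")
  case True
  then show ?thesis by (intro bexI[of _ "\<lambda>_. 0"]) auto
next
  case False
  obtain d v where dv: "\<And>s. s \<in> E \<Longrightarrow> 0 < d s" "\<And>s t. s \<in> E \<Longrightarrow> t \<in> E \<inter> ball s (d s) \<Longrightarrow> v s \<le> dens t"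
    "\<And>s X. s \<in> E \<Longrightarrow> X \<subseteq> E \<inter> ball s (d s) \<Longrightarrow>
       \<exists>G\<in>sets borel. F ` X \<subseteq> G \<and> k * emeasure lborel G \<le> v s * hausdorff_outer j X"
    using loc by metis
  obtain \<F> where F: "\<F> \<subseteq> (\<lambda>s. ball s (d s)) ` E" "countable \<F>" "\<Union>\<F> = \<Union>((\<lambda>s. ball s (d s)) ` E)"
    using Lindelof[of "(\<lambda>s. ball s (d s)) ` E"] by auto
  then obtain D where D: "countable D" "D \<subseteq> E" "\<F> = (\<lambda>s. ball s (d s)) ` D"
    using countable_subset_image[of \<F> "\<lambda>s. ball s (d s)" E] by auto
  have cov: "E \<subseteq> (\<Union>s\<in>D. ball s (d s))"
  proof
    fix t assume "t \<in> E"
    then have "t \<in> \<Union>((\<lambda>s. ball s (d s)) ` E)" using dv(1) by force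
    then show "t \<in> (\<Union>s\<in>D. ball s (d s))" using F(3) D(3) by simp
  qed
  then have "D \<noteq> {}" using False by blast
  define c where "c = from_nat_into D"
  have c: "range c = D" unfolding c_def using \<open>D \<noteq> {}\<close> D(1) by (rule range_from_nat_into)
  then have cE: "c i \<in> E" for i using D(2) by auto
  \<comment> \<open>Disjoint Borel pieces, each inside one of countably many balls; the minorant is
    constant on each of them.\<close>
  define A where "A = disjointed (\<lambda>i. E \<inter> ball (c i) (d (c i)))"
  have Asub: "A i \<subseteq> E \<inter> ball (c i) (d (c i))" for i unfolding A_def by (rule disjointed_subset)
  have UA: "(\<Union>i. A i) = E"
    unfolding A_def UN_disjointed_eq using cov c by (auto simp: image_iff subset_iff)
  have dis: "disjoint_family A" unfolding A_def by (rule disjoint_family_disjointed)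
  have "range (\<lambda>i. E \<inter> ball (c i) (d (c i))) \<subseteq> sets borel" using E by auto
  from sets.range_disjointed_sets[OF this] have Am: "A i \<in> sets borel" for i
    unfolding A_def by blast
  note Am[measurable]
  obtain G where G: "\<And>i. G i \<in> sets borel" "\<And>i. F ` A i \<subseteq> G i"
      "\<And>i. k * emeasure lborel (G i) \<le> v (c i) * hausdorff_outer j (A i)"
    using dv(3)[OF cE Asub] by metis
  define w where "w s = (\<Sum>i. v (c i) * indicator (A i) s)" for s
  have wm: "w \<in> borel_measurable borel" unfolding w_def[abs_def] by measurable
  have "w s \<le> dens s * indicator E s" for s
  proof (cases "s \<in> E")
    case True
    then obtain i where i: "s \<in> A i" using UA by blast
    have "w s = v (c i)" unfolding w_def by (rule suminf_cmult_indicator[OF dis i])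
    also have "\<dots> \<le> dens s" by (rule dv(2)[OF cE]) (use i Asub in blast)
    finally show ?thesis using True by simp
  next
    case False
    then have "indicator (A i) s = (0::ennreal)" for i using UA by (auto simp: indicator_def)
    then show ?thesis by (simp add: w_def)
  qed
  moreover have "k * emeasure lborel (\<Union>i. G i) \<le> (\<integral>\<^sup>+ s. w s \<partial>hausdorff_measure j)"
  proof -
    have "k * emeasure lborel (\<Union>i. G i) \<le> k * (\<Sum>i. emeasure lborel (G i))"
      using G(1) by (intro mult_left_mono emeasure_subadditive_countably) auto
    also have "\<dots> = (\<Sum>i. k * emeasure lborel (G i))" by simp
    also have "\<dots> \<le> (\<Sum>i. v (c i) * hausdorff_outer j (A i))" by (intro suminf_le G(3)) auto
    also have "\<dots> = (\<Sum>i. \<integral>\<^sup>+ s. v (c i) * indicator (A i) s \<partial>hausdorff_measure j)"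
      using Am by (intro suminf_cong) (simp add: nn_integral_cmult_indicator emeasure_hausdorff_measure)
    also have "\<dots> = (\<integral>\<^sup>+ s. w s \<partial>hausdorff_measure j)"
      unfolding w_def by (intro nn_integral_suminf[symmetric]) measurable
    finally show ?thesis .
  qed
  moreover have "F ` E \<subseteq> (\<Union>i. G i)" using G(2) UA by blast
  ultimately show ?thesis using wm G(1) by (intro bexI[of _ w] conjI allI bexI[of _ "\<Union>i. G i"]) auto
qed

section \<open>Area of a piece of the sphere\<close>

context adapted_frame begin

context
  fixes g :: "(real^'m) set \<Rightarrow> real^'m \<Rightarrow> real" and \<rho> :: real
  assumes g: "proper_density g" and \<rho>: "0 < \<rho>" "\<rho> \<le> 1" "\<rho> \<le> r"
begin

text \<open>A factor \<open>2 ^ CARD('m)\<close> is lost in the simplex bound, another one by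
  semicontinuity of the Jacobian, which makes the minorant \<open>v\<close> constant near
  \<open>s\<close>, and \<open>4 ^ CARD('m)\<close> in the covering; together they give
  \<open>16 ^ CARD('m)\<close>. The Jacobian at \<open>s\<close> cancels.\<close>

lemma area_density_local:
  assumes s: "s \<in> piece \<rho>" "\<exists>!\<nu>. unit_normal (closed_ball x r) s \<nu>"
    and E: "\<And>t. t \<in> E \<Longrightarrow> t \<in> piece \<rho>" "\<And>t. t \<in> E \<Longrightarrow> \<exists>!\<nu>. unit_normal (closed_ball x r) t \<nu>"
  shows "\<exists>d>0. \<exists>v. (\<forall>t\<in>E \<inter> ball s d. v \<le> area_density g C (hilbert_sphere C x r) t) \<and>
    (\<forall>X\<subseteq>E \<inter> ball s d. \<exists>G\<in>sets borel. proj ` X \<subseteq> G \<and>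
       ennreal (g orthant 1 / 16 ^ CARD('m)) * emeasure lborel G \<le> v * hausdorff_outer CARD('m) X)"
proof -
  interpret K: convex_body "closed_ball x r" by (rule convex_body_closed_ball)
  note fr = frontier_closed_ball[OF x r]
  have sC: "s \<in> C" using s(1) by (auto simp: piece_def hilbert_sphere_def)
  have EF: "E \<subseteq> frontier (closed_ball x r)" unfolding fr by (auto dest!: E(1) simp: piece_def)
  obtain \<nu> where n: "unit_normal (closed_ball x r) s \<nu>" and uniq: "\<And>\<nu>'. unit_normal (closed_ball x r) s \<nu>' \<Longrightarrow> \<nu>' = \<nu>"
    using s(2) by blast
  have n1: "norm \<nu> = 1" using n by (simp add: unit_normal_def)
  let ?J = "\<lambda>t Q. \<bar>det (matrix (secant t t \<circ> Q))\<bar>"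
  obtain Q :: "real^'m \<Rightarrow> real^'n" where Q: "linear Q" "\<forall>h. norm (Q h) = norm h" "range Q = {h. \<nu> \<bullet> h = 0}"
    "det (matrix (secant s s \<circ> Q)) \<noteq> 0"
    by (rule area_density_ge[OF g \<rho> s(1) n uniq]) blast
  have ran: "h \<in> range Q" if "\<nu> \<bullet> h = 0" for h using Q(3) that by simp
  have g1: "0 < g orthant 1"
    by (rule proper_density_pos[OF g properly_open_convex_orthant]) (simp add: orthant_def)
  obtain e where e: "e > 0" and lsc: "\<And>A' Q'. linear A' \<Longrightarrow> linear Q' \<Longrightarrow> (\<forall>h. norm (Q' h) = norm h) \<Longrightarrow>
     (\<forall>h. \<bar>\<nu> \<bullet> Q' h\<bar> \<le> e * norm h) \<Longrightarrow> (\<forall>h. norm (A' h - secant s s h) \<le> e * norm h) \<Longrightarrow>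
     ?J s Q \<le> 2 ^ CARD('m) * \<bar>det (matrix (A' \<circ> Q'))\<bar>"
    using jacobian_lower_semicontinuous[OF n1 Q(1) Q(2)[rule_format] ran linear_secant Q(4)] by blast
  obtain d1 where d1: "d1 > 0" "\<And>t \<mu>. t \<in> frontier (closed_ball x r) \<inter> ball s d1 \<Longrightarrow> unit_normal (closed_ball x r) t \<mu> \<Longrightarrow> norm (\<mu> - \<nu>) < e"
    using K.normals_near[OF uniq e] by blast
  obtain d2 where d2: "d2 > 0" "\<And>a b h. a \<in> ball s d2 \<Longrightarrow> b \<in> ball s d2 \<Longrightarrow> norm (secant a b h - secant s s h) \<le> e * norm h"
    using secant_near[OF sC e] by blast
  have "\<exists>d>0. \<forall>X\<subseteq>E \<inter> ball s d. \<exists>G\<in>sets borel. proj ` X \<subseteq> G \<and>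
    emeasure lborel G \<le> ennreal (4 ^ CARD('m) * ?J s Q) * hausdorff_outer CARD('m) X"
  proof (rule local_area_inequality[OF n1 Q(1) Q(2)[rule_format] ran linear_secant Q(4)])
    fix e :: real assume e: "e > 0"
    show "\<exists>d>0. \<forall>p\<in>E \<inter> ball s d. \<forall>q\<in>E \<inter> ball s d. \<bar>\<nu> \<bullet> (p - q)\<bar> \<le> e * norm (p - q)"
      using K.frontier_flat[OF uniq e] EF by blast
    show "\<exists>d>0. \<forall>p\<in>E \<inter> ball s d. \<forall>q\<in>E \<inter> ball s d. norm (proj p - proj q - secant s s (p - q)) \<le> e * norm (p - q)"
      using proj_strict[OF sC e] by blast
  qed
  then obtain d3 where d3: "d3 > 0" "\<And>X. X \<subseteq> E \<inter> ball s d3 \<Longrightarrow> \<exists>G\<in>sets borel. proj ` X \<subseteq> G \<and>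
    emeasure lborel G \<le> ennreal (4 ^ CARD('m) * ?J s Q) * hausdorff_outer CARD('m) X"
    by blast
  define d where "d = min d1 (min d2 d3)"
  define v where "v = ennreal (g orthant 1 / 4 ^ CARD('m) * ?J s Q)"
  have "v \<le> area_density g C (hilbert_sphere C x r) t" if t: "t \<in> E \<inter> ball s d" for t
  proof -
    have tp: "t \<in> piece \<rho>" and td: "t \<in> ball s d1" "t \<in> ball s d2" using t E(1) by (auto simp: d_def)
    obtain \<mu> where m: "unit_normal (closed_ball x r) t \<mu>" and mu: "\<And>\<nu>'. unit_normal (closed_ball x r) t \<nu>' \<Longrightarrow> \<nu>' = \<mu>"
      using E(2)[of t] t by blast
    obtain Q' :: "real^'m \<Rightarrow> real^'n" where Q': "linear Q'" "\<forall>h. norm (Q' h) = norm h" "range Q' = {h. \<mu> \<bullet> h = 0}"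
        "ennreal (g orthant 1 / 2 ^ CARD('m) * ?J t Q') \<le> area_density g C (hilbert_sphere C x r) t"
      by (rule area_density_ge[OF g \<rho> tp m mu]) blast
    have near: "norm (\<mu> - \<nu>) < e" using d1(2)[of t \<mu>] t td m EF by blast
    have "\<bar>\<nu> \<bullet> Q' h\<bar> \<le> e * norm h" for h
    proof -
      have "\<mu> \<bullet> Q' h = 0" using Q'(3) by blast
      then have "\<bar>\<nu> \<bullet> Q' h\<bar> = \<bar>(\<mu> - \<nu>) \<bullet> Q' h\<bar>" by (simp add: inner_diff_left)
      also have "\<dots> \<le> norm (\<mu> - \<nu>) * norm (Q' h)" by (rule Cauchy_Schwarz_ineq2)
      also have "\<dots> \<le> e * norm h" unfolding Q'(2)[rule_format] using near by (intro mult_right_mono) auto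
      finally show ?thesis .
    qed
    then have J: "?J s Q \<le> 2 ^ CARD('m) * ?J t Q'" using d2(2) td Q'(1,2) by (intro lsc linear_secant) auto
    have "(4::real) ^ CARD('m) = 2 ^ CARD('m) * 2 ^ CARD('m)" by (simp flip: power_mult_distrib)
    then have "g orthant 1 / 4 ^ CARD('m) * ?J s Q = g orthant 1 / 2 ^ CARD('m) * (?J s Q / 2 ^ CARD('m))" by simp
    also have "\<dots> \<le> g orthant 1 / 2 ^ CARD('m) * ?J t Q'"
      using g1 J by (intro mult_left_mono) (auto simp: divide_le_eq mult.commute)
    finally show ?thesis unfolding v_def using Q'(4) by (meson ennreal_leI order_trans)
  qed
  moreover have "\<exists>G\<in>sets borel. proj ` X \<subseteq> G \<and>
       ennreal (g orthant 1 / 16 ^ CARD('m)) * emeasure lborel G \<le> v * hausdorff_outer CARD('m) X"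
    if X: "X \<subseteq> E \<inter> ball s d" for X
  proof -
    have "X \<subseteq> E \<inter> ball s d3" using X by (auto simp: d_def)
    from d3(2)[OF this] obtain G where G: "G \<in> sets borel" "proj ` X \<subseteq> G"
      "emeasure lborel G \<le> ennreal (4 ^ CARD('m) * ?J s Q) * hausdorff_outer CARD('m) X" by blast
    have "(16::real) ^ CARD('m) = 4 ^ CARD('m) * 4 ^ CARD('m)" by (simp flip: power_mult_distrib)
    then have eq: "g orthant 1 / 16 ^ CARD('m) * (4 ^ CARD('m) * ?J s Q) = g orthant 1 / 4 ^ CARD('m) * ?J s Q" by simp
    have "ennreal (g orthant 1 / 16 ^ CARD('m)) * emeasure lborel G
        \<le> ennreal (g orthant 1 / 16 ^ CARD('m)) * (ennreal (4 ^ CARD('m) * ?J s Q) * hausdorff_outer CARD('m) X)"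
      by (intro mult_left_mono G(3)) simp
    also have "\<dots> = v * hausdorff_outer CARD('m) X"
    proof -
      have "ennreal (g orthant 1 / 16 ^ CARD('m)) * ennreal (4 ^ CARD('m) * ?J s Q) = v"
        unfolding v_def eq[symmetric] by (rule ennreal_mult[symmetric]) (use g1 in auto)
      then show ?thesis by (simp only: mult.assoc[symmetric])
    qed
    finally show ?thesis using G(1,2) by blast
  qed
  moreover have "d > 0" using d1(1) d2(1) d3(1) by (simp add: d_def)
  ultimately show ?thesis by blast
qed

lemma closed_piece: "closed (piece \<rho>)"
proof -
  have "closed (hilbert_sphere C x r)" unfolding frontier_closed_ball[OF x r, symmetric] by simp
  moreover have "piece \<rho> = hilbert_sphere C x r \<inter>
     ((\<Inter>i. {s. \<bar>\<delta> i \<bullet> (s, 1)\<bar> \<le> \<rho> / (24 * CARD('m)) * (\<chi>' \<bullet> (s, 1))}) \<inter>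
     {s. \<bar>\<tau> \<bullet> (s, 1)\<bar> \<le> \<rho> / 6 * (\<chi>' \<bullet> (s, 1))})"
    by (auto simp: piece_def)
  moreover have "closed {s. \<bar>\<zeta> \<bullet> (s, 1)\<bar> \<le> c * (\<chi>' \<bullet> (s, 1))}" for c :: real and \<zeta> :: "(real^'n) \<times> real"
    by (intro closed_Collect_le continuous_intros)
  ultimately show ?thesis by (simp only:) (intro closed_Int closed_INT ballI)
qed

text \<open>A Borel minorant \<open>w\<close> is exported rather than an integral bound, so that the
  contributions of several pieces can be added under the integral. Singular points are removed
  together with the whole preimage of a Borel null set containing their projections, which leaves a
  Borel set.\<close>

lemma area_lower_bound_piece:
  "\<exists>w\<in>borel_measurable borel. (\<forall>s. w s \<le> area_density g C (hilbert_sphere C x r) s * indicator (hilbert_sphere C x r \<inter> hilbert_ball C p \<rho>) s) \<and>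
    ennreal (g orthant 1 / 16 ^ CARD('m) * (\<rho> / (12 * CARD('m))) ^ CARD('m)) \<le> (\<integral>\<^sup>+ s. w s \<partial>hausdorff_measure CARD('m))"
proof -
  let ?\<eta> = "\<rho> / (24 * CARD('m))"
  let ?bad = "{s \<in> frontier (closed_ball x r) \<inter> C. \<not> (\<exists>!\<nu>. unit_normal (closed_ball x r) s \<nu>)}"
  have "negligible (proj ` ?bad)"
    by (rule singular_points_negligible[OF convex_body_closed_ball dim proj_lipschitz])
  then have "proj ` ?bad \<in> null_sets (completion lborel)" by (simp add: negligible_iff_null_sets)
  then obtain G0 where G0: "G0 \<in> null_sets lborel" "proj ` ?bad \<subseteq> G0"
    unfolding null_sets_completion_iff2 by blast
  have G0m: "G0 \<in> sets borel" using G0(1) by (simp add: null_sets_def)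
  have pC: "piece \<rho> \<subseteq> C" by (auto simp: piece_def hilbert_sphere_def)
  define E where "E = {s \<in> piece \<rho>. proj s \<notin> G0}"
  have E: "E \<in> sets borel"
  proof -
    have "proj \<in> borel_measurable (restrict_space borel C)"
      by (rule borel_measurable_continuous_on_restrict[OF continuous_on_proj])
    from measurable_sets[OF this G0m] have "proj -` G0 \<inter> C \<in> sets (restrict_space borel C)"
      by (simp add: space_restrict_space)
    then have "proj -` G0 \<inter> C \<in> sets borel" using open_C by (simp add: sets_restrict_space_iff)
    moreover have "E = piece \<rho> - (proj -` G0 \<inter> C)" using pC by (auto simp: E_def)
    ultimately show ?thesis using closed_piece by auto
  qed
  have good: "\<exists>!\<nu>. unit_normal (closed_ball x r) s \<nu>" if "s \<in> E" for s
  proof (rule ccontr)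
    assume "\<not> ?thesis"
    moreover have "s \<in> frontier (closed_ball x r)" "s \<in> C"
      using that pC unfolding frontier_closed_ball[OF x r] by (auto simp: E_def piece_def)
    ultimately have "proj s \<in> G0" using G0(2) by blast
    with that show False by (simp add: E_def)
  qed
  define k where "k = ennreal (g orthant 1 / 16 ^ CARD('m))"
  have loc: "\<exists>d>0. \<exists>v. (\<forall>t\<in>E \<inter> ball s d. v \<le> area_density g C (hilbert_sphere C x r) t) \<and>
      (\<forall>X\<subseteq>E \<inter> ball s d. \<exists>G\<in>sets borel. proj ` X \<subseteq> G \<and> k * emeasure lborel G \<le> v * hausdorff_outer CARD('m) X)"
    if "s \<in> E" for s
  proof -
    have piece: "t \<in> piece \<rho>" if "t \<in> E" for t using that by (simp add: E_def)
    show ?thesis unfolding k_def by (rule area_density_local[OF piece[OF that] good[OF that] piece good])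
  qed
  obtain w G where w: "w \<in> borel_measurable borel" "\<And>s. w s \<le> area_density g C (hilbert_sphere C x r) s * indicator E s"
    and G: "G \<in> sets borel" "proj ` E \<subseteq> G" "k * emeasure lborel G \<le> (\<integral>\<^sup>+ s. w s \<partial>hausdorff_measure CARD('m))"
    using integral_minorant_of_local[where F = proj and dens = "area_density g C (hilbert_sphere C x r)", OF E loc] by blast
  have "w s \<le> area_density g C (hilbert_sphere C x r) s * indicator (hilbert_sphere C x r \<inter> hilbert_ball C p \<rho>) s" for s
  proof -
    have "E \<subseteq> hilbert_sphere C x r \<inter> hilbert_ball C p \<rho>" using piece_subset_ball[OF \<rho>] by (auto simp: E_def)
    then have "area_density g C (hilbert_sphere C x r) s * indicator E s \<le> area_density g C (hilbert_sphere C x r) s * indicator (hilbert_sphere C x r \<inter> hilbert_ball C p \<rho>) s"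
      by (intro mult_left_mono) (auto simp: indicator_def)
    with w(2) show ?thesis by (rule order_trans)
  qed
  moreover have "ennreal (g orthant 1 / 16 ^ CARD('m) * (\<rho> / (12 * CARD('m))) ^ CARD('m)) \<le> k * emeasure lborel G"
  proof -
    let ?B = "cbox (\<chi> i. - ?\<eta>) (\<chi> i. ?\<eta>) :: (real^'m) set"
    \<comment> \<open>The piece projects onto a set containing the box, and removing the singular
      points costs only the null set \<open>G0\<close>.\<close>
    have "?B \<subseteq> G \<union> G0"
    proof
      fix u assume "u \<in> ?B"
      then have "\<bar>u $ i\<bar> \<le> ?\<eta>" for i by (auto simp: mem_box_cart abs_le_iff minus_le_iff)
      then obtain s where "s \<in> piece \<rho>" "u = proj s" using box_subset_proj[OF \<rho>, of u] by blast
      then show "u \<in> G \<union> G0" using G(2) by (auto simp: E_def)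
    qed
    then have "emeasure lborel ?B \<le> emeasure lborel (G \<union> G0)" using G(1) G0m by (intro emeasure_mono) auto
    also have "\<dots> = emeasure lborel G" using G(1) G0(1) by (intro emeasure_Un_null_set) auto
    finally have 1: "emeasure lborel ?B \<le> emeasure lborel G" .
    have B: "emeasure lborel ?B = ennreal ((\<rho> / (12 * CARD('m))) ^ CARD('m))"
    proof -
      have "0 \<le> ?\<eta>" using \<rho> by simp
      then have "measure lborel ?B = (\<Prod>i\<in>(UNIV::'m set). ?\<eta> - - ?\<eta>)"
        using content_cbox_cart[of "\<chi> i. - ?\<eta>" "\<chi> i. ?\<eta> :: real ^ 'm"] by (auto simp: interval_ne_empty_cart)
      also have "?\<eta> - - ?\<eta> = \<rho> / (12 * CARD('m))" by simp
      finally show ?thesis by (simp add: emeasure_eq_ennreal_measure[OF less_imp_neq[OF emeasure_lborel_cbox_finite[unfolded infinity_ennreal_def]]])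
    qed
    have "ennreal (g orthant 1 / 16 ^ CARD('m) * (\<rho> / (12 * CARD('m))) ^ CARD('m)) = k * emeasure lborel ?B"
      unfolding k_def B by (rule ennreal_mult'') (use \<rho> in simp)
    also have "\<dots> \<le> k * emeasure lborel G" using 1 by (rule mult_left_mono) simp
    finally show ?thesis .
  qed
  ultimately show ?thesis using w(1) G(3) by (meson order_trans)
qed

end

end

section \<open>Lower bounds for volume and area\<close>

lemma emeasure_hilbert_measure:
  assumes f: "proper_density f" and C: "properly_open_convex C" and A: "A \<in> sets borel" "A \<subseteq> C"
  shows "emeasure (hilbert_measure f C) A = (\<integral>\<^sup>+ y\<in>A. ennreal (f C y) \<partial>lborel)"
proof -
  have Cm: "C \<inter> space lborel \<in> sets lborel" using C by (simp add: properly_open_convex_def)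
  have "f C \<in> borel_measurable (restrict_space borel C)"
    by (rule borel_measurable_continuous_on_restrict[OF proper_density_continuous[OF f C]])
  then have "f C \<in> borel_measurable (restrict_space lborel C)"
    by (simp cong: measurable_cong_sets sets_restrict_space_cong add: measurable_def space_restrict_space sets_restrict_space)
  then have "(\<lambda>y. ennreal (f C y)) \<in> borel_measurable (restrict_space lborel C)" by simp
  moreover have "A \<in> sets (restrict_space lborel C)" using A Cm by (simp add: sets_restrict_space_iff)
  ultimately have "emeasure (hilbert_measure f C) A = (\<integral>\<^sup>+ y. ennreal (f C y) * indicator A y \<partial>restrict_space lborel C)"
    unfolding hilbert_measure_def by (rule emeasure_density)
  also have "\<dots> = (\<integral>\<^sup>+ y. ennreal (f C y) * indicator A y * indicator C y \<partial>lborel)"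
    by (rule nn_integral_restrict_space[OF Cm])
  also have "\<dots> = (\<integral>\<^sup>+ y\<in>A. ennreal (f C y) \<partial>lborel)"
    using A(2) by (intro nn_integral_cong) (auto simp: indicator_def)
  finally show ?thesis .
qed

text \<open>\<open>N\<close> levels at spacing \<open>a\<close> need only the length
  \<open>a * (N - 1)\<close>, so one of them fits even when \<open>a\<close> exceeds
  \<open>R\<close>.\<close>

lemma packing_number_exists:
  fixes R a :: real
  assumes "0 \<le> R" "0 < a"
  obtains N :: nat where "a * (real N - 1) \<le> R" "R \<le> a * real N"
proof
  let ?N = "nat \<lfloor>R / a\<rfloor> + 1"
  have N: "real ?N = of_int \<lfloor>R / a\<rfloor> + 1" using assms by simp
  have "of_int \<lfloor>R / a\<rfloor> \<le> R / a" by simp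
  then show "a * (real ?N - 1) \<le> R" unfolding N using assms by (simp add: le_divide_eq mult.commute)
  have "R / a \<le> of_int \<lfloor>R / a\<rfloor> + 1" by linarith
  then have "R \<le> (of_int \<lfloor>R / a\<rfloor> + 1) * a" by (simp only: pos_divide_le_eq[OF assms(2)])
  then show "R \<le> a * real ?N" unfolding N by (simp only: mult.commute)
qed

context properly_convex begin

lemma separated_balls_disjoint:
  assumes "p \<in> C" "q \<in> C" "2 * \<rho> \<le> hilbert_dist C p q"
  shows "hilbert_ball C p \<rho> \<inter> hilbert_ball C q \<rho> = {}"
proof -
  have False if "y \<in> C" "hilbert_dist C p y < \<rho>" "hilbert_dist C q y < \<rho>" for y
    using hilbert_dist_triangle[OF assms(1) that(1) assms(2)] hilbert_dist_sym[of q y] assms(3) that(2,3) by linarith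
  then show ?thesis by (auto simp: hilbert_ball_def)
qed

end

text \<open>Centres are packed in the closed ball of radius \<open>r / 2\<close>, and the balls of
  radius \<open>\<rho>\<close> around them stay inside the large one. With
  \<open>n = CARD('n)\<close>, one has \<open>N \<ge> r / (8 * \<rho> * n)\<close>, and each ball
  contributes a multiple of \<open>(\<rho> / (4 * n)) ^ n\<close>; this gives the \<open>32\<close>
  and the square of the dimension.\<close>

lemma volume_lower_bound:
  fixes f :: "(real^'n) set \<Rightarrow> real^'n \<Rightarrow> real"
  assumes f: "proper_density f" and C: "properly_open_convex C" and x: "x \<in> C" and r: "0 \<le> r"
  shows "ennreal (f orthant 1 / (32 * CARD('n)\<^sup>2) ^ CARD('n) * r ^ CARD('n)) \<le> emeasure (hilbert_measure f C) (hilbert_ball C x r)"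
proof (cases "r = 0")
  case True
  then show ?thesis by (simp add: zero_power)
next
  case False
  interpret properly_convex C by unfold_locales (rule C)
  define n where "n = real CARD('n)"
  have n: "n > 0" by (simp add: n_def)
  \<comment> \<open>At most 1 for \<open>local_volume\<close>, and at most \<open>r / 2\<close> to
    leave room for the centres.\<close>
  define \<rho> where "\<rho> = min 1 (r / 2)"
  have \<rho>: "0 < \<rho>" "\<rho> \<le> 1" "\<rho> \<le> r / 2" using False r by (auto simp: \<rho>_def)
  have f1: "0 < f orthant 1"
    by (rule proper_density_pos[OF f properly_open_convex_orthant]) (simp add: orthant_def)
  have "0 \<le> r / 2" "0 < 4 * \<rho> * n" using r \<rho>(1) n by simp_all
  then obtain N :: nat where N: "4 * \<rho> * n * (real N - 1) \<le> r / 2" "r / 2 \<le> 4 * \<rho> * n * real N"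
    by (rule packing_number_exists)
  have "\<exists>P. P \<subseteq> {y \<in> C. hilbert_dist C x y \<le> r / 2} \<inter> UNIV \<and> finite P \<and> card P = N ^ CARD('n) \<and>
      (\<forall>p\<in>P. \<forall>q\<in>P. p \<noteq> q \<longrightarrow> 2 * \<rho> \<le> hilbert_dist C p q)"
  proof (rule packing[where k = 0 and R = "r / 2" and y = x and x = x])
    show "hilbert_dist C x x + 2 * (2 * \<rho>) * real CARD('n) * (real N - 1) \<le> r / 2"
      using N(1) by (simp add: n_def)
  qed (use x \<rho> in \<open>auto simp: aff_dim_UNIV\<close>)
  then obtain P where P: "P \<subseteq> {y \<in> C. hilbert_dist C x y \<le> r / 2}" "finite P" "card P = N ^ CARD('n)"
      "\<And>p q. p \<in> P \<Longrightarrow> q \<in> P \<Longrightarrow> p \<noteq> q \<Longrightarrow> 2 * \<rho> \<le> hilbert_dist C p q"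
    by auto
  have PC: "p \<in> C" if "p \<in> P" for p using P(1) that by blast
  have Cm: "C \<inter> space lborel \<in> sets lborel" using open_C by simp
  have sets_ball: "hilbert_ball C p s \<in> sets (hilbert_measure f C)" if "p \<in> C" for p s
    using open_hilbert_ball[OF that, of s] Cm
    by (simp add: hilbert_measure_def sets_restrict_space_iff) (auto simp: hilbert_ball_def)
  let ?c = "f orthant 1 * (\<rho> / (4 * n)) ^ CARD('n)"
  have each: "ennreal ?c \<le> emeasure (hilbert_measure f C) (hilbert_ball C p \<rho>)" if "p \<in> P" for p
  proof -
    have "hilbert_ball C p \<rho> \<in> sets borel" using open_hilbert_ball[OF PC[OF that]] by simp
    then show ?thesis
      using local_volume[OF f C PC[OF that] \<rho>(1,2)]
      by (subst emeasure_hilbert_measure[OF f C]) (auto simp: hilbert_ball_def n_def)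
  qed
  have "f orthant 1 / (32 * (CARD('n))\<^sup>2) ^ CARD('n) * r ^ CARD('n) = f orthant 1 * ((r / 2) / (4 * \<rho> * n) * (\<rho> / (4 * n))) ^ CARD('n)"
  proof -
    have "(r / 2) / (4 * \<rho> * n) * (\<rho> / (4 * n)) = r / (32 * (CARD('n))\<^sup>2)"
      using \<rho>(1) by (simp add: n_def power2_eq_square)
    then show ?thesis by (simp add: power_divide)
  qed
  also have "\<dots> \<le> f orthant 1 * (real N * (\<rho> / (4 * n))) ^ CARD('n)"
    using f1 \<rho> n r N(2) by (intro mult_left_mono power_mono mult_right_mono) (auto simp: divide_le_eq mult.commute)
  also have "\<dots> = real (card P) * ?c" by (simp only: P(3) of_nat_power power_mult_distrib mult_ac)
  finally have "ennreal (f orthant 1 / (32 * (CARD('n))\<^sup>2) ^ CARD('n) * r ^ CARD('n)) \<le> ennreal (real (card P) * ?c)"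
    by (rule ennreal_leI)
  also have "\<dots> = of_nat (card P) * ennreal ?c" by (simp only: ennreal_mult'[OF of_nat_0_le_iff] ennreal_of_nat_eq_real_of_nat)
  also have "\<dots> = (\<Sum>p\<in>P. ennreal ?c)" by simp
  also have "\<dots> \<le> (\<Sum>p\<in>P. emeasure (hilbert_measure f C) (hilbert_ball C p \<rho>))" by (intro sum_mono each)
  also have "\<dots> = emeasure (hilbert_measure f C) (\<Union>p\<in>P. hilbert_ball C p \<rho>)"
  proof (rule sum_emeasure)
    show "(\<lambda>p. hilbert_ball C p \<rho>) ` P \<subseteq> sets (hilbert_measure f C)" using sets_ball PC by blast
    show "disjoint_family_on (\<lambda>p. hilbert_ball C p \<rho>) P"
      unfolding disjoint_family_on_def using separated_balls_disjoint PC P(4) by blast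
  qed (rule P(2))
  also have "\<dots> \<le> emeasure (hilbert_measure f C) (hilbert_ball C x r)"
  proof (rule emeasure_mono[OF _ sets_ball[OF x]])
    show "(\<Union>p\<in>P. hilbert_ball C p \<rho>) \<subseteq> hilbert_ball C x r"
    proof
      fix y assume "y \<in> (\<Union>p\<in>P. hilbert_ball C p \<rho>)"
      then obtain p where p: "p \<in> P" "y \<in> C" "hilbert_dist C p y < \<rho>" by (auto simp: hilbert_ball_def)
      have "hilbert_dist C x p \<le> r / 2" using p(1) P(1) by blast
      then have "hilbert_dist C x y < r"
        using hilbert_dist_triangle[OF x PC[OF p(1)] p(2)] p(3) \<rho>(3) by linarith
      then show "y \<in> hilbert_ball C x r" using p(2) by (simp add: hilbert_ball_def)
    qed
  qed
  finally show ?thesis .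
qed

text \<open>One dimension is used up by the sphere: slicing stops at lines, which meet the sphere
  when they contain a point of the ball. With \<open>m = CARD('m)\<close>, one has
  \<open>N \<ge> r / (4 * \<rho> * m)\<close>, and each piece contributes a multiple of
  \<open>(\<rho> / (12 * m)) ^ m / 16 ^ m\<close>; so \<open>768 = 16 * 4 * 12\<close>.\<close>

lemma area_lower_bound:
  fixes g :: "(real^'m) set \<Rightarrow> real^'m \<Rightarrow> real" and C :: "(real^'n) set"
  assumes dim: "CARD('n) = CARD('m) + 1" and g: "proper_density g" and C: "properly_open_convex C"
    and x: "x \<in> C" and r: "0 \<le> r"
  shows "ennreal (g orthant 1 / (768 * CARD('m)\<^sup>2) ^ CARD('m) * r ^ CARD('m)) \<le> hilbert_area g C (hilbert_sphere C x r)"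
proof (cases "r = 0")
  case True
  then show ?thesis by (simp add: zero_power)
next
  case False
  interpret properly_convex C by unfold_locales (rule C)
  define n where "n = real CARD('m)"
  have n: "n > 0" by (simp add: n_def)
  define \<rho> where "\<rho> = min 1 r"
  have \<rho>: "0 < \<rho>" "\<rho> \<le> 1" "\<rho> \<le> r" and r0: "0 < r" using False r by (auto simp: \<rho>_def)
  have g1: "0 < g orthant 1"
    by (rule proper_density_pos[OF g properly_open_convex_orthant]) (simp add: orthant_def)
  let ?S = "hilbert_sphere C x r"
  have "0 < 4 * \<rho> * n" using \<rho>(1) n by simp
  with r obtain N :: nat where N: "4 * \<rho> * n * (real N - 1) \<le> r" "r \<le> 4 * \<rho> * n * real N"
    by (rule packing_number_exists)
  have "\<exists>P. P \<subseteq> ?S \<inter> UNIV \<and> finite P \<and> card P = N ^ CARD('m) \<and>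
      (\<forall>p\<in>P. \<forall>q\<in>P. p \<noteq> q \<longrightarrow> 2 * \<rho> \<le> hilbert_dist C p q)"
  proof (rule packing[where k = 1 and R = r and y = x and x = x])
    show "hilbert_dist C x x + 2 * (2 * \<rho>) * real CARD('m) * (real N - 1) \<le> r"
      using N(1) by (simp add: n_def)
    show "?S \<inter> M \<noteq> {}" if "affine M" "aff_dim M = int 1" "y \<in> M" "y \<in> C" "hilbert_dist C x y \<le> r" for M y
      using that by (intro hilbert_sphere_meets[OF x]) auto
    show "?S \<subseteq> C" by (auto simp: hilbert_sphere_def)
  qed (use x \<rho> dim in \<open>auto simp: aff_dim_UNIV\<close>)
  then obtain P where P: "P \<subseteq> ?S" "finite P" "card P = N ^ CARD('m)"
      "\<And>p q. p \<in> P \<Longrightarrow> q \<in> P \<Longrightarrow> p \<noteq> q \<Longrightarrow> 2 * \<rho> \<le> hilbert_dist C p q"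
    by auto
  have PC: "p \<in> C" "hilbert_dist C x p = r" if "p \<in> P" for p using P(1) that by (auto simp: hilbert_sphere_def)
  let ?c = "g orthant 1 / 16 ^ CARD('m) * (\<rho> / (12 * CARD('m))) ^ CARD('m)"
  have "\<exists>w\<in>borel_measurable borel. (\<forall>s. w s \<le> area_density g C ?S s * indicator (?S \<inter> hilbert_ball C p \<rho>) s) \<and>
    ennreal ?c \<le> (\<integral>\<^sup>+ s. w s \<partial>hausdorff_measure CARD('m))" if pP: "p \<in> P" for p
  proof -
    obtain \<alpha> \<beta> q and \<delta> :: "'m \<Rightarrow> (real^'n) \<times> real" where "adapted_frame C x p r \<alpha> \<beta> q \<delta>"
      by (rule adapted_frame_exists[OF C dim x PC[OF pP] r0])
    then interpret F: adapted_frame C x p r \<alpha> \<beta> q \<delta> "(1/2) *\<^sub>R (\<alpha> + \<beta>)" "(1/2) *\<^sub>R (\<alpha> - \<beta>)" by simp_all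
    show ?thesis by (rule F.area_lower_bound_piece[OF g \<rho>])
  qed
  then obtain w where w: "\<And>p. p \<in> P \<Longrightarrow> w p \<in> borel_measurable borel"
      "\<And>p s. p \<in> P \<Longrightarrow> w p s \<le> area_density g C ?S s * indicator (?S \<inter> hilbert_ball C p \<rho>) s"
      "\<And>p. p \<in> P \<Longrightarrow> ennreal ?c \<le> (\<integral>\<^sup>+ s. w p s \<partial>hausdorff_measure CARD('m))"
    by metis
  have "g orthant 1 / (768 * (CARD('m))\<^sup>2) ^ CARD('m) * r ^ CARD('m) = g orthant 1 / 16 ^ CARD('m) * (r / (4 * \<rho> * n) * (\<rho> / (12 * CARD('m)))) ^ CARD('m)"
  proof -
    have e1: "r / (4 * \<rho> * n) * (\<rho> / (12 * CARD('m))) = r / (48 * (real CARD('m))\<^sup>2)"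
      using \<rho>(1) by (simp add: n_def power2_eq_square)
    have e2: "(768 :: real) ^ CARD('m) = 16 ^ CARD('m) * 48 ^ CARD('m)"
      by (simp flip: power_mult_distrib)
    show ?thesis unfolding e1 by (simp add: e2 power_divide power_mult_distrib)
  qed
  also have "\<dots> \<le> g orthant 1 / 16 ^ CARD('m) * (real N * (\<rho> / (12 * CARD('m)))) ^ CARD('m)"
    using g1 \<rho> n r N(2) by (intro mult_left_mono power_mono mult_right_mono) (auto simp: divide_le_eq mult.commute)
  also have "\<dots> = real (card P) * ?c" by (simp only: P(3) of_nat_power power_mult_distrib mult_ac)
  finally have "ennreal (g orthant 1 / (768 * (CARD('m))\<^sup>2) ^ CARD('m) * r ^ CARD('m)) \<le> ennreal (real (card P) * ?c)"
    by (rule ennreal_leI)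
  also have "\<dots> = of_nat (card P) * ennreal ?c" by (simp only: ennreal_mult'[OF of_nat_0_le_iff] ennreal_of_nat_eq_real_of_nat)
  also have "\<dots> = (\<Sum>p\<in>P. ennreal ?c)" by simp
  also have "\<dots> \<le> (\<Sum>p\<in>P. \<integral>\<^sup>+ s. w p s \<partial>hausdorff_measure CARD('m))" by (intro sum_mono w(3))
  also have "\<dots> = (\<integral>\<^sup>+ s. (\<Sum>p\<in>P. w p s) \<partial>hausdorff_measure CARD('m))"
    using w(1) by (intro nn_integral_sum[symmetric]) simp
  finally have le: "ennreal (g orthant 1 / (768 * (CARD('m))\<^sup>2) ^ CARD('m) * r ^ CARD('m)) \<le>
    (\<integral>\<^sup>+ s. (\<Sum>p\<in>P. w p s) \<partial>hausdorff_measure CARD('m))" .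
  \<comment> \<open>Disjointness of the balls keeps the sum of the minorants below the density on
    the sphere.\<close>
  have disjoint: "disjoint_family_on (\<lambda>p. ?S \<inter> hilbert_ball C p \<rho>) P"
    unfolding disjoint_family_on_def
  proof (intro ballI impI)
    fix p q assume "p \<in> P" "q \<in> P" "p \<noteq> q"
    then have "hilbert_ball C p \<rho> \<inter> hilbert_ball C q \<rho> = {}" by (intro separated_balls_disjoint PC P(4))
    then show "(?S \<inter> hilbert_ball C p \<rho>) \<inter> (?S \<inter> hilbert_ball C q \<rho>) = {}" by blast
  qed
  note le
  also have "(\<integral>\<^sup>+ s. (\<Sum>p\<in>P. w p s) \<partial>hausdorff_measure CARD('m)) \<le> (\<integral>\<^sup>+ s\<in>?S. area_density g C ?S s \<partial>hausdorff_measure CARD('m))"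
  proof (rule nn_integral_mono)
    fix s
    have "(\<Sum>p\<in>P. w p s) \<le> (\<Sum>p\<in>P. area_density g C ?S s * indicator (?S \<inter> hilbert_ball C p \<rho>) s)"
      by (intro sum_mono w(2))
    also have "\<dots> = area_density g C ?S s * (\<Sum>p\<in>P. indicator (?S \<inter> hilbert_ball C p \<rho>) s)"
      by (simp add: sum_distrib_left)
    also have "(\<Sum>p\<in>P. indicator (?S \<inter> hilbert_ball C p \<rho>) s) = (indicator (\<Union>p\<in>P. ?S \<inter> hilbert_ball C p \<rho>) s :: ennreal)"
      by (rule indicator_UN_disjoint[OF P(2) disjoint, symmetric])
    also have "area_density g C ?S s * \<dots> \<le> area_density g C ?S s * indicator ?S s"
      by (intro mult_left_mono) (auto simp: indicator_def)
    finally show "(\<Sum>p\<in>P. w p s) \<le> area_density g C ?S s * indicator ?S s" .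
  qed
  also have "\<dots> = hilbert_area g C ?S" by (simp add: hilbert_area_def area_density_def)
  finally show ?thesis .
qed

text \<open>A single point of the sphere is enough for counting measure; in dimension 1 the power of
  \<open>r\<close> in the final bound is 1.\<close>

lemma line_area_lower_bound:
  fixes C :: "(real^'n) set"
  assumes C: "properly_open_convex C" and x: "x \<in> C" and r: "0 \<le> r"
  shows "ennreal g \<le> hilbert_area_line g (hilbert_sphere C x r)"
proof -
  interpret properly_convex C by unfold_locales (rule C)
  have "hilbert_sphere C x r \<inter> UNIV \<noteq> {}"
    by (rule hilbert_sphere_meets[OF x, of _ x]) (use x r in \<open>auto simp: aff_dim_UNIV\<close>)
  then obtain s where s: "s \<in> hilbert_sphere C x r" by blast
  have "1 = emeasure (count_space UNIV) {s}" by simp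
  also have "\<dots> \<le> emeasure (count_space UNIV) (hilbert_sphere C x r)" using s by (intro emeasure_mono) auto
  finally have "ennreal g * 1 \<le> ennreal g * emeasure (count_space UNIV) (hilbert_sphere C x r)" by (rule mult_left_mono) simp
  then show ?thesis by (simp add: hilbert_area_line_def)
qed

theorem theorem3:
  "(\<forall>f :: (real^'n) set \<Rightarrow> real^'n \<Rightarrow> real. proper_density f \<longrightarrow>
      (\<exists>c_B>0. \<forall>(C :: (real^'n) set) x r. properly_open_convex C \<longrightarrow> x \<in> C \<longrightarrow> 0 \<le> r \<longrightarrow>
         ennreal (c_B * r ^ CARD('n)) \<le> emeasure (hilbert_measure f C) (hilbert_ball C x r)))
   \<and> (CARD('n) = CARD('m) + 1 \<longrightarrow>
      (\<forall>g :: (real^'m) set \<Rightarrow> real^'m \<Rightarrow> real. proper_density g \<longrightarrow>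
        (\<exists>c_S>0. \<forall>(C :: (real^'n) set) x r. properly_open_convex C \<longrightarrow> x \<in> C \<longrightarrow> 0 \<le> r \<longrightarrow>
           ennreal (c_S * r ^ (CARD('n) - 1)) \<le> hilbert_area g C (hilbert_sphere C x r))))
   \<and> (CARD('n) = 1 \<longrightarrow>
      (\<forall>g>0. \<exists>c_S>0. \<forall>(C :: (real^'n) set) x r. properly_open_convex C \<longrightarrow> x \<in> C \<longrightarrow> 0 \<le> r \<longrightarrow>
         ennreal (c_S * r ^ (CARD('n) - 1)) \<le> hilbert_area_line g (hilbert_sphere C x r)))"
proof (intro conjI impI allI)
  fix f :: "(real^'n) set \<Rightarrow> real^'n \<Rightarrow> real" assume f: "proper_density f"
  have "0 < f orthant 1"
    by (rule proper_density_pos[OF f properly_open_convex_orthant]) (simp add: orthant_def)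
  then show "\<exists>c_B>0. \<forall>(C :: (real^'n) set) x r. properly_open_convex C \<longrightarrow> x \<in> C \<longrightarrow> 0 \<le> r \<longrightarrow>
         ennreal (c_B * r ^ CARD('n)) \<le> emeasure (hilbert_measure f C) (hilbert_ball C x r)"
    by (intro exI[of _ "f orthant 1 / (32 * CARD('n)\<^sup>2) ^ CARD('n)"] conjI allI impI volume_lower_bound[OF f]) simp_all
next
  fix g :: "(real^'m) set \<Rightarrow> real^'m \<Rightarrow> real" assume dim: "CARD('n) = CARD('m) + 1" and g: "proper_density g"
  then have m: "CARD('n) - 1 = CARD('m)" by simp
  have "0 < g orthant 1"
    by (rule proper_density_pos[OF g properly_open_convex_orthant]) (simp add: orthant_def)
  then show "\<exists>c_S>0. \<forall>(C :: (real^'n) set) x r. properly_open_convex C \<longrightarrow> x \<in> C \<longrightarrow> 0 \<le> r \<longrightarrow>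
           ennreal (c_S * r ^ (CARD('n) - 1)) \<le> hilbert_area g C (hilbert_sphere C x r)"
    unfolding m
    by (intro exI[of _ "g orthant 1 / (768 * CARD('m)\<^sup>2) ^ CARD('m)"] conjI allI impI area_lower_bound[OF dim g]) simp_all
next
  fix g :: real assume "CARD('n) = 1" "0 < g"
  then show "\<exists>c_S>0. \<forall>(C :: (real^'n) set) x r. properly_open_convex C \<longrightarrow> x \<in> C \<longrightarrow> 0 \<le> r \<longrightarrow>
         ennreal (c_S * r ^ (CARD('n) - 1)) \<le> hilbert_area_line g (hilbert_sphere C x r)"
    using line_area_lower_bound by (intro exI[of _ g]) auto
qed

end
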